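(* Fix $q\in\mathbb{N}$ and $j$ with $1\le j\le q$, $(j,q)=1$; let $F_{j,q}(a)=e_q(ja)=e^{2\pi i ja/q}$. Let $P$ be a prime with $P\ge q$ and $\ell\in(P)$. Then $$\mathrm{Car}^{(P)}_\ell F_{j,q}=\mathrm{Car}_\ell F_{j,q}+\sum_{b\mid q}\frac{1}{b\varphi(q')}\sum_{\substack{\chi\ne\chi_0\\ (\bmod q')}}\tau(\overline\chi)\chi(j)\frac{\mu(q'')\chi(\ell'')}{\varphi(\ell')}\prod_{p\mid\ell''}\left(1-\overline\chi(p)\right)\frac{\prod_{p\le P}\left(1-\frac{\chi(p)}{p}\right)^{-1}}{\prod_{p\le P}\left(1-\frac1p\right)^{-1}},$$ where $q'=q/b$, $\ell'=\ell/(\ell,b)$, $q''=(\ell',q')$, $\ell''=\ell'/q''$, and the inner sum runs over the non-principal Dirichlet characters modulo $q'$. As a consequence, $$\mathrm{Car}^{(P)}_\ell F_{j,q}=\mathrm{Car}_\ell F_{j,q}+O_q\!\left(\frac1{\log P}\right)=\mathbf{1}_{\ell=q}\frac{1}{\varphi(q)}+O_q\!\left(\frac1{\log P}\right),$$ uniformly in $\ell\in\mathbb{N}$, with an implied constant depending at most on $q$.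
   Context: $e_q(x)=e^{2\pi i x/q}$. For $F:\mathbb{N}\to\mathbb{C}$, $F'=F*\mu$; $(P)$ is the set of $n\in\mathbb{N}$ with no prime factor $>P$. $c_\ell(a)$ is the Ramanujan sum, $\varphi$ Euler's totient, $\mu$ Möbius. Carmichael coefficients: $\mathrm{Car}_\ell F=\frac1{\varphi(\ell)}\lim_{x\to\infty}\frac1x\sum_{a\le x}F(a)c_\ell(a)$; $P$-smooth Carmichael coefficients: $\mathrm{Car}^{(P)}_\ell F=\frac1{\varphi(\ell)}\lim_{x\to\infty}\frac1x\sum_{a\le x}\Big(\sum_{d\in(P),\,d\mid a}F'(d)\Big)c_\ell(a)$. For a Dirichlet character $\chi$ modulo $q'$, $\chi_0$ is the principal character and $\tau(\chi)=\sum_{1\le m\le q',(m,q')=1}\chi(m)e_{q'}(m)$ is the Gauss sum; $\mathbf{1}_{\ell=q}$ is $1$ if $\ell=q$ and $0$ otherwise. *)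

theory Defs
  imports "HOL-Analysis.Analysis" "HOL-Number_Theory.Number_Theory"
    "HOL-Computational_Algebra.Squarefree"
begin

text \<open>
  Throughout, the natural numbers of the mathematics are the positive elements of \<^typ>\<open>nat\<close>;
  the value of an arithmetic function at \<open>0\<close> never matters.
\<close>

definition e_q :: "nat \<Rightarrow> real \<Rightarrow> complex" where
  "e_q q x = exp (2 * complex_of_real pi * \<i> * complex_of_real x / of_nat q)"

definition F_exp :: "nat \<Rightarrow> nat \<Rightarrow> nat \<Rightarrow> complex" where
  "F_exp j q a = e_q q (real (j * a))"

definition moebius_mu :: "nat \<Rightarrow> int" where
  "moebius_mu n = (if squarefree n then (-1) ^ card (prime_factors n) else 0)"

definition ramanujan_sum :: "nat \<Rightarrow> nat \<Rightarrow> complex" where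
  "ramanujan_sum l a = (\<Sum>k | 1 \<le> k \<and> k \<le> l \<and> coprime k l. e_q l (real (k * a)))"

definition smooth :: "nat \<Rightarrow> nat set" where
  "smooth P = {n. 1 \<le> n \<and> (\<forall>p. prime p \<longrightarrow> p dvd n \<longrightarrow> p \<le> P)}"

text \<open>The Eratosthenes transform \<open>F' = F * \<mu>\<close> (Dirichlet convolution).\<close>

definition eratosthenes :: "(nat \<Rightarrow> complex) \<Rightarrow> nat \<Rightarrow> complex" where
  "eratosthenes F n = (\<Sum>d | d dvd n. F d * of_int (moebius_mu (n div d)))"

definition smooth_part :: "nat \<Rightarrow> (nat \<Rightarrow> complex) \<Rightarrow> nat \<Rightarrow> complex" where
  "smooth_part P F a = (\<Sum>d | d \<in> smooth P \<and> d dvd a. eratosthenes F d)"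

definition Car_mean :: "nat \<Rightarrow> (nat \<Rightarrow> complex) \<Rightarrow> real \<Rightarrow> complex" where
  "Car_mean l F x = complex_of_real (1 / x) * (\<Sum>a = 1..nat \<lfloor>x\<rfloor>. F a * ramanujan_sum l a)"

text \<open>
  \<^const>\<open>Lim\<close> is unspecified when there is no limit, so existence of the limit is a separate
  predicate.
\<close>

definition Car_exists :: "nat \<Rightarrow> (nat \<Rightarrow> complex) \<Rightarrow> bool" where
  "Car_exists l F \<longleftrightarrow> (\<exists>L. (Car_mean l F \<longlongrightarrow> L) at_top)"

definition Car :: "nat \<Rightarrow> (nat \<Rightarrow> complex) \<Rightarrow> complex" where
  "Car l F = 1 / of_nat (totient l) * Lim at_top (Car_mean l F)"

definition Car_smooth_exists :: "nat \<Rightarrow> nat \<Rightarrow> (nat \<Rightarrow> complex) \<Rightarrow> bool" where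
  "Car_smooth_exists P l F \<longleftrightarrow> Car_exists l (smooth_part P F)"

definition Car_smooth :: "nat \<Rightarrow> nat \<Rightarrow> (nat \<Rightarrow> complex) \<Rightarrow> complex" where
  "Car_smooth P l F = Car l (smooth_part P F)"

text \<open>For \<open>n \<ge> 1\<close>, the Dirichlet characters modulo \<open>n\<close>, as functions on the non-negative integers.\<close>

definition dirichlet_chars :: "nat \<Rightarrow> (nat \<Rightarrow> complex) set" where
  "dirichlet_chars n =
     {chi. (\<forall>a b. chi (a * b) = chi a * chi b) \<and> (\<forall>a. chi (a + n) = chi a) \<and>
         (\<forall>a. chi a \<noteq> 0 \<longleftrightarrow> coprime a n)}"

definition principal_char :: "nat \<Rightarrow> nat \<Rightarrow> complex" where
  "principal_char n a = (if coprime a n then 1 else 0)"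

definition gauss_sum :: "nat \<Rightarrow> (nat \<Rightarrow> complex) \<Rightarrow> complex" where
  "gauss_sum n chi = (\<Sum>m | 1 \<le> m \<and> m \<le> n \<and> coprime m n. chi m * e_q n (real m))"

text \<open>Sums over \<^const>\<open>dirichlet_chars\<close> are genuine finite sums.\<close>

lemma principal_char_in_dirichlet_chars: "principal_char n \<in> dirichlet_chars n"
proof -
  have "coprime (a + n) n \<longleftrightarrow> coprime a n" for a
    by (metis coprime_iff_gcd_eq_1 gcd_add1)
  then show ?thesis
    by (auto simp: dirichlet_chars_def principal_char_def)
qed

lemma finite_dirichlet_chars:
  assumes n: "n \<ge> 1"
  shows "finite (dirichlet_chars n)"
proof -
  define R where "R = insert 0 {z :: complex. z ^ totient n = 1}"
  have "finite {z :: complex. z ^ totient n = 1}"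
    using n by (intro finite_roots_unity) (simp add: Suc_le_eq)
  then have fin: "finite ({..<n} \<rightarrow>\<^sub>E R)"
    by (auto simp: R_def intro!: finite_PiE)
  have per: "chi a = chi (a mod n)" if "chi \<in> dirichlet_chars n" for chi a
  proof -
    have "chi (b + k * n) = chi b" for b k
    proof (induction k)
      case (Suc k)
      have "chi (b + Suc k * n) = chi ((b + k * n) + n)"
        by (simp add: algebra_simps)
      also have "\<dots> = chi b"
        using that Suc by (simp add: dirichlet_chars_def)
      finally show ?case .
    qed simp
    from this[of "a mod n" "a div n"] show ?thesis
      by simp
  qed
  have val: "chi a \<in> R" if chi: "chi \<in> dirichlet_chars n" for chi a
  proof (cases "coprime a n")
    case True
    have mult: "chi (x * y) = chi x * chi y" for x y
      using chi by (simp add: dirichlet_chars_def)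
    have "chi 1 * chi 1 = chi 1" "chi 1 \<noteq> 0"
      using mult[of 1 1] chi by (auto simp: dirichlet_chars_def)
    then have one: "chi 1 = 1"
      by simp
    have pow: "chi (a ^ k) = chi a ^ k" for k
      using one by (induction k) (simp_all add: mult)
    have "[a ^ totient n = 1] (mod n)"
      using True by (rule euler_theorem)
    then have "chi (a ^ totient n) = chi 1"
      using per[OF chi, of "a ^ totient n"] per[OF chi, of 1] by (simp add: cong_def)
    then show ?thesis
      using one by (simp add: pow R_def)
  next
    case False
    then show ?thesis
      using chi by (auto simp: dirichlet_chars_def R_def)
  qed
  have inj: "inj_on (\<lambda>chi. restrict chi {..<n}) (dirichlet_chars n)"
  proof (rule inj_onI, rule ext)
    fix chi \<psi> a
    assume mem: "chi \<in> dirichlet_chars n" "\<psi> \<in> dirichlet_chars n"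
      and eq: "restrict chi {..<n} = restrict \<psi> {..<n}"
    have "a mod n < n"
      using n by simp
    then have "chi (a mod n) = \<psi> (a mod n)"
      using fun_cong[OF eq, of "a mod n"] by simp
    then show "chi a = \<psi> a"
      using per[OF mem(1), of a] per[OF mem(2), of a] by simp
  qed
  have "(\<lambda>chi. restrict chi {..<n}) ` dirichlet_chars n \<subseteq> {..<n} \<rightarrow>\<^sub>E R"
    using val by (auto split: if_splits)
  then show ?thesis
    using inj fin by (blast intro: inj_on_finite)
qed

end

theory Submission
  imports Defs
begin

text \<open>
  Write \<open>a = s * m\<close> with \<open>s\<close> the \<open>P\<close>-smooth part of \<open>a\<close>. By Moebius inversion the truncated
  divisor sum of \<open>F'\<close> at \<open>a\<close> is just \<open>F s\<close>, so the smooth Carmichael coefficient is the mean of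
  \<open>F s * c_l (s * m)\<close>. Summing over \<open>s\<close> with Tannery's theorem, this mean vanishes if \<open>l\<close> is not
  \<open>P\<close>-smooth, and otherwise equals the product of all \<open>1 - 1 / p\<close>, \<open>p \<le> P\<close>, times the sum of
  \<open>F s * c_l s / s\<close> over all smooth \<open>s\<close>. For \<open>F s = e_q (j * s)\<close> one splits by \<open>b = gcd s q\<close> and
  expands \<open>e_{q/b}\<close> into Dirichlet characters; Hoelder's formula for \<open>c_l\<close> then turns each character
  sum into a finite Euler product. The principal characters contribute \<open>1 / \<phi> q\<close> if \<open>l = q\<close> and \<open>0\<close>
  otherwise, which is the ordinary Carmichael coefficient. For the other characters the Euler
  products over \<open>p \<le> P\<close> stay bounded, while the product of all \<open>1 - 1 / p\<close> is at most \<open>1 / ln P\<close>.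
\<close>

subsection \<open>Exponentials, the Moebius function and Ramanujan sums\<close>


text \<open>Uniformity in \<open>l\<close> is the delicate point. The product over the primes of
  \<open>l''\<close> can have size 2 to their number, and only the factor 1 /
  \<phi>(\<open>l'\<close>) can absorb it; it does, because 2 \<le> p - 1 for every prime except 2.
  An index \<open>l\<close> that is not smooth lies outside the exact formula, but then both
  coefficients are 0, since P \<ge> q rules out l = q. The condition P \<ge> q also makes every b
  dividing q smooth and puts all primes of q into the Euler products. The shapes of
  \<open>l'\<close>, \<open>q''\<close> and \<open>l''\<close> come from Hoelder's formula:
  \<open>c_l\<close>(a) / \<phi>(l) depends only on l / gcd(l, a). Taking b out of the argument
  replaces l by \<open>l'\<close>; for t coprime to \<open>q'\<close>, the part \<open>q''\<close>
  shares nothing with t, so only \<open>l''\<close> interacts with it. The exponent shift is d = 1 /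
  ln P because the sum of ln p / p over p \<le> P is O(ln P): the differences 1/p - p^(-1-d) with p
  \<le> P then sum to O(1), and so do the terms p^(-1-d) with p > P.\<close>

lemma e_q_cis: "e_q n x = cis (2 * pi * x / real n)"
  by (simp add: e_q_def cis_conv_exp mult_ac)

lemma norm_e_q [simp]: "norm (e_q n x) = 1"
  by (simp add: e_q_cis)

lemma e_q_nonzero [simp]: "e_q n x \<noteq> 0"
  by (simp add: e_q_cis)

lemma e_q_0 [simp]: "e_q n 0 = 1"
  by (simp add: e_q_cis)

lemma e_q_add: "e_q n (x + y) = e_q n x * e_q n y"
  by (simp add: e_q_cis cis_mult ring_distribs add_divide_distrib)

lemma e_q_power: "e_q n x ^ k = e_q n (real k * x)"
  unfolding e_q_cis Complex.DeMoivre by (rule arg_cong[of _ _ cis]) simp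

lemma e_q_cancel: "b > 0 \<Longrightarrow> e_q (b * n) (real b * x) = e_q n x"
  unfolding e_q_cis by (rule arg_cong[of _ _ cis]) simp

lemma e_q_eq_1_iff:
  assumes "n > 0"
  shows "e_q n (real k) = 1 \<longleftrightarrow> n dvd k"
proof
  assume "n dvd k"
  then obtain m where "k = n * m" ..
  then show "e_q n (real k) = 1"
    using assms cis_multiple_2pi[of "real m"] by (simp add: e_q_cis mult_ac)
next
  assume "e_q n (real k) = 1"
  then obtain m :: int where "2 * pi * real k / real n = 2 * pi * of_int m"
    by (auto simp: e_q_cis complex_eq_iff cos_one_2pi_int mult_ac)
  then have "real k = real n * of_int m"
    using assms by (simp add: field_simps)
  then have "of_int (int k) = (of_int (int n * m) :: real)"
    by simp
  then have "int k = int n * m"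
    by (simp only: of_int_eq_iff)
  then show "n dvd k"
    by (metis dvd_triv_left int_dvd_int_iff)
qed

lemma e_q_periodic: "n > 0 \<Longrightarrow> n dvd k \<Longrightarrow> e_q n (real (m + k)) = e_q n (real m)"
  using e_q_eq_1_iff[of n k] by (simp add: e_q_add)

lemma e_q_cong:
  assumes "n > 0" "[a = b] (mod n)"
  shows "e_q n (real a) = e_q n (real b)"
proof -
  have "e_q n (real (m mod n)) = e_q n (real m)" for m
    using e_q_periodic[of n "n * (m div n)" "m mod n"] assms(1) by simp
  then show ?thesis
    using assms(2) by (metis cong_def)
qed

lemma sum_e_q:
  assumes "n > 0"
  shows "(\<Sum>i<n. e_q n (real (i * k))) = (if n dvd k then of_nat n else 0)"
proof -
  have "(\<Sum>i<n. e_q n (real (i * k))) = (\<Sum>i<n. e_q n (real k) ^ i)"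
    by (simp add: e_q_power)
  also have "\<dots> = (if n dvd k then of_nat n else 0)"
  proof (cases "n dvd k")
    case True
    then show ?thesis
      using e_q_eq_1_iff[OF assms, of k] by simp
  next
    case False
    have "e_q n (real k) ^ n = 1"
      using e_q_eq_1_iff[OF assms, of "n * k"] by (simp add: e_q_power)
    moreover have "e_q n (real k) \<noteq> 1"
      using False e_q_eq_1_iff[OF assms, of k] by simp
    ultimately show ?thesis
      using False by (simp add: geometric_sum)
  qed
  finally show ?thesis .
qed

lemma sum_e_q_atLeastAtMost:
  assumes "n > 0"
  shows "(\<Sum>i=1..n. e_q n (real (i * k))) = (if n dvd k then of_nat n else 0)"
proof -
  have "(\<Sum>i=1..n. e_q n (real (i * k))) = (\<Sum>i<n. e_q n (real (Suc i * k)))"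
    by (rule sum.reindex_bij_witness[of _ Suc "\<lambda>i. i - 1"]) auto
  also have "\<dots> = e_q n (real k) * (\<Sum>i<n. e_q n (real (i * k)))"
    by (simp add: sum_distrib_left e_q_add [symmetric] algebra_simps)
  \<comment> \<open>The factor produced by the shift is 1 if n divides k; otherwise it multiplies a
    sum that is 0.\<close>
  also have "\<dots> = (if n dvd k then of_nat n else 0)"
    using e_q_eq_1_iff[OF assms, of k] by (simp only: sum_e_q[OF assms]) simp
  finally show ?thesis .
qed

section \<open>The Moebius function and sums over divisors\<close>

lemma prime_factors_prod_primes:
  fixes X :: "nat set"
  assumes "finite X" "\<And>p. p \<in> X \<Longrightarrow> prime p"
  shows "prime_factors (\<Prod>X) = X"
  using assms
proof (induction X rule: finite_induct)
  case (insert p X)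
  have "\<Prod>X \<noteq> 0" "p \<noteq> 0"
    using insert by (auto dest: prime_gt_0_nat)
  then show ?case
    using insert by (simp add: prime_factors_product prime_factorization_prime)
qed simp

lemma squarefree_prod_primes:
  fixes X :: "nat set"
  assumes "\<And>p. p \<in> X \<Longrightarrow> prime p"
  shows "squarefree (\<Prod>X)"
  using assms by (intro squarefree_prod_coprime) (auto intro: primes_coprime squarefree_prime)

lemma prod_prime_factors_squarefree:
  fixes d :: nat
  assumes "squarefree d"
  shows "\<Prod>(prime_factors d) = d"
proof -
  have "d \<noteq> 0"
    using assms by (intro notI) simp
  have "(\<Prod>p\<in>prime_factors d. p ^ multiplicity p d) = \<Prod>(prime_factors d)"
    using squarefree_factorial_semiring''[OF \<open>d \<noteq> 0\<close>] assms
    by (intro prod.cong refl) (auto simp: prime_factors_multiplicity le_Suc_eq dest!: spec)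
  then show ?thesis
    using \<open>d \<noteq> 0\<close> prime_factorization_nat[of d] by simp
qed

text \<open>Expanding the product over subsets of the prime factors gives one term for each
  squarefree divisor, namely the product of the subset, and \<mu> vanishes on all other divisors.
  Later \<open>g\<close> is the constant 1, the function 1/d with or without a coprimality
  condition, or a conjugate character.\<close>

lemma sum_divisors_moebius:
  fixes g :: "nat \<Rightarrow> complex"
  assumes mult: "\<And>a b. g (a * b) = g a * g b" and one: "g 1 = 1" and n: "n > 0"
  shows "(\<Sum>d | d dvd n. of_int (moebius_mu d) * g d) = (\<Prod>p\<in>prime_factors n. 1 - g p)"
proof -
  have g_prod: "g (\<Prod>X) = (\<Prod>x\<in>X. g x)" for X :: "nat set"
    using one by (induction X rule: infinite_finite_induct) (auto simp: mult)
  have fin: "finite {d. d dvd n}"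
    using n by simp
  have "(\<Prod>p\<in>prime_factors n. 1 - g p) = (\<Prod>p\<in>prime_factors n. - g p + 1)"
    by simp
  also have "\<dots> = (\<Sum>X\<in>Pow (prime_factors n). \<Prod>x\<in>X. - g x)"
    by (subst prod_add) auto
  also have "\<dots> = (\<Sum>d | d dvd n \<and> squarefree d. of_int (moebius_mu d) * g d)"
  proof (rule sum.reindex_bij_witness[of _ "prime_factors" "\<lambda>X. \<Prod>X"])
    fix X assume X: "X \<in> Pow (prime_factors n)"
    then have fX: "finite X"
      by (auto intro: finite_subset)
    have pX: "\<And>p. p \<in> X \<Longrightarrow> prime p"
      using X by auto
    show pf: "prime_factors (\<Prod>X) = X"
      using fX pX by (rule prime_factors_prod_primes)
    have sq: "squarefree (\<Prod>X)"
      using pX by (rule squarefree_prod_primes)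
    have "\<Prod>X dvd \<Prod>(prime_factors n)"
      using X by (intro prod_dvd_prod_subset) auto
    also have "\<dots> dvd (\<Prod>p\<in>prime_factors n. p ^ multiplicity p n)"
      by (intro prod_dvd_prod) (auto simp: prime_factors_multiplicity intro: dvd_power)
    also have "\<dots> = n"
      using n prime_factorization_nat[of n] by simp
    finally show "\<Prod>X \<in> {d. d dvd n \<and> squarefree d}"
      using sq by simp
    show "of_int (moebius_mu (\<Prod>X)) * g (\<Prod>X) = (\<Prod>x\<in>X. - g x)"
      using sq pf by (simp add: moebius_mu_def g_prod prod_uminus)
  next
    fix d assume d: "d \<in> {d. d dvd n \<and> squarefree d}"
    then show "\<Prod>(prime_factors d) = d"
      by (simp add: prod_prime_factors_squarefree)
    show "prime_factors d \<in> Pow (prime_factors n)"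
      using d n by (auto intro: dvd_prime_factors[THEN subsetD])
  qed
  also have "\<dots> = (\<Sum>d | d dvd n. of_int (moebius_mu d) * g d)"
    using fin by (intro sum.mono_neutral_left) (auto simp: moebius_mu_def)
  finally show ?thesis ..
qed

lemma sum_moebius_divisors:
  assumes "n > 0"
  shows "(\<Sum>d | d dvd n. of_int (moebius_mu d) :: complex) = (if n = 1 then 1 else 0)"
proof -
  have "(\<Sum>d | d dvd n. of_int (moebius_mu d) :: complex) = (\<Prod>p\<in>prime_factors n. 0)"
    using sum_divisors_moebius[of "\<lambda>_. 1" n] assms by simp
  \<comment> \<open>A product of zeros is 1 exactly when it is empty, that is, when \<open>n\<close>
    has no prime factor.\<close>
  also have "\<dots> = (if n = 1 then 1 else 0)"
    using assms prime_factorization_empty_iff[of n] by (auto simp: power_0_left card_eq_0_iff)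
  finally show ?thesis .
qed

lemma moebius_mu_1 [simp]: "moebius_mu 1 = 1" "moebius_mu (Suc 0) = 1"
  by (simp_all add: moebius_mu_def)

lemma moebius_mu_mult_coprime:
  assumes "coprime a b"
  shows "moebius_mu (a * b) = moebius_mu a * moebius_mu b"
proof (cases "squarefree a \<and> squarefree b")
  case True
  then have "a \<noteq> 0" "b \<noteq> 0"
    by (metis not_squarefree_0)+
  have "prime_factors a \<inter> prime_factors b = {}"
    using assms by (metis disjoint_iff coprime_common_divisor in_prime_factors_imp_dvd
        in_prime_factors_imp_prime not_prime_unit)
  then have "card (prime_factors (a * b)) = card (prime_factors a) + card (prime_factors b)"
    using \<open>a \<noteq> 0\<close> \<open>b \<noteq> 0\<close> by (simp add: prime_factors_product card_Un_disjoint)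
  then show ?thesis
    using True squarefree_mult_coprime[OF assms] by (simp add: moebius_mu_def power_add)
next
  case False
  then show ?thesis
    using squarefree_multD[of a b] by (auto simp: moebius_mu_def)
qed

lemma moebius_mu_not_coprime: "\<not> coprime a b \<Longrightarrow> moebius_mu (a * b) = 0"
proof -
  assume "\<not> coprime a b"
  then obtain d where "d dvd a" "d dvd b" "\<not> is_unit d"
    by (auto simp: coprime_def)
  then have "d ^ 2 dvd a * b"
    by (simp add: power2_eq_square mult_dvd_mono)
  then show ?thesis
    using \<open>\<not> is_unit d\<close> not_squarefreeI[of d "a * b"] by (simp add: moebius_mu_def)
qed

lemma norm_moebius_mu_le: "norm (of_int (moebius_mu n) :: complex) \<le> 1"
  by (simp add: moebius_mu_def norm_power)

lemma sum_divisors_flip: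
  fixes n :: nat and f :: "nat \<Rightarrow> 'a :: comm_monoid_add"
  assumes "n > 0"
  shows "(\<Sum>d | d dvd n. f (n div d)) = (\<Sum>d | d dvd n. f d)"
  by (rule sum.reindex_bij_witness[of _ "\<lambda>d. n div d" "\<lambda>d. n div d"])
     (use assms in \<open>auto simp: div_dvd_iff_mult dvd_div_mult_self elim!: dvdE\<close>)

text \<open>Moebius inversion: with d = e * k the double sum becomes a sum over e, whose inner sum
  of \<mu> over the divisors of \<open>n div e\<close> leaves only e = n.\<close>

lemma sum_eratosthenes:
  assumes "n > 0"
  shows "(\<Sum>d | d dvd n. eratosthenes F d) = F n"
proof -
  have fin: "finite {d. d dvd n}"
    using assms by simp
  have "(\<Sum>d | d dvd n. eratosthenes F d) =
      (\<Sum>(d, e)\<in>(SIGMA d:{d. d dvd n}. {e. e dvd d}). F e * of_int (moebius_mu (d div e)))"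
    unfolding eratosthenes_def using assms
    by (subst sum.Sigma) (auto intro: finite_divisors_nat dvd_pos_nat)
  also have "\<dots> = (\<Sum>(e, k)\<in>(SIGMA e:{e. e dvd n}. {k. k dvd n div e}). F e * of_int (moebius_mu k))"
    using assms
    by (intro sum.reindex_bij_witness[of _ "\<lambda>(e, k). (e * k, e)" "\<lambda>(d, e). (e, d div e)"])
       (auto elim!: dvdE)
  also have "\<dots> = (\<Sum>e | e dvd n. \<Sum>k | k dvd n div e. F e * of_int (moebius_mu k))"
    using assms by (subst sum.Sigma) (auto intro!: finite_divisors_nat simp: dvd_div_eq_0_iff)
  also have "\<dots> = (\<Sum>e | e dvd n. if e = n then F e else 0)"
  proof (rule sum.cong)
    fix e assume "e \<in> {e. e dvd n}"
    then obtain k where k: "n = e * k"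
      by auto
    then have "e > 0" "k > 0"
      using assms by auto
    then have "n div e = 1 \<longleftrightarrow> e = n" "n div e > 0"
      using k by auto
    then show "(\<Sum>k | k dvd n div e. F e * of_int (moebius_mu k)) = (if e = n then F e else 0)"
      by (simp only: sum_distrib_left [symmetric] sum_moebius_divisors) simp
  qed simp
  also have "\<dots> = F n"
    using fin by (simp add: sum.delta')
  finally show ?thesis .
qed

section \<open>Ramanujan sums\<close>

text \<open>Coprimality of k and l is detected by summing \<mu> over their common divisors d. For l
  = d * m, the multiples k = d * i form a complete exponential sum modulo m, equal to m or 0
  according to whether m divides \<open>a\<close>.\<close>

lemma ramanujan_sum_divisors:
  assumes "l > 0"
  shows "ramanujan_sum l a = (\<Sum>d | d dvd l.
      if d dvd a then of_nat d * of_int (moebius_mu (l div d)) else 0)"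
proof -
  have "ramanujan_sum l a = (\<Sum>k=1..l. if coprime k l then e_q l (real (k * a)) else 0)"
    unfolding ramanujan_sum_def by (rule sum.mono_neutral_cong_left) auto
  also have "\<dots> = (\<Sum>k=1..l. \<Sum>d | d dvd l.
      if d dvd k then of_int (moebius_mu d) * e_q l (real (k * a)) else 0)"
  proof (rule sum.cong)
    fix k assume "k \<in> {1..l}"
    then have "k > 0" "gcd k l > 0"
      by auto
    have "(\<Sum>d | d dvd l. if d dvd k then of_int (moebius_mu d) * e_q l (real (k * a)) else 0)
        = (\<Sum>d | d dvd gcd k l. of_int (moebius_mu d) * e_q l (real (k * a)))"
      using assms by (intro sum.mono_neutral_cong_right) auto
    also have "\<dots> = (if coprime k l then e_q l (real (k * a)) else 0)"
      unfolding sum_distrib_right [symmetric] sum_moebius_divisors[OF \<open>gcd k l > 0\<close>]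
      by (cases "gcd k l = 1") (simp_all only: coprime_iff_gcd_eq_1 if_True if_False mult_1
          mult_zero_left simp_thms)
    finally show "(if coprime k l then e_q l (real (k * a)) else 0)
        = (\<Sum>d | d dvd l. if d dvd k then of_int (moebius_mu d) * e_q l (real (k * a)) else 0)" ..
  qed simp
  also have "\<dots> = (\<Sum>d | d dvd l. \<Sum>k=1..l.
      if d dvd k then of_int (moebius_mu d) * e_q l (real (k * a)) else 0)"
    by (rule sum.swap)
  also have "\<dots> = (\<Sum>d | d dvd l. if l div d dvd a then of_int (moebius_mu d) * of_nat (l div d)
      else 0)"
  proof (rule sum.cong)
    fix d assume "d \<in> {d. d dvd l}"
    then obtain m where m: "l = d * m"
      by auto
    with assms have pos: "d > 0" "m > 0"
      by auto
    have "(\<Sum>k=1..l. if d dvd k then of_int (moebius_mu d) * e_q l (real (k * a)) else 0)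
        = (\<Sum>k | k \<in> {1..l} \<and> d dvd k. of_int (moebius_mu d) * e_q l (real (k * a)))"
      by (rule sum.mono_neutral_cong_right) auto
    also have "\<dots> = (\<Sum>i=1..m. of_int (moebius_mu d) * e_q m (real (i * a)))"
    proof (rule sum.reindex_bij_witness[of _ "\<lambda>i. d * i" "\<lambda>k. k div d"])
      fix k assume "k \<in> {k \<in> {1..l}. d dvd k}"
      then obtain i where i: "k = d * i" "k \<ge> 1" "k \<le> l"
        by auto
      show "d * (k div d) = k"
        using i by simp
      show "k div d \<in> {1..m}"
        using i m pos by auto
      show "of_int (moebius_mu d) * e_q m (real (k div d * a))
          = of_int (moebius_mu d) * e_q l (real (k * a))"
        using i m pos e_q_cancel[of d m "real (i * a)"] by (simp add: mult_ac)
    qed (use m pos in auto)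
    also have "\<dots> = (if l div d dvd a then of_int (moebius_mu d) * of_nat (l div d) else 0)"
      using sum_e_q_atLeastAtMost[OF \<open>m > 0\<close>, of a] m pos
          by (simp add: sum_distrib_left [symmetric])
    finally show "(\<Sum>k=1..l. if d dvd k then of_int (moebius_mu d) * e_q l (real (k * a)) else 0)
        = (if l div d dvd a then of_int (moebius_mu d) * of_nat (l div d) else 0)" .
  qed simp
  also have "\<dots> = (\<Sum>d | d dvd l. (\<lambda>e. if e dvd a then of_nat e * of_int (moebius_mu (l div e))
      else 0) (l div d))"
    using assms by (intro sum.cong) (auto elim!: dvdE)
  also have "\<dots> = (\<Sum>d | d dvd l. if d dvd a then of_nat d * of_int (moebius_mu (l div d)) else 0)"
    by (rule sum_divisors_flip[OF assms])
  finally show ?thesis .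
qed

lemma of_nat_totient:
  "(of_nat (totient n) :: complex) = of_nat n * (\<Prod>p\<in>prime_factors n. 1 - 1 / of_nat p)"
  using arg_cong[OF totient_formula2[of n], of complex_of_real] by simp

text \<open>Let l = g * n with g = gcd l a. Only divisors of g contribute to the divisor formula;
  writing them as \<open>g div e\<close> leaves \<mu>(e * n), which factors if e and n are coprime
  and is 0 otherwise. The sum over e is then a product over the primes of g not dividing n, and the
  same product occurs in \<phi>(l).\<close>

lemma ramanujan_sum_hoelder:
  assumes "l > 0"
  shows "ramanujan_sum l a / of_nat (totient l) =
    of_int (moebius_mu (l div gcd l a)) / of_nat (totient (l div gcd l a))"
proof -
  define g where "g = gcd l a"
  obtain n where n: "l = g * n"
    unfolding g_def by (meson dvdE gcd_dvd1)
  have pos: "g > 0" "n > 0"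
    using n assms by auto
  \<comment> \<open>The condition that e and n be coprime is built into 1/e; the result is still
    completely multiplicative.\<close>
  define h :: "nat \<Rightarrow> complex" where "h e = (if coprime e n then 1 / of_nat e else 0)" for e
  have "ramanujan_sum l a = (\<Sum>d | d dvd g. of_nat d * of_int (moebius_mu (l div d)))"
    unfolding ramanujan_sum_divisors[OF assms] using assms pos
    by (intro sum.mono_neutral_cong_right) (auto simp: g_def)
  also have "\<dots> = (\<Sum>e | e dvd g. of_nat (g div e) * of_int (moebius_mu (l div (g div e))))"
    by (rule sum_divisors_flip[OF pos(1), symmetric])
  also have "\<dots> = (\<Sum>e | e dvd g. of_nat g * of_int (moebius_mu n) * (of_int (moebius_mu e) * h e))"
  proof (rule sum.cong)
    fix e assume "e \<in> {e. e dvd g}"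
    then obtain k where k: "g = e * k"
      by auto
    then have "e > 0" "k > 0"
      using pos by auto
    moreover have "moebius_mu (e * n) = (if coprime e n then moebius_mu e * moebius_mu n else 0)"
      by (simp add: moebius_mu_mult_coprime moebius_mu_not_coprime)
    moreover have "l div k = e * n" "g div e = k"
      using n k \<open>k > 0\<close> \<open>e > 0\<close> by (auto simp: mult_ac)
    ultimately show "of_nat (g div e) * of_int (moebius_mu (l div (g div e))) =
        of_nat g * of_int (moebius_mu n) * (of_int (moebius_mu e) * h e)"
      using k by (simp add: h_def)
  qed simp
  also have "\<dots> = of_nat g * of_int (moebius_mu n) * (\<Prod>p\<in>prime_factors g. 1 - h p)"
    using sum_divisors_moebius[of h g] pos by (simp add: sum_distrib_left [symmetric] h_def)
  finally have c: "ramanujan_sum l a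
      = of_nat g * of_int (moebius_mu n) * (\<Prod>p\<in>prime_factors g. 1 - h p)" .
  \<comment> \<open>Primes of g that divide n are already counted with n; \<open>h\<close> vanishes
    at them, so they contribute the factor 1 to the product over g.\<close>
  have pf: "prime_factors l = prime_factors n \<union> prime_factors g"
    using n pos by (simp add: prime_factors_product Un_commute)
  have "(\<Prod>p\<in>prime_factors l. 1 - 1 / of_nat p :: complex) =
      (\<Prod>p\<in>prime_factors n. 1 - 1 / of_nat p) * (\<Prod>p\<in>prime_factors g - prime_factors n. 1 - 1 /
          of_nat p)"
    unfolding pf by (subst prod.union_disjoint [symmetric]) (auto intro!: prod.cong)
  also have "(\<Prod>p\<in>prime_factors g - prime_factors n. 1 - 1 / of_nat p :: complex)
      = (\<Prod>p\<in>prime_factors g. 1 - h p)"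
    using pos by (intro prod.mono_neutral_cong_left)
      (auto simp: h_def prime_factors_dvd dest: prime_imp_coprime_nat coprime_absorb_left[THEN
          iffD1, rotated])
  finally have "of_nat (totient l) = of_nat g * (\<Prod>p\<in>prime_factors g. 1 - h p) * of_nat (totient n)"
    using n by (simp add: of_nat_totient)
  moreover have "of_nat (totient l) \<noteq> (0 :: complex)"
    using assms by simp
  moreover have "l div gcd l a = n"
    using n pos unfolding g_def [symmetric] by simp
  ultimately show ?thesis
    using c by (auto simp: field_simps)
qed

subsection \<open>Smooth numbers and finite Euler products\<close>


lemma one_in_smooth [simp]: "1 \<in> smooth P" "Suc 0 \<in> smooth P"
  by (auto simp: smooth_def)

lemma zero_notin_smooth [simp]: "0 \<notin> smooth P"
  by (auto simp: smooth_def)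

lemma smooth_pos: "n \<in> smooth P \<Longrightarrow> n > 0"
  by (auto simp: smooth_def)

lemma smooth_mult_iff: "a * b \<in> smooth P \<longleftrightarrow> a \<in> smooth P \<and> b \<in> smooth P"
  by (auto simp: smooth_def prime_dvd_mult_iff)

lemma smooth_dvd: "n \<in> smooth P \<Longrightarrow> d dvd n \<Longrightarrow> d \<in> smooth P"
  by (auto simp: smooth_mult_iff elim!: dvdE)

lemma le_in_smooth: "1 \<le> n \<Longrightarrow> n \<le> P \<Longrightarrow> n \<in> smooth P"
  by (auto simp: smooth_def dest!: dvd_imp_le)

lemma prime_in_smooth_iff: "prime p \<Longrightarrow> p \<in> smooth P \<longleftrightarrow> p \<le> P"
  by (auto simp: smooth_def dest: primes_dvd_imp_eq prime_ge_1_nat)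

lemma finite_primes_le [simp]: "finite {p. prime p \<and> p \<le> (P::nat)}"
  by (rule finite_subset[of _ "{..P}"]) auto

text \<open>Induction on the bound: a new prime p multiplies the sum by a geometric series, since
  each smooth number is uniquely p ^ k * m with m smooth for the old bound. Absolute summability is
  carried through the induction because the double series requires it.\<close>

lemma euler_product_smooth:
  fixes f :: "nat \<Rightarrow> 'a :: {real_normed_field, banach}"
  assumes mult: "\<And>a b. f (a * b) = f a * f b" and one: "f 1 = 1"
    and small: "\<And>p. prime p \<Longrightarrow> p \<le> N \<Longrightarrow> norm (f p) < 1"
  shows "(f has_sum (\<Prod>p | prime p \<and> p \<le> N. inverse (1 - f p))) (smooth N)"
    and "f abs_summable_on smooth N"
proof -
  have pow: "f (p ^ k) = f p ^ k" for p k
    using one by (induction k) (auto simp: mult)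
  have "(f has_sum (\<Prod>p | prime p \<and> p \<le> N. inverse (1 - f p))) (smooth N) \<and>
      f abs_summable_on smooth N"
    using small
  proof (induction N)
    case 0
    have "n = 1" if "n \<in> smooth 0" for n
      using that prime_factor_nat[of n] by (auto simp: smooth_def dest: prime_gt_0_nat)
    then have "smooth 0 = {1}"
      by auto
    moreover have none: "{p::nat. prime p \<and> p \<le> 0} = {}"
      by (auto dest: prime_gt_0_nat)
    ultimately show ?case
      unfolding none using one has_sum_finite[of "{Suc 0}" f] by simp
  next
    case (Suc N)
    then have IH: "(f has_sum (\<Prod>p | prime p \<and> p \<le> N. inverse (1 - f p))) (smooth N)"
        "f abs_summable_on smooth N"
      by auto
    show ?case
    proof (cases "prime (Suc N)")
      case False
      then have "p \<le> Suc N \<longleftrightarrow> p \<le> N" if "prime p" for p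
        using that by (auto simp: le_Suc_eq)
      then have "{p. prime p \<and> p \<le> Suc N} = {p. prime p \<and> p \<le> N}" "smooth (Suc N) = smooth N"
        by (auto simp: smooth_def)
      then show ?thesis
        using IH by simp
    next
      case True
      define p where "p = Suc N"
      have p: "prime p"
        using True by (simp add: p_def)
      define E where "E = (\<Prod>p | prime p \<and> p \<le> N. inverse (1 - f p))"
      have fp: "norm (f p) < 1"
        using Suc.prems p by (simp add: p_def)
      have notdvd: "\<not> p dvd m" if "m \<in> smooth N" for m
        using that p by (auto simp: smooth_def p_def)
      have geo: "((\<lambda>k. f p ^ k) has_sum (1 / (1 - f p))) UNIV"
        using fp by (intro norm_summable_imp_has_sum geometric_sums)
          (simp_all add: norm_power summable_geometric)
      \<comment> \<open>Absolute convergence on the product set is what permits evaluating the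
        double sum one variable at a time.\<close>
      have sum: "(\<lambda>(k, m). f p ^ k * f m) abs_summable_on (UNIV \<times> smooth N)"
      proof (rule summable_on_SigmaI)
        show "((\<lambda>m. norm ((\<lambda>(k, m). f p ^ k * f m) (k, m))) has_sum
            norm (f p) ^ k * infsum (\<lambda>m. norm (f m)) (smooth N)) (smooth N)" for k
          using IH(2) by (auto simp: norm_mult norm_power intro!: has_sum_cmult_right
              has_sum_infsum)
        have "(\<lambda>k. norm (f p) ^ k) summable_on UNIV"
          using fp by (intro summable_nonneg_imp_summable_on) (simp_all add: summable_geometric)
        then show "(\<lambda>k. norm (f p) ^ k * infsum (\<lambda>m. norm (f m)) (smooth N)) summable_on UNIV"
          by (rule summable_on_cmult_left)
      qed simp
      have prod: "((\<lambda>(k, m). f p ^ k * f m) has_sum (1 / (1 - f p) * E)) (UNIV \<times> smooth N)"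
      proof (rule has_sum_SigmaI)
        show "((\<lambda>m. (\<lambda>(k, m). f p ^ k * f m) (k, m)) has_sum f p ^ k * E) (smooth N)" for k
          using IH(1) by (auto simp: E_def intro!: has_sum_cmult_right)
        show "((\<lambda>k. f p ^ k * E) has_sum 1 / (1 - f p) * E) UNIV"
          using geo by (rule has_sum_cmult_left)
        show "(\<lambda>(k, m). f p ^ k * f m) summable_on UNIV \<times> smooth N"
          using sum by (rule abs_summable_summable)
      qed
      have mult_p: "multiplicity p (p ^ k * m) = k" if "m \<in> smooth N" for k m
        using notdvd[OF that] p smooth_pos[OF that]
        by (simp add: prime_elem_multiplicity_mult_distrib not_dvd_imp_multiplicity_0
              multiplicity_prime_power)
      have mem1: "p ^ k * m \<in> smooth (Suc N)" if m: "m \<in> smooth N" for k m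
      proof -
        have "p \<in> smooth (Suc N)"
          using prime_in_smooth_iff[OF p, of "Suc N"] by (simp add: p_def)
        then have "p ^ k \<in> smooth (Suc N)"
          by (induction k) (auto simp: smooth_mult_iff)
        moreover have "m \<in> smooth (Suc N)"
          using m by (auto simp: smooth_def intro: le_SucI)
        ultimately show ?thesis
          by (simp add: smooth_mult_iff)
      qed
      have mem2: "n div p ^ multiplicity p n \<in> smooth N" if n: "n \<in> smooth (Suc N)" for n
      proof -
        obtain m where m: "n = p ^ multiplicity p n * m" "\<not> p dvd m"
          using p smooth_pos[OF n] multiplicity_decompose'[of n p]
          by (metis not_prime_unit less_numeral_extra(3))
        have "m \<in> smooth (Suc N)"
          using n m(1) by (metis smooth_mult_iff)
        then have "m \<in> smooth N"
          using m(2) by (auto simp: smooth_def p_def le_Suc_eq)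
        moreover have "n div p ^ multiplicity p n = m"
          using m(1) p by (metis nonzero_mult_div_cancel_left power_not_zero not_prime_0)
        ultimately show ?thesis
          by simp
      qed
      \<comment> \<open>The inverse reads off the exponent of p and the remaining cofactor.\<close>
      have bij: "bij_betw (\<lambda>(k, m). p ^ k * m) (UNIV \<times> smooth N) (smooth (Suc N))"
        by (rule bij_betw_byWitness[of _ "\<lambda>n. (multiplicity p n, n div p ^ multiplicity p n)"])
           (use p mult_p mem1 mem2 in \<open>auto simp: multiplicity_dvd prime_gt_0_nat\<close>)
      have "((\<lambda>x. f ((\<lambda>(k, m). p ^ k * m) x)) has_sum (1 / (1 - f p) * E)) (UNIV \<times> smooth N)"
        using prod by (simp add: case_prod_unfold mult pow)
      then have 1: "(f has_sum (1 / (1 - f p) * E)) (smooth (Suc N))"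
        using has_sum_reindex_bij_betw[OF bij] by blast
      have "(\<lambda>x. norm (f ((\<lambda>(k, m). p ^ k * m) x))) summable_on (UNIV \<times> smooth N)"
        using sum by (simp add: case_prod_unfold mult pow)
      then have 2: "f abs_summable_on (smooth (Suc N))"
        using summable_on_reindex_bij_betw[OF bij, of "\<lambda>x. norm (f x)"] by blast
      have "{p. prime p \<and> p \<le> Suc N} = insert p {p. prime p \<and> p \<le> N}" "p \<notin> {p. prime p \<and> p \<le> N}"
        using p by (auto simp: p_def le_Suc_eq)
      then have "(\<Prod>p | prime p \<and> p \<le> Suc N. inverse (1 - f p)) = 1 / (1 - f p) * E"
        by (simp add: E_def inverse_eq_divide)
      then show ?thesis
        using 1 2 by simp
    qed
  qed
  then show "(f has_sum (\<Prod>p | prime p \<and> p \<le> N. inverse (1 - f p))) (smooth N)"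
    and "f abs_summable_on smooth N"
    by auto
qed

lemma has_sum_inverse_smooth:
  "((\<lambda>n. 1 / real n) has_sum (\<Prod>p | prime p \<and> p \<le> N. inverse (1 - 1 / real p))) (smooth N)"
proof (rule euler_product_smooth(1))
  show "norm (1 / real p) < 1" if "prime p" for p
    using prime_gt_1_nat[OF that] by simp
qed auto

text \<open>The product is the sum of 1/n over all P-smooth n. These include 1, ..., P, so it
  dominates a harmonic number. This lower bound for the denominator is the source of 1 / ln P in the
  error term.\<close>

lemma ln_le_prod_primes:
  assumes "P \<ge> 1"
  shows "ln (real P) \<le> (\<Prod>p | prime p \<and> p \<le> P. inverse (1 - 1 / real p))"
proof -
  have "ln (real P) \<le> ln (real P + 1)"
    using assms by simp
  also have "\<dots> \<le> harm P"
    by (rule ln_le_harm)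
  also have "\<dots> = (\<Sum>n\<in>{1..P}. 1 / real n)"
    by (simp add: harm_def inverse_eq_divide)
  also have "\<dots> \<le> (\<Prod>p | prime p \<and> p \<le> P. inverse (1 - 1 / real p))"
  proof (rule has_sum_mono2)
    show "((\<lambda>n. 1 / real n) has_sum (\<Sum>n\<in>{1..P}. 1 / real n)) {1..P}"
      by (rule has_sum_finite) simp
    show "((\<lambda>n. 1 / real n) has_sum (\<Prod>p | prime p \<and> p \<le> P. inverse (1 - 1 / real p))) (smooth P)"
      by (rule has_sum_inverse_smooth)
  qed (auto intro: le_in_smooth)
  finally show ?thesis .
qed

text \<open>Multiplication by a smooth \<open>d\<close> maps the smooth numbers bijectively onto the
  smooth multiples of \<open>d\<close>. This removes divisibility conditions from sums over smooth
  numbers.\<close>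

lemma has_sum_smooth_dilate:
  assumes d: "d \<in> smooth N" and h: "(h has_sum S) (smooth N)"
  shows "((\<lambda>s. if d dvd s then h (s div d) else 0) has_sum S) (smooth N)"
proof -
  have pos: "d > 0"
    using d by (rule smooth_pos)
  have bij: "bij_betw (\<lambda>t. d * t) (smooth N) {s \<in> smooth N. d dvd s}"
    by (rule bij_betw_byWitness[of _ "\<lambda>s. s div d"])
       (use pos d in \<open>auto simp: smooth_mult_iff elim!: dvdE\<close>)
  have "((\<lambda>t. (\<lambda>s. h (s div d)) (d * t)) has_sum S) (smooth N)"
    using h pos by simp
  then have "((\<lambda>s. h (s div d)) has_sum S) {s \<in> smooth N. d dvd s}"
    using has_sum_reindex_bij_betw[OF bij] by blast
  also have "?this \<longleftrightarrow> ?thesis"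
    by (rule has_sum_cong_neutral) auto
  finally show ?thesis .
qed

section \<open>Splitting an integer into a smooth part and a rough cofactor\<close>

text \<open>Having no prime factor up to P is expressed as coprimality to one fixed integer, so that
  it can be detected by a finite Moebius sum.\<close>

lemma coprime_prod_primes_iff:
  "coprime m (\<Prod>{p. prime p \<and> p \<le> P}) \<longleftrightarrow> (\<forall>p. prime p \<and> p \<le> P \<longrightarrow> \<not> p dvd (m::nat))"
proof
  assume "coprime m (\<Prod>{p. prime p \<and> p \<le> P})"
  show "\<forall>p. prime p \<and> p \<le> P \<longrightarrow> \<not> p dvd m"
  proof (intro allI impI notI)
    fix p assume p: "prime p \<and> p \<le> P" "p dvd m"
    have "p dvd \<Prod>{p. prime p \<and> p \<le> P}"
      using p by (intro dvd_prodI) auto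
    then show False
      using \<open>coprime m _\<close> p by (meson coprime_common_divisor not_prime_unit)
  qed
next
  assume "\<forall>p. prime p \<and> p \<le> P \<longrightarrow> \<not> p dvd m"
  then have "coprime p m" if "prime p" "p \<le> P" for p
    using that by (simp add: prime_imp_coprime_nat)
  then show "coprime m (\<Prod>{p. prime p \<and> p \<le> P})"
    by (intro prod_coprime_right) (auto simp: coprime_commute)
qed

lemma coprime_smooth:
  assumes "s \<in> smooth P" "coprime m (\<Prod>{p. prime p \<and> p \<le> P})"
  shows "coprime s m"
proof (rule ccontr)
  assume "\<not> coprime s m"
  then obtain p where "prime p" "p dvd s" "p dvd m"
    by (metis coprime_iff_gcd_eq_1 gcd_nat.bounded_iff prime_factor_nat)
  then show False
    using assms by (auto simp: smooth_def coprime_prod_primes_iff)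
qed

lemma smooth_decomposition:
  assumes "a > 0"
  obtains s m where "a = s * m" "s \<in> smooth P" "coprime m (\<Prod>{p. prime p \<and> p \<le> P})"
proof -
  define D where "D = {d \<in> smooth P. d dvd a}"
  have "finite D" "1 \<in> D"
    using assms by (auto simp: D_def)
  \<comment> \<open>If a prime p \<le> P divided the cofactor, s * p would be a larger smooth
    divisor.\<close>
  define s where "s = Max D"
  have s: "s \<in> D"
    unfolding s_def using \<open>finite D\<close> \<open>1 \<in> D\<close> by (intro Max_in) auto
  then obtain m where m: "a = s * m"
    by (auto simp: D_def)
  have "\<not> p dvd m" if p: "prime p" "p \<le> P" for p
  proof
    assume "p dvd m"
    then have "s * p \<in> D"
      using s m p by (auto simp: D_def smooth_mult_iff prime_in_smooth_iff)
    then have "s * p \<le> s"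
      unfolding s_def using \<open>finite D\<close> by simp
    then show False
      using prime_gt_1_nat[OF p(1)] s smooth_pos[of s P] by (auto simp: D_def)
  qed
  then show thesis
    using m s that by (auto simp: D_def coprime_prod_primes_iff)
qed

lemma smooth_divisors_of_mult:
  assumes "s \<in> smooth P" "coprime m (\<Prod>{p. prime p \<and> p \<le> P})"
  shows "{d. d \<in> smooth P \<and> d dvd s * m} = {d. d dvd s}"
  using assms by (auto intro: smooth_dvd simp: coprime_dvd_mult_left_iff coprime_smooth)

lemma smooth_part_mult:
  assumes "s \<in> smooth P" "coprime m (\<Prod>{p. prime p \<and> p \<le> P})"
  shows "smooth_part P F (s * m) = F s"
  using sum_eratosthenes[of s F] assms
  by (simp add: smooth_part_def smooth_divisors_of_mult smooth_pos)

subsection \<open>Mean values\<close>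


text \<open>Averages along the integers, to which counting and Tannery's theorem apply directly;
  \<open>Car_mean_tendsto\<close> returns to the real variable of \<open>Car_mean\<close>.\<close>

definition has_mean :: "(nat \<Rightarrow> complex) \<Rightarrow> complex \<Rightarrow> bool" where
  "has_mean f L \<longleftrightarrow> (\<lambda>N. (\<Sum>a=1..N. f a) / of_nat N) \<longlonglongrightarrow> L"

lemma has_mean_cmult: "has_mean f L \<Longrightarrow> has_mean (\<lambda>a. c * f a) (c * L)"
  unfolding has_mean_def sum_distrib_left [symmetric] times_divide_eq_right [symmetric]
  by (rule tendsto_mult_left)

lemma has_mean_sum:
  assumes "\<And>i. i \<in> I \<Longrightarrow> has_mean (f i) (L i)"
  shows "has_mean (\<lambda>a. \<Sum>i\<in>I. f i a) (\<Sum>i\<in>I. L i)"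
proof -
  have "(\<lambda>N. \<Sum>i\<in>I. (\<Sum>a=1..N. f i a) / of_nat N) \<longlonglongrightarrow> (\<Sum>i\<in>I. L i)"
    using assms by (intro tendsto_sum) (auto simp: has_mean_def)
  also have "(\<lambda>N. \<Sum>i\<in>I. (\<Sum>a=1..N. f i a) / of_nat N) = (\<lambda>N. (\<Sum>a=1..N. \<Sum>i\<in>I. f i a) / of_nat N)"
    by (subst sum.swap) (simp add: sum_divide_distrib)
  finally show ?thesis
    by (simp add: has_mean_def)
qed

lemma has_mean_cong:
  assumes "\<And>a. a > 0 \<Longrightarrow> f a = g a"
  shows "has_mean f L \<longleftrightarrow> has_mean g L"
proof -
  have "(\<Sum>a=1..N. f a) = (\<Sum>a=1..N. g a)" for N
    using assms by (intro sum.cong) auto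
  then show ?thesis
    by (simp add: has_mean_def)
qed

lemma has_mean_e_q:
  assumes "n > 0"
  shows "has_mean (\<lambda>a. e_q n (real (k * a))) (if n dvd k then 1 else 0)"
proof (cases "n dvd k")
  case True
  then have "e_q n (real (k * a)) = 1" for a
    using e_q_eq_1_iff[OF assms, of "k * a"] by simp
  moreover have "(\<lambda>N. of_nat N / of_nat N :: complex) \<longlonglongrightarrow> 1"
    by (rule tendsto_eventually) (auto intro: eventually_mono[OF eventually_gt_at_top[of 0]])
  ultimately show ?thesis
    using True by (simp add: has_mean_def)
next
  case False
  define z where "z = e_q n (real k)"
  have z: "z \<noteq> 1" "norm z = 1"
    using False e_q_eq_1_iff[OF assms, of k] by (auto simp: z_def)
  have sum_z: "(\<Sum>a=1..N. e_q n (real (k * a))) = z * ((z ^ N - 1) / (z - 1))" for N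
  proof -
    have "(\<Sum>a=1..N. e_q n (real (k * a))) = (\<Sum>i<N. z ^ Suc i)"
      by (rule sum.reindex_bij_witness[of _ Suc "\<lambda>i. i - 1"])
         (auto simp: z_def e_q_power mult.commute simp del: power_Suc)
    also have "\<dots> = z * (\<Sum>i<N. z ^ i)"
      by (simp add: sum_distrib_left)
    finally show ?thesis
      using z by (simp add: geometric_sum)
  qed
  \<comment> \<open>For z \<noteq> 1 the geometric partial sums stay bounded, so their averages tend
    to 0.\<close>
  have bound: "norm ((\<Sum>a=1..N. e_q n (real (k * a))) / of_nat N) \<le> 2 / norm (z - 1) / real N" for N
  proof -
    have "norm (z ^ N - 1) \<le> 2"
      using norm_triangle_ineq4[of "z ^ N" 1] z by (simp add: norm_power)
    then show ?thesis
      unfolding sum_z using z by (simp add: norm_divide norm_mult divide_right_mono)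
  qed
  have "(\<lambda>N. 2 / norm (z - 1) / real N) \<longlonglongrightarrow> 0"
    by (rule tendsto_divide_0[OF tendsto_const])
       (simp add: filterlim_real_at_infinity_sequentially)
  then show ?thesis
    unfolding has_mean_def if_not_P[OF False]
    by (rule Lim_null_comparison[OF always_eventually[OF allI[OF bound]]])
qed

lemma sum_multiples:
  fixes h :: "nat \<Rightarrow> 'a :: comm_monoid_add"
  assumes "d > 0"
  shows "(\<Sum>a=1..N. if d dvd a then h (a div d) else 0) = (\<Sum>m=1..N div d. h m)"
proof -
  have "(\<Sum>a=1..N. if d dvd a then h (a div d) else 0) = (\<Sum>a | a \<in> {1..N} \<and> d dvd a. h (a div d))"
    by (rule sum.mono_neutral_cong_right) auto
  also have "\<dots> = (\<Sum>m=1..N div d. h m)"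
    by (rule sum.reindex_bij_witness[of _ "\<lambda>m. d * m" "\<lambda>a. a div d"])
       (use assms in \<open>auto elim!: dvdE simp: less_eq_div_iff_mult_less_eq mult.commute\<close>)
  finally show ?thesis .
qed

lemma tendsto_div_over:
  assumes "d > 0"
  shows "(\<lambda>N. real (N div d) / real N) \<longlonglongrightarrow> 1 / real d"
proof (rule tendsto_sandwich[of "\<lambda>N. 1 / real d - 1 / real N" _ _ "\<lambda>_. 1 / real d"])
  have *: "real (N div d) \<le> real N / real d" "real N / real d - 1 \<le> real (N div d)" for N
  proof -
    show "real (N div d) \<le> real N / real d"
      by (rule of_nat_div_le_of_nat)
    have "real N = real d * real (N div d) + real (N mod d)"
      by (metis of_nat_add of_nat_mult mult_div_mod_eq)
    moreover have "real (N mod d) \<le> real d"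
      using assms by (simp add: less_imp_le)
    ultimately show "real N / real d - 1 \<le> real (N div d)"
      using assms by (simp add: field_simps)
  qed
  show "\<forall>\<^sub>F N in sequentially. 1 / real d - 1 / real N \<le> real (N div d) / real N"
    using eventually_gt_at_top[of 0]
  proof eventually_elim
    case (elim N)
    have "1 / real d - 1 / real N = (real N / real d - 1) / real N"
      using elim by (simp add: field_simps)
    also have "\<dots> \<le> real (N div d) / real N"
      using * by (intro divide_right_mono) auto
    finally show ?case .
  qed
  show "\<forall>\<^sub>F N in sequentially. real (N div d) / real N \<le> 1 / real d"
    using eventually_gt_at_top[of 0]
  proof eventually_elim
    case (elim N)
    have "real (N div d) / real N \<le> (real N / real d) / real N"
      using * by (intro divide_right_mono) auto
    then show ?case
      using elim by simp
  qed
  show "(\<lambda>N. 1 / real d - 1 / real N) \<longlonglongrightarrow> 1 / real d"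
    using tendsto_diff[OF tendsto_const[of "1 / real d"] lim_1_over_n] by simp
qed simp

lemma tendsto_mean_div:
  assumes "d > 0" "has_mean h L"
  shows "(\<lambda>N. (\<Sum>m=1..N div d. h m) / of_nat N) \<longlonglongrightarrow> L / of_nat d"
proof -
  have "filterlim (\<lambda>N. N div d) at_top sequentially"
    unfolding filterlim_at_top
  proof
    fix Z
    show "\<forall>\<^sub>F N in sequentially. Z \<le> N div d"
      using eventually_ge_at_top[of "Z * d"]
      by eventually_elim (use assms in \<open>simp add: less_eq_div_iff_mult_less_eq\<close>)
  qed
  then have "(\<lambda>N. (\<Sum>m=1..N div d. h m) / of_nat (N div d)) \<longlonglongrightarrow> L"
    using assms(2) unfolding has_mean_def by (rule filterlim_compose[rotated])
  moreover have "(\<lambda>N. complex_of_real (real (N div d) / real N)) \<longlonglongrightarrow> complex_of_real (1 / real d)"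
    by (intro tendsto_of_real tendsto_div_over assms)
  ultimately have "(\<lambda>N. (\<Sum>m=1..N div d. h m) / of_nat (N div d) * complex_of_real (real (N div d)
      / real N))
      \<longlonglongrightarrow> L * complex_of_real (1 / real d)"
    by (rule tendsto_mult)
  \<comment> \<open>For N < d both sides are 0: the sum is empty and division by 0 yields 0.\<close>
  moreover have "(\<Sum>m=1..N div d. h m) / of_nat (N div d) * complex_of_real (real (N div d) / real N)
      = (\<Sum>m=1..N div d. h m) / of_nat N" for N
    by (cases "N div d = 0") auto
  ultimately show ?thesis
    by (simp only:) simp
qed

lemma has_mean_dilate:
  assumes "d > 0" "has_mean h L"
  shows "has_mean (\<lambda>a. if d dvd a then h (a div d) else 0) (L / of_nat d)"
  using tendsto_mean_div[OF assms] by (simp only: has_mean_def sum_multiples[OF assms(1)])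

text \<open>Coprimality to \<open>Q\<close> is replaced by a Moebius sum over common divisors, and
  each divisor gives a dilated exponential. The mean stays a divisor sum because it is used in two
  ways: for the trivial exponential it becomes a product over primes, and for non-smooth
  \<open>l\<close> every term vanishes.\<close>

lemma has_mean_coprime_e_q:
  assumes "n > 0" "Q > 0"
  shows "has_mean (\<lambda>m. if coprime m Q then e_q n (real (k * m)) else 0)
    (\<Sum>e | e dvd Q. of_int (moebius_mu e) * ((if n dvd k * e then 1 else 0) / of_nat e))"
proof -
  have "has_mean (\<lambda>m. \<Sum>e | e dvd Q. of_int (moebius_mu e) *
        (if e dvd m then e_q n (real (k * e * (m div e))) else 0))
      (\<Sum>e | e dvd Q. of_int (moebius_mu e) * ((if n dvd k * e then 1 else 0) / of_nat e))"
  proof (intro has_mean_sum has_mean_cmult)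
    fix e assume "e \<in> {e. e dvd Q}"
    then have "e > 0"
      using assms by (auto intro: dvd_pos_nat)
    from has_mean_dilate[OF this has_mean_e_q[OF assms(1), of "k * e"]]
    show "has_mean (\<lambda>m. if e dvd m then e_q n (real (k * e * (m div e))) else 0)
        ((if n dvd k * e then 1 else 0) / of_nat e)" .
  qed
  also have "?this \<longleftrightarrow> ?thesis"
  proof (rule has_mean_cong)
    fix m :: nat assume "m > 0"
    then have g: "gcd m Q > 0"
      by simp
    have "(\<Sum>e | e dvd Q. of_int (moebius_mu e) * (if e dvd m then e_q n (real (k * e * (m div e)))
        else 0))
        = (\<Sum>e | e dvd gcd m Q. of_int (moebius_mu e) * e_q n (real (k * m)))"
      using assms by (intro sum.mono_neutral_cong_right) (auto simp: mult.assoc)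
    also have "\<dots> = (if coprime m Q then e_q n (real (k * m)) else 0)"
      unfolding sum_distrib_right [symmetric] sum_moebius_divisors[OF g]
      by (cases "gcd m Q = 1")
         (simp_all only: coprime_iff_gcd_eq_1 if_True if_False mult_1 mult_zero_left simp_thms)
    finally show "(\<Sum>e | e dvd Q. of_int (moebius_mu e) * (if e dvd m then e_q n (real (k * e * (m
        div e))) else 0))
        = (if coprime m Q then e_q n (real (k * m)) else 0)" .
  qed
  finally show ?thesis .
qed

section \<open>Means of Ramanujan sums and Tannery's theorem\<close>

lemma ramanujan_sum_mult_coprime:
  assumes "l > 0" "coprime m l"
  shows "ramanujan_sum l (s * m) = ramanujan_sum l s"
  unfolding ramanujan_sum_divisors[OF assms(1)]
proof (intro sum.cong refl)
  fix d assume "d \<in> {d. d dvd l}"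
  then have "coprime d m"
    using assms(2) by (metis coprime_commute coprime_divisors dvd_refl mem_Collect_eq)
  then have "d dvd s * m \<longleftrightarrow> d dvd s"
    by (rule coprime_dvd_mult_left_iff)
  then show "(if d dvd s * m then of_nat d * of_int (moebius_mu (l div d)) else 0 :: complex) =
      (if d dvd s then of_nat d * of_int (moebius_mu (l div d)) else 0)"
    by simp
qed

lemma norm_ramanujan_sum_le: "norm (ramanujan_sum l a) \<le> real l"
proof -
  have "norm (ramanujan_sum l a) \<le> (\<Sum>k | 1 \<le> k \<and> k \<le> l \<and> coprime k l. 1)"
    unfolding ramanujan_sum_def by (rule sum_norm_le) simp
  also have "\<dots> \<le> real (card {1..l})"
    unfolding real_of_card [symmetric] of_nat_le_iff by (rule card_mono) auto
  finally show ?thesis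
    by simp
qed

lemma prod_primes_pos: "\<Prod>{p. prime p \<and> p \<le> P} > (0::nat)"
  by (rule prod_pos) (auto simp: prime_gt_0_nat)

text \<open>All primes of \<open>l\<close> are at most P, so each admissible m is coprime to
  \<open>l\<close> and does not change the Ramanujan sum. What remains is the density of the
  admissible m.\<close>

lemma has_mean_ramanujan_coprime_smooth:
  assumes l: "l \<in> smooth P"
  shows "has_mean (\<lambda>m. if coprime m (\<Prod>{p. prime p \<and> p \<le> P}) then ramanujan_sum l (s * m) else 0)
    (ramanujan_sum l s * (\<Prod>p | prime p \<and> p \<le> P. 1 - 1 / of_nat p))"
proof -
  define Q where "Q = \<Prod>{p. prime p \<and> p \<le> P}"
  have Q: "Q > 0"
    unfolding Q_def by (rule prod_primes_pos)
  \<comment> \<open>Modulus 1 and frequency 0 make the exponential constantly 1, so only the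
    coprimality condition is averaged.\<close>
  have "(\<Sum>e | e dvd Q. of_int (moebius_mu e) * ((if 1 dvd 0 * e then 1 else 0) / of_nat e))
      = (\<Prod>p\<in>prime_factors Q. 1 - 1 / of_nat p :: complex)"
    using sum_divisors_moebius[of "\<lambda>e. 1 / of_nat e" Q] Q by simp
  also have "prime_factors Q = {p. prime p \<and> p \<le> P}"
    unfolding Q_def by (rule prime_factors_prod_primes) auto
  finally have "has_mean (\<lambda>m. ramanujan_sum l s * (if coprime m Q then e_q 1 (real (0 * m)) else 0))
      (ramanujan_sum l s * (\<Prod>p | prime p \<and> p \<le> P. 1 - 1 / of_nat p))"
    using has_mean_cmult[OF has_mean_coprime_e_q[of 1 Q 0]] Q by simp
  also have "?this \<longleftrightarrow> has_mean (\<lambda>m. if coprime m Q then ramanujan_sum l (s * m) else 0)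
      (ramanujan_sum l s * (\<Prod>p | prime p \<and> p \<le> P. 1 - 1 / of_nat p))"
    using l coprime_smooth[OF l]
    by (intro has_mean_cong)
       (auto simp: Q_def smooth_pos ramanujan_sum_mult_coprime coprime_commute)
  finally show ?thesis
    by (simp add: Q_def)
qed

text \<open>A nonzero mean would need some e dividing Q and k coprime to \<open>l\<close> with
  \<open>l\<close> dividing k * s * e. Then \<open>l\<close> would divide the smooth number s * e
  and be smooth itself.\<close>

lemma has_mean_ramanujan_coprime_nonsmooth:
  assumes l: "l > 0" "l \<notin> smooth P" and s: "s \<in> smooth P"
  shows "has_mean (\<lambda>m. if coprime m (\<Prod>{p. prime p \<and> p \<le> P}) then ramanujan_sum l (s * m) else 0) 0"
proof -
  define Q where "Q = \<Prod>{p. prime p \<and> p \<le> P}"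
  have Q: "Q > 0"
    unfolding Q_def by (rule prod_primes_pos)
  have "prime p \<Longrightarrow> p dvd Q \<Longrightarrow> p \<le> P" for p
    using coprime_prod_primes_iff[of p P]
        by (metis Q_def coprime_absorb_left not_prime_unit primes_dvd_imp_eq)
  then have "Q \<in> smooth P"
    using Q by (auto simp: smooth_def)
  have no: "\<not> l dvd k * s * e" if "coprime k l" "e dvd Q" for k e
  proof
    assume "l dvd k * s * e"
    then have "l dvd s * e"
      using that by (simp add: mult.assoc coprime_dvd_mult_right_iff coprime_commute)
    then show False
      using l s that \<open>Q \<in> smooth P\<close> by (meson smooth_dvd smooth_mult_iff)
  qed
  have "has_mean (\<lambda>m. \<Sum>k | 1 \<le> k \<and> k \<le> l \<and> coprime k l.
        if coprime m Q then e_q l (real (k * s * m)) else 0)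
      (\<Sum>k | 1 \<le> k \<and> k \<le> l \<and> coprime k l.
         \<Sum>e | e dvd Q. of_int (moebius_mu e) * ((if l dvd k * s * e then 1 else 0) / of_nat e))"
    using l(1) Q by (intro has_mean_sum has_mean_coprime_e_q)
  also have "(\<Sum>k | 1 \<le> k \<and> k \<le> l \<and> coprime k l.
      \<Sum>e | e dvd Q. of_int (moebius_mu e) * ((if l dvd k * s * e then 1 else 0) / of_nat e))
          = (0 :: complex)"
    using no by (intro sum.neutral ballI) auto
  also have "(\<lambda>m. \<Sum>k | 1 \<le> k \<and> k \<le> l \<and> coprime k l.
        if coprime m Q then e_q l (real (k * s * m)) else 0)
      = (\<lambda>m. if coprime m Q then ramanujan_sum l (s * m) else 0)"
    by (auto simp: ramanujan_sum_def mult.assoc)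
  finally show ?thesis
    by (simp add: Q_def)
qed

text \<open>The integers a = s * m with a fixed smooth s contribute F s * M s / s in the limit.
  Leaving \<open>M\<close> abstract covers smooth and non-smooth \<open>l\<close> at once.\<close>

lemma has_mean_smooth_part:
  assumes F: "\<And>s. norm (F s) \<le> 1"
    and M: "\<And>s. s \<in> smooth P \<Longrightarrow>
      has_mean (\<lambda>m. if coprime m (\<Prod>{p. prime p \<and> p \<le> P}) then ramanujan_sum l (s * m) else 0) (M s)"
    and L: "((\<lambda>s. F s * M s / of_nat s) has_sum L) (smooth P)"
  shows "has_mean (\<lambda>a. smooth_part P F a * ramanujan_sum l a) L"
proof -
  define Q where "Q = \<Prod>{p. prime p \<and> p \<le> P}"
  define h where "h s m = (if coprime m Q then ramanujan_sum l (s * m) else 0)" for s m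
  define w where "w s N = (if s \<in> smooth P then F s * ((\<Sum>m=1..N div s. h s m) / of_nat N) else 0)"
      for s N
  define b where "b s = (if s \<in> smooth P then F s * M s / of_nat s else 0)" for s
  \<comment> \<open>The majorant for Tannery's theorem: a Ramanujan sum is at most l in norm and
    there are at most N / s values of m. It is summable because the sum of 1/s over smooth s is a
    finite Euler product.\<close>
  define B where "B s = (if s \<in> smooth P then real l * (1 / real s) else 0)" for s
  have pointwise: "smooth_part P F a * ramanujan_sum l a =
      (\<Sum>s=1..N. if s \<in> smooth P then F s * (if s dvd a then h s (a div s) else 0) else 0)"
    if a: "a \<in> {1..N}" for a N
  proof -
    obtain s m where sm: "a = s * m" "s \<in> smooth P" "coprime m Q"
      using smooth_decomposition[of a P] a by (auto simp: Q_def)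
    \<comment> \<open>If the cofactor of t were also coprime to Q, then s and t would divide each
      other. Thus each \<open>a\<close> is counted at exactly one smooth divisor.\<close>
    have zero: "h t (a div t) = 0" if "t \<in> smooth P" "t dvd a" "t \<noteq> s" for t
    proof (rule ccontr)
      assume "h t (a div t) \<noteq> 0"
      then have c: "coprime (a div t) Q"
        by (auto simp: h_def split: if_splits)
      have a': "a = t * (a div t)"
        using that by simp
      have "t dvd s"
        using smooth_divisors_of_mult[OF sm(2) sm(3)[unfolded Q_def]] that sm(1) by blast
      moreover have "s dvd t"
        using smooth_divisors_of_mult[OF that(1) c[unfolded Q_def]] sm a'
            by (metis (no_types, lifting) dvd_triv_left mem_Collect_eq)
      ultimately show False
        using that by (simp add: dvd_antisym)
    qed
    have "s \<in> {1..N}"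
      using a sm smooth_pos[OF sm(2)] by (cases m) auto
    have "(\<Sum>t=1..N. if t \<in> smooth P then F t * (if t dvd a then h t (a div t) else 0) else 0)
        = (\<Sum>t=1..N. if t = s then F s * h s m else 0)"
      using sm zero smooth_pos[OF sm(2)] by (intro sum.cong) auto
    also have "\<dots> = F s * h s m"
      using \<open>s \<in> {1..N}\<close> by (simp add: sum.delta)
    also have "\<dots> = smooth_part P F a * ramanujan_sum l a"
      using sm smooth_part_mult[of s P m F] by (simp add: h_def Q_def)
    finally show ?thesis ..
  qed
  have sum_w: "(\<Sum>a=1..N. smooth_part P F a * ramanujan_sum l a) / of_nat N = (\<Sum>s. w s N)" for N
  proof -
    have "(\<Sum>a=1..N. smooth_part P F a * ramanujan_sum l a) =
        (\<Sum>s=1..N. \<Sum>a=1..N. if s \<in> smooth P then F s * (if s dvd a then h s (a div s) else 0)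
            else 0)"
      by (subst sum.swap) (intro sum.cong refl pointwise)
    also have "\<dots> = (\<Sum>s=1..N. if s \<in> smooth P then F s * (\<Sum>m=1..N div s. h s m) else 0)"
    proof (rule sum.cong)
      fix s assume "s \<in> {1..N}"
      then show "(\<Sum>a=1..N. if s \<in> smooth P then F s * (if s dvd a then h s (a div s) else 0) else 0)
          = (if s \<in> smooth P then F s * (\<Sum>m=1..N div s. h s m) else 0)"
        using sum_multiples[of s "h s" N] by (auto simp: sum_distrib_left [symmetric])
    qed simp
    also have "\<dots> / of_nat N = (\<Sum>s=1..N. w s N)"
      unfolding sum_divide_distrib [of _ "{1..N}"] by (rule sum.cong) (auto simp: w_def)
    \<comment> \<open>For s > N the inner sum is empty, so the series is finite for each N.\<close>
    also have "\<dots> = (\<Sum>s. w s N)"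
      by (rule suminf_finite [symmetric]) (auto simp: w_def not_le Suc_le_eq)
    finally show ?thesis .
  qed
  have wb: "((\<lambda>N. w s N) \<longlongrightarrow> b s) sequentially" for s
  proof (cases "s \<in> smooth P")
    case True
    have "(\<lambda>N. F s * ((\<Sum>m=1..N div s. h s m) / of_nat N)) \<longlonglongrightarrow> F s * (M s / of_nat s)"
      using M[OF True] True by (intro tendsto_mult_left tendsto_mean_div smooth_pos)
        (auto simp: h_def [abs_def] Q_def)
    then show ?thesis
      using True by (simp add: w_def b_def)
  qed (simp add: w_def b_def)
  have bound: "norm (w s N) \<le> B s" for s N
  proof (cases "s \<in> smooth P")
    case True
    have "norm (\<Sum>m=1..N div s. h s m) \<le> (\<Sum>m=1..N div s. real l)"
      by (rule sum_norm_le) (auto simp: h_def norm_ramanujan_sum_le)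
    also have "\<dots> = real l * real (N div s)"
      by simp
    also have "\<dots> \<le> real l * (real N / real s)"
      by (intro mult_left_mono of_nat_div_le_of_nat) auto
    finally have "norm (\<Sum>m=1..N div s. h s m) / real N \<le> real l * (real N / real s) / real N"
      by (rule divide_right_mono) simp
    also have "\<dots> \<le> real l * (1 / real s)"
      by (cases "N = 0") auto
    finally have "norm (F s) * (norm (\<Sum>m=1..N div s. h s m) / real N) \<le> 1 * (real l * (1 / real s))"
      using F by (intro mult_mono) auto
    then show ?thesis
      using True by (simp add: w_def B_def norm_mult norm_divide)
  qed (simp add: w_def B_def)
  have "((\<lambda>s. real l * (1 / real s)) summable_on smooth P)"
    by (intro summable_on_cmult_right has_sum_imp_summable[OF has_sum_inverse_smooth])
  also have "?this \<longleftrightarrow> B summable_on UNIV"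
    by (rule summable_on_cong_neutral) (auto simp: B_def)
  finally have "summable B"
    by (rule summable_on_imp_summable)
  then have lim: "(\<lambda>N. \<Sum>s. w s N) \<longlonglongrightarrow> (\<Sum>s. b s)"
    using tannerys_theorem[of w b sequentially B, OF wb] bound by (auto intro: always_eventually)
  have "(b has_sum L) UNIV \<longleftrightarrow> ((\<lambda>s. F s * M s / of_nat s) has_sum L) (smooth P)"
    by (rule has_sum_cong_neutral) (auto simp: b_def)
  then have "(\<Sum>s. b s) = L"
    using L has_sum_imp_sums sums_unique by metis
  then show ?thesis
    using lim unfolding has_mean_def sum_w by simp
qed

section \<open>From means to Carmichael coefficients\<close>

lemma Car_mean_tendsto:
  assumes "has_mean (\<lambda>a. F a * ramanujan_sum l a) L"
  shows "(Car_mean l F \<longlongrightarrow> L) at_top"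
proof -
  define S where "S N = (\<Sum>a=1..N. F a * ramanujan_sum l a)" for N
  have nat_floor: "filterlim (\<lambda>x::real. nat \<lfloor>x\<rfloor>) at_top at_top"
    by (rule filterlim_compose[OF filterlim_nat_sequentially filterlim_floor_sequentially])
  have "((\<lambda>x::real. S (nat \<lfloor>x\<rfloor>) / of_nat (nat \<lfloor>x\<rfloor>)) \<longlongrightarrow> L) at_top"
    using filterlim_compose[OF assms[unfolded has_mean_def] nat_floor] by (simp only: S_def)
  moreover have "((\<lambda>x::real. real (nat \<lfloor>x\<rfloor>) / x) \<longlongrightarrow> 1) at_top"
  proof (rule tendsto_sandwich[of "\<lambda>x. 1 - 1 / x" _ _ "\<lambda>_. 1"])
    show "\<forall>\<^sub>F x::real in at_top. 1 - 1 / x \<le> real (nat \<lfloor>x\<rfloor>) / x"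
      using eventually_ge_at_top[of 1]
    proof eventually_elim
      case (elim x)
      then have "x - 1 \<le> real (nat \<lfloor>x\<rfloor>)"
        by linarith
      then have "(x - 1) / x \<le> real (nat \<lfloor>x\<rfloor>) / x"
        using elim by (intro divide_right_mono) auto
      then show ?case
        using elim by (simp add: diff_divide_distrib)
    qed
    show "\<forall>\<^sub>F x::real in at_top. real (nat \<lfloor>x\<rfloor>) / x \<le> 1"
      using eventually_ge_at_top[of 1] by eventually_elim (auto simp: field_simps)
    show "((\<lambda>x::real. 1 - 1 / x) \<longlongrightarrow> 1) at_top"
      using tendsto_diff[OF tendsto_const[of "1::real"] tendsto_divide_0[OF tendsto_const[of
          "1::real"] filterlim_mono[OF filterlim_ident at_top_le_at_infinity order_refl]]] by simp
  qed simp
  then have "((\<lambda>x::real. complex_of_real (real (nat \<lfloor>x\<rfloor>) / x)) \<longlongrightarrow> complex_of_real 1) at_top"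
    by (rule tendsto_of_real)
  ultimately have "((\<lambda>x. S (nat \<lfloor>x\<rfloor>) / of_nat (nat \<lfloor>x\<rfloor>) * complex_of_real (real (nat \<lfloor>x\<rfloor>) / x)) \<longlongrightarrow>
      L * complex_of_real 1) at_top"
    by (rule tendsto_mult)
  \<comment> \<open>If the integer part is 0, both sides vanish because the sum is empty.\<close>
  moreover have "S (nat \<lfloor>x\<rfloor>) / of_nat (nat \<lfloor>x\<rfloor>) * complex_of_real (real (nat \<lfloor>x\<rfloor>) / x)
      = Car_mean l F x" for x
    by (cases "nat \<lfloor>x\<rfloor> = 0") (auto simp: Car_mean_def S_def)
  ultimately show ?thesis
    by simp
qed

lemma Car_eq:
  assumes "has_mean (\<lambda>a. F a * ramanujan_sum l a) L"
  shows "Car_exists l F" "Car l F = L / of_nat (totient l)"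
  using Car_mean_tendsto[OF assms] tendsto_Lim[OF trivial_limit_at_top_linorder
      Car_mean_tendsto[OF assms]]
  by (auto simp: Car_exists_def Car_def)

text \<open>The product of the two exponentials has frequency (j l + k q) / (q l), so its mean is 1
  or 0. An integral frequency forces q to divide l and l to divide q, by the two coprimality
  conditions; for l = q exactly one k, the residue of -j, remains.\<close>

lemma Car_F_exp:
  assumes q: "q \<ge> 1" and j: "coprime j q" and l: "l \<ge> 1"
  shows "Car_exists l (F_exp j q)"
    and "Car l (F_exp j q) = (if l = q then 1 else 0) * (1 / of_nat (totient q))"
proof -
  have *: "F_exp j q a * e_q l (real (k * a)) = e_q (q * l) (real ((j * l + k * q) * a))" for a k
  proof -
    have "e_q (q * l) (real ((j * l + k * q) * a)) =
        e_q (l * q) (real l * real (j * a)) * e_q (q * l) (real q * real (k * a))"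
      by (simp add: e_q_add [symmetric] algebra_simps)
    then show ?thesis
      using q l by (simp add: F_exp_def e_q_cancel del: of_nat_mult)
  qed
  have "has_mean (\<lambda>a. \<Sum>k | 1 \<le> k \<and> k \<le> l \<and> coprime k l. e_q (q * l) (real ((j * l + k * q) * a)))
      (\<Sum>k | 1 \<le> k \<and> k \<le> l \<and> coprime k l. if q * l dvd j * l + k * q then 1 else 0)"
    using q l by (intro has_mean_sum has_mean_e_q) auto
  then have mean: "has_mean (\<lambda>a. F_exp j q a * ramanujan_sum l a)
      (\<Sum>k | 1 \<le> k \<and> k \<le> l \<and> coprime k l. if q * l dvd j * l + k * q then 1 else 0)"
    by (simp only: ramanujan_sum_def sum_distrib_left *)
  have eq: "l = q" if "coprime k l" "q * l dvd j * l + k * q" for k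
  proof (rule dvd_antisym)
    have "q dvd j * l + k * q"
      using that(2) by (rule dvd_mult_left)
    then have "q dvd j * l"
      by (simp add: dvd_add_left_iff)
    then show "q dvd l"
      using j by (simp add: coprime_dvd_mult_right_iff coprime_commute)
    have "l dvd j * l + k * q"
      using that(2) by (rule dvd_mult_right)
    then have "l dvd k * q"
      by (simp add: dvd_add_right_iff)
    then show "l dvd q"
      using that(1) by (simp add: coprime_dvd_mult_right_iff coprime_commute)
  qed
  have "(\<Sum>k | 1 \<le> k \<and> k \<le> l \<and> coprime k l. if q * l dvd j * l + k * q then 1 else 0)
      = (if l = q then 1 else 0 :: complex)"
  proof (cases "l = q")
    case False
    then show ?thesis
      using eq by (auto intro!: sum.neutral)
  next
    case True
    \<comment> \<open>The representative of -j modulo q in the range 1..q.\<close>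
    define r where "r = q - j mod q"
    have jr: "(j + k) mod q = 0 \<longleftrightarrow> k = r" if "1 \<le> k" "k \<le> q" for k
    proof -
      have "(j + k) mod q = (j mod q + k) mod q"
        by (simp add: mod_simps)
      moreover have "(j mod q + k) mod q = 0 \<longleftrightarrow> k = r"
      proof
        assume "(j mod q + k) mod q = 0"
        then obtain c where c: "j mod q + k = q * c"
          by (auto simp: mod_eq_0_iff_dvd elim!: dvdE)
        have "j mod q < q"
          using q by simp
        then have "0 < q * c" "q * c < q * 2"
          using c that by linarith+
        then have "c = 1"
          by (auto simp: mult_less_cancel1)
        then show "k = r"
          using c by (simp add: r_def)
      next
        assume "k = r"
        then have "j mod q + k = q"
          using q by (simp add: r_def less_imp_le)
        then show "(j mod q + k) mod q = 0"
          by simp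
      qed
      ultimately show ?thesis
        by simp
    qed
    have r: "1 \<le> r" "r \<le> q"
      using q by (auto simp: r_def Suc_le_eq)
    have "q dvd j + r"
      using jr[OF r] by (simp add: mod_eq_0_iff_dvd)
    have "coprime r q"
    proof (rule coprimeI)
      fix c assume "c dvd r" "c dvd q"
      then have "c dvd j"
        using \<open>q dvd j + r\<close> by (meson dvd_add_left_iff dvd_trans)
      then show "is_unit c"
        using j \<open>c dvd q\<close> by (meson coprime_common_divisor)
    qed
    have "(\<Sum>k | 1 \<le> k \<and> k \<le> l \<and> coprime k l. if q * l dvd j * l + k * q then 1 else 0)
        = (\<Sum>k | 1 \<le> k \<and> k \<le> q \<and> coprime k q. if k = r then 1 else 0 :: complex)"
    proof (rule sum.cong)
      fix k assume k: "k \<in> {k. 1 \<le> k \<and> k \<le> q \<and> coprime k q}"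
      have "q * q dvd j * q + k * q \<longleftrightarrow> q dvd j + k"
        using q dvd_times_left_cancel_iff[of q q "j + k"] by (simp add: algebra_simps)
      then show "(if q * l dvd j * l + k * q then 1 else 0) = (if k = r then 1 else 0 :: complex)"
        using True jr[of k] k by (simp add: mod_eq_0_iff_dvd)
    qed (use True in simp)
    also have "\<dots> = 1"
      using r \<open>coprime r q\<close> by (simp add: sum.delta')
    finally show ?thesis
      using True by simp
  qed
  then show "Car_exists l (F_exp j q)"
    and "Car l (F_exp j q) = (if l = q then 1 else 0) * (1 / of_nat (totient q))"
    using Car_eq[OF mean] by auto
qed

subsection \<open>Dirichlet characters\<close>


lemma dirichlet_charsD:
  assumes "chi \<in> dirichlet_chars n"
  shows "chi (a * b) = chi a * chi b" "chi (a + n) = chi a" "chi a = 0 \<longleftrightarrow> \<not> coprime a n"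
  using assms by (auto simp: dirichlet_chars_def)

lemma periodic_mod:
  fixes G :: "nat \<Rightarrow> 'a"
  assumes "\<And>x. G (x + n) = G x"
  shows "G (x mod n) = G x"
proof -
  have "G (y + k * n) = G y" for y k
  proof (induction k)
    case (Suc k)
    then show ?case
      using assms[of "y + k * n"] by (simp add: algebra_simps)
  qed simp
  from this[of "x mod n" "x div n"] show ?thesis
    by simp
qed

lemma periodic_cong:
  fixes G :: "nat \<Rightarrow> 'a"
  assumes "\<And>x. G (x + n) = G x" "[x = y] (mod n)"
  shows "G x = G y"
  using periodic_mod[of G n, OF assms(1)] assms(2) by (metis cong_def)

lemma dirichlet_char_1:
  assumes "chi \<in> dirichlet_chars n"
  shows "chi 1 = 1" "chi (Suc 0) = 1"
proof -
  have "chi 1 * chi 1 = chi 1" "chi 1 \<noteq> 0"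
    using dirichlet_charsD(1)[OF assms, of 1 1] dirichlet_charsD(3)[OF assms, of 1] by auto
  then show "chi 1 = 1" "chi (Suc 0) = 1"
    by simp_all
qed

lemma norm_dirichlet_char:
  assumes "chi \<in> dirichlet_chars n" "n \<ge> 1" "coprime a n"
  shows "norm (chi a) = 1"
proof -
  have pow: "chi (a ^ k) = chi a ^ k" for k
    using dirichlet_char_1[OF assms(1)]
        by (induction k) (auto simp: dirichlet_charsD(1)[OF assms(1)])
  have "chi (a ^ totient n) = chi 1"
    using periodic_cong[of chi n "a ^ totient n" 1] dirichlet_charsD(2)[OF assms(1)]
      euler_theorem[OF assms(3)] by blast
  then have "norm (chi a) ^ totient n = 1"
    using dirichlet_char_1[OF assms(1)] by (metis pow norm_power norm_one)
  then show ?thesis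
    using assms(2) power_eq_1_iff[of "norm (chi a)" "totient n"] by auto
qed

lemma norm_dirichlet_char_le:
  assumes "chi \<in> dirichlet_chars n" "n \<ge> 1"
  shows "norm (chi a) \<le> 1"
  using norm_dirichlet_char[OF assms, of a] dirichlet_charsD(3)[OF assms(1), of a]
  by (cases "coprime a n") auto

lemma dirichlet_char_cnj_mult:
  assumes "chi \<in> dirichlet_chars n" "n \<ge> 1" "coprime a n"
  shows "chi a * cnj (chi a) = 1"
  using norm_dirichlet_char[OF assms] by (simp add: complex_norm_square [symmetric])

lemma sum_residues_mult:
  fixes G :: "nat \<Rightarrow> 'a :: comm_monoid_add"
  assumes per: "\<And>x. G (x + n) = G x" and j: "coprime j n" and n: "n \<ge> 1"
  shows "(\<Sum>m<n. G (j * m)) = (\<Sum>m<n. G m)"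
proof -
  have inj: "inj_on (\<lambda>m. j * m mod n) {..<n}"
  proof (rule inj_onI)
    fix x y assume xy: "x \<in> {..<n}" "y \<in> {..<n}" "j * x mod n = j * y mod n"
    then have "[j * x = j * y] (mod n)"
      by (simp add: cong_def)
    then have "[x = y] (mod n)"
      using j by (simp add: cong_mult_lcancel_nat)
    then show "x = y"
      using xy by (simp add: cong_def)
  qed
  moreover have "(\<lambda>m. j * m mod n) ` {..<n} \<subseteq> {..<n}"
    using n by auto
  ultimately have "bij_betw (\<lambda>m. j * m mod n) {..<n} {..<n}"
    by (simp add: bij_betw_def endo_inj_surj)
  then have "(\<Sum>m<n. G (j * m mod n)) = (\<Sum>m<n. G m)"
    by (rule sum.reindex_bij_betw)
  then show ?thesis
    by (simp add: periodic_mod[of G n, OF per])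
qed

lemma coprime_add_right_self: "coprime (a + n) n \<longleftrightarrow> coprime a (n::nat)"
  by (metis coprime_iff_gcd_eq_1 gcd_add1)

text \<open>Passes from the representatives 1..n of the Gauss sum to 0..n-1, where reindexing by
  residues is convenient; the two end points agree by periodicity.\<close>

lemma sum_units:
  fixes G :: "nat \<Rightarrow> 'a :: comm_monoid_add"
  assumes per: "\<And>x. G (x + n) = G x" and n: "n \<ge> 1"
  shows "(\<Sum>m | 1 \<le> m \<and> m \<le> n \<and> coprime m n. G m) = (\<Sum>m<n. if coprime m n then G m else 0)"
proof -
  define H where "H m = (if coprime m n then G m else 0)" for m
  have "H n = H 0"
    using per[of 0] coprime_add_right_self[of 0 n] by (auto simp: H_def)
  have "(\<Sum>m | 1 \<le> m \<and> m \<le> n \<and> coprime m n. G m) = (\<Sum>m\<in>{1..n}. H m)"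
    by (rule sum.mono_neutral_cong_left) (auto simp: H_def)
  also have "\<dots> = (\<Sum>m\<in>{1..<n}. H m) + H n"
    using n by (metis Suc_eq_plus1 Suc_le_eq add.commute atLeastLessThanSuc_atLeastAtMost
        le_add_diff_inverse plus_1_eq_Suc sum.atLeastLessThan_Suc)
  also have "\<dots> = (\<Sum>m<n. H m)"
    using n \<open>H n = H 0\<close> by (simp add: lessThan_atLeast0 sum.atLeast_Suc_lessThan add.commute)
  finally show ?thesis
    by (simp add: H_def)
qed

lemma sum_units_mult:
  fixes G :: "nat \<Rightarrow> 'a :: comm_monoid_add"
  assumes per: "\<And>x. G (x + n) = G x" and j: "coprime j n" and n: "n \<ge> 1"
  shows "(\<Sum>m | 1 \<le> m \<and> m \<le> n \<and> coprime m n. G (j * m)) = (\<Sum>m | 1 \<le> m \<and> m \<le> n \<and> coprime m n. G m)"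
proof -
  have per': "G (j * (x + n)) = G (j * x)" for x
    by (rule periodic_cong[of G n, OF per]) (simp add: cong_def distrib_left)
  have "(\<Sum>m | 1 \<le> m \<and> m \<le> n \<and> coprime m n. G (j * m)) = (\<Sum>m<n. if coprime (j * m) n then G (j * m)
      else 0)"
    using sum_units[of "\<lambda>m. G (j * m)" n, OF per' n] j by simp
  also have "\<dots> = (\<Sum>m<n. if coprime m n then G m else 0)"
    using j n per by (intro sum_residues_mult) (auto simp: coprime_add_right_self)
  finally show ?thesis
    using sum_units[of G n, OF per n] by simp
qed

text \<open>Multiplying the summation variable by a unit \<open>a\<close> with chi a \<noteq> 1
  permutes the residues but scales the sum by chi a.\<close>

lemma sum_dirichlet_char:
  assumes chi: "chi \<in> dirichlet_chars n" and n: "n \<ge> 1" and np: "chi \<noteq> principal_char n"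
  shows "(\<Sum>m<n. chi m) = 0"
proof -
  obtain a where a: "chi a \<noteq> principal_char n a"
    using np by auto
  then have "coprime a n"
    using dirichlet_charsD(3)[OF chi, of a] by (auto simp: principal_char_def split: if_splits)
  then have "chi a \<noteq> 1"
    using a by (simp add: principal_char_def)
  have "(\<Sum>m<n. chi m) = (\<Sum>m<n. chi (a * m))"
    using sum_residues_mult[of chi n a, OF dirichlet_charsD(2)[OF chi] \<open>coprime a n\<close> n] by simp
  also have "\<dots> = chi a * (\<Sum>m<n. chi m)"
    by (simp add: dirichlet_charsD(1)[OF chi] sum_distrib_left)
  finally show ?thesis
    using \<open>chi a \<noteq> 1\<close> by simp
qed

text \<open>Complete periods cancel, which leaves fewer than \<open>n\<close> terms of norm at most
  1.\<close>

lemma norm_sum_dirichlet_char_le: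
  assumes chi: "chi \<in> dirichlet_chars n" and n: "n \<ge> 1" and np: "chi \<noteq> principal_char n"
  shows "norm (\<Sum>m<N. chi m) \<le> real n"
proof -
  have block: "(\<Sum>m<n * k. chi m) = 0" for k
  proof (induction k)
    case (Suc k)
    have split: "{..<n * Suc k} = {..<n * k} \<union> {n * k..<n * k + n}"
      by auto
    have "(\<Sum>m<n * Suc k. chi m) = (\<Sum>m<n * k. chi m) + (\<Sum>m=n * k..<n * k + n. chi m)"
      by (subst split, rule sum.union_disjoint) auto
    also have "(\<Sum>m=n * k..<n * k + n. chi m) = (\<Sum>m<n. chi (m + n * k))"
      by (rule sum.reindex_bij_witness[of _ "\<lambda>m. m + n * k" "\<lambda>m. m - n * k"]) auto
    also have "\<dots> = (\<Sum>m<n. chi m)"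
      using periodic_cong[of chi n, OF dirichlet_charsD(2)[OF chi]]
          by (intro sum.cong) (auto simp: cong_def)
    finally show ?case
      using Suc sum_dirichlet_char[OF assms] by simp
  qed simp
  have split: "{..<N} = {..<n * (N div n)} \<union> {n * (N div n)..<N}"
    using order.strict_trans2[OF _ times_div_less_eq_dividend[of n N]] by auto
  have "(\<Sum>m<N. chi m) = (\<Sum>m<n * (N div n). chi m) + (\<Sum>m=n * (N div n)..<N. chi m)"
    by (subst split, rule sum.union_disjoint) auto
  also have "norm \<dots> \<le> (\<Sum>m=n * (N div n)..<N. 1)"
    unfolding block add_0_left by (rule sum_norm_le) (rule norm_dirichlet_char_le[OF chi n])
  also have "\<dots> = real (N mod n)"
    by (simp add: minus_mult_div_eq_mod)
  also have "\<dots> \<le> real n"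
    using n by (simp add: less_imp_le)
  finally show ?thesis .
qed

lemma dirichlet_char_orthogonality:
  assumes chi: "chi \<in> dirichlet_chars n" and psi: "psi \<in> dirichlet_chars n" and n: "n \<ge> 1"
  shows "(\<Sum>m | 1 \<le> m \<and> m \<le> n \<and> coprime m n. chi m * cnj (psi m))
    = (if chi = psi then of_nat (totient n) else 0)"
proof -
  have "{m. 1 \<le> m \<and> m \<le> n \<and> coprime m n} = totatives n"
    by (auto simp: totatives_def)
  then have card: "(\<Sum>m | 1 \<le> m \<and> m \<le> n \<and> coprime m n. 1 :: complex) = of_nat (totient n)"
    by (simp add: totient_def)
  show ?thesis
  proof (cases "chi = psi")
    case True
    then show ?thesis
      using dirichlet_char_cnj_mult[OF psi n] card by simp
  next
    case False
    \<comment> \<open>Orthogonality reduces to the vanishing sum of the single non-principal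
      character chi * cnj psi.\<close>
    define theta where "theta m = chi m * cnj (psi m)" for m
    have theta: "theta \<in> dirichlet_chars n"
      using dirichlet_charsD[OF chi] dirichlet_charsD[OF psi]
      by (auto simp: dirichlet_chars_def theta_def)
    have "theta \<noteq> principal_char n"
    proof
      assume eq: "theta = principal_char n"
      have "chi a = psi a" for a
      proof (cases "coprime a n")
        case True
        then have "chi a * cnj (psi a) = psi a * cnj (psi a)"
          using fun_cong[OF eq, of a] dirichlet_char_cnj_mult[OF psi n True]
          by (simp add: theta_def principal_char_def)
        moreover have "cnj (psi a) \<noteq> 0"
          using dirichlet_charsD(3)[OF psi, of a] True by simp
        ultimately show ?thesis
          by simp
      next
        case False
        then show ?thesis
          using dirichlet_charsD(3)[OF psi, of a] dirichlet_charsD(3)[OF chi, of a] by simp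
      qed
      then show False
        using False by auto
    qed
    then have "(\<Sum>m<n. theta m) = 0"
      using sum_dirichlet_char[OF theta n] by simp
    moreover have "(\<Sum>m<n. theta m) = (\<Sum>m<n. if coprime m n then theta m else 0)"
      using dirichlet_charsD(3)[OF theta] by (intro sum.cong) auto
    ultimately show ?thesis
      using False sum_units[of theta n, OF dirichlet_charsD(2)[OF theta] n] by (simp add: theta_def)
  qed
qed

text \<open>
  The translations \<open>f \<mapsto> f (a * _)\<close> by units commute and have finite order, so every function on
  the units splits into simultaneous eigenfunctions; these are multiples of characters.
  The set \<open>A\<close> collects the units whose translation has not been diagonalised yet.
\<close>

lemma dirichlet_chars_span_aux:
  assumes n: "n \<ge> 1" and "finite A"
    and "\<And>x. f (x + n) = f x"
    and "\<And>x. \<not> coprime x n \<Longrightarrow> f x = (0 :: complex)"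
    and "\<And>a. a < n \<Longrightarrow> coprime a n \<Longrightarrow> a \<notin> A \<Longrightarrow> \<exists>w. \<forall>x. f (a * x) = w * f x"
  shows "\<exists>c. \<forall>x. f x = (\<Sum>chi\<in>dirichlet_chars n. c chi * chi x)"
  using assms(2-)
proof (induction A arbitrary: f rule: finite_induct)
  \<comment> \<open>Now every unit translation acts by a scalar, so \<open>f\<close> is determined
    by \<open>f 1\<close>: it is 0, or \<open>f 1\<close> times a multiplicative function that is
    nonzero exactly on the units.\<close>
  case empty
  have per: "f x = f y" if "[x = y] (mod n)" for x y
    using that by (rule periodic_cong[of f n, OF empty(1)])
  have eig: "\<exists>w. \<forall>y. f (x * y) = w * f y" if "coprime x n" for x
  proof -
    have "x mod n < n" "coprime (x mod n) n"
      using that n by auto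
    with empty(3) obtain w where "\<forall>y. f (x mod n * y) = w * f y"
      by blast
    moreover have "f (x * y) = f (x mod n * y)" for y
      by (rule per) (simp add: cong_def mod_mult_left_eq)
    ultimately show ?thesis
      by auto
  qed
  then obtain w where w: "\<And>x y. coprime x n \<Longrightarrow> f (x * y) = w x * f y"
    by metis
  have wx: "f x = w x * f 1" if "coprime x n" for x
    using w[OF that, of 1] by simp
  show ?case
  proof (cases "f 1 = 0")
    case True
    then have "f x = 0" for x
      using wx[of x] empty(2)[of x] by (cases "coprime x n") auto
    then show ?thesis
      by (intro exI[of _ "\<lambda>_. 0"]) simp
  next
    case False
    define chi where "chi x = f x / f 1" for x
    have w_nz: "w x \<noteq> 0" if cop: "coprime x n" for x
    proof
      assume "w x = 0"
      obtain y where "[x * y = 1] (mod n)"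
        using cong_solve_coprime_nat[OF cop] by auto
      then have "f 1 = w x * f y"
        using per[of "x * y" 1] w[OF cop, of y] by simp
      then show False
        using False \<open>w x = 0\<close> by simp
    qed
    have "chi (a * b) = chi a * chi b" for a b
    proof (cases "coprime a n")
      case True
      then show ?thesis
        using w[OF True, of b] wx[OF True] False by (simp add: chi_def)
    next
      case False
      then show ?thesis
        using empty(2) by (simp add: chi_def)
    qed
    moreover have "chi a \<noteq> 0 \<longleftrightarrow> coprime a n" for a
      using False wx[of a] w_nz[of a] empty(2)[of a] by (cases "coprime a n") (auto simp: chi_def)
    ultimately have chi: "chi \<in> dirichlet_chars n"
      using empty(1) by (simp add: dirichlet_chars_def chi_def)
    have "f x = (\<Sum>psi\<in>dirichlet_chars n. (if psi = chi then f 1 else 0) * psi x)" for x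
    proof -
      have "(\<Sum>psi\<in>dirichlet_chars n. (if psi = chi then f 1 else 0) * psi x)
          = (\<Sum>psi\<in>dirichlet_chars n. if psi = chi then f 1 * chi x else 0)"
        by (rule sum.cong) auto
      also have "\<dots> = f x"
        using chi False finite_dirichlet_chars[OF n] by (simp add: chi_def)
      finally show ?thesis ..
    qed
    then show ?thesis
      by (intro exI[of _ "\<lambda>psi. if psi = chi then f 1 else 0"]) simp
  qed
next
  case (insert a A)
  show ?case
  proof (cases "coprime a n")
    case False
    then have "aa \<notin> insert a A" if "coprime aa n" "aa \<notin> A" for aa
      using that by auto
    then show ?thesis
      using insert.prems by (intro insert.IH) blast+
  next
    case True
    have per: "f x = f y" if "[x = y] (mod n)" for x y
      using that by (rule periodic_cong[of f n, OF insert.prems(1)])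
    define e where "e = totient n"
    have e: "e > 0"
      using n by (simp add: e_def)
    \<comment> \<open>With e = \<phi>(n), the e-th power of translation by \<open>a\<close> is the
      identity, and \<open>g i\<close> is the projection of \<open>f\<close> to the eigenvalue
      \<open>inverse (e_q e (real i))\<close>. Summing over i < e kills every k \<noteq> 0, so the
      \<open>g i\<close> add up to \<open>f\<close>.\<close>
    define g where "g i x = (\<Sum>k<e. e_q e (real (i * k)) * f (a ^ k * x)) / of_nat e" for i x
    have g_per: "g i (x + n) = g i x" for i x
    proof -
      have "f (a ^ k * (x + n)) = f (a ^ k * x)" for k
        by (rule per) (simp add: cong_def distrib_left)
      then show ?thesis
        by (simp add: g_def)
    qed
    have g_zero: "g i x = 0" if "\<not> coprime x n" for i x
      using that insert.prems(2) by (simp add: g_def)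
    have g_a: "g i (a * x) = inverse (e_q e (real i)) * g i x" for i x
    proof -
      define h where "h k = e_q e (real (i * k)) * f (a ^ k * x)" for k
      have "[a ^ e * x = 1 * x] (mod n)"
        unfolding e_def by (intro cong_mult euler_theorem True cong_refl)
      then have "f (a ^ e * x) = f x"
        using per by simp
      moreover have "e_q e (real (i * e)) = 1"
        using e e_q_eq_1_iff[of e "i * e"] by simp
      ultimately have "h e = h 0"
        by (simp add: h_def)
      have "(\<Sum>k<e. h (Suc k)) = (\<Sum>k<Suc e. h k) - h 0"
        by (simp only: sum.lessThan_Suc_shift) simp
      also have "\<dots> = (\<Sum>k<e. h k)"
        using \<open>h e = h 0\<close> by simp
      finally have shift: "(\<Sum>k<e. h (Suc k)) = (\<Sum>k<e. h k)" .
      have "e_q e (real (i * k)) * f (a ^ k * (a * x)) = inverse (e_q e (real i)) * h (Suc k)" for k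
        by (simp add: h_def e_q_add distrib_left mult_ac)
      then have "g i (a * x) = inverse (e_q e (real i)) * (\<Sum>k<e. h (Suc k)) / of_nat e"
        by (simp add: g_def sum_distrib_left)
      then show ?thesis
        unfolding shift by (simp add: g_def h_def)
    qed
    have g_eig: "\<exists>w. \<forall>x. g i (b * x) = w * g i x" if b: "b < n" "coprime b n" "b \<notin> A" for i b
    proof (cases "b = a")
      case True
      then show ?thesis
        using g_a by blast
    next
      case False
      then obtain w where w: "\<And>x. f (b * x) = w * f x"
        using insert.prems(3)[of b] b by auto
      \<comment> \<open>Translations commute, so the projections inherit the eigenvalues that
        \<open>f\<close> already has.\<close>
      have eq: "f (a ^ k * (b * x)) = w * f (a ^ k * x)" for k x
        using w[of "a ^ k * x"] by (simp add: mult_ac)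
      have "g i (b * x) = w * g i x" for x
        unfolding g_def eq times_divide_eq_right sum_distrib_left by (simp add: mult_ac)
      then show ?thesis
        by blast
    qed
    have "\<exists>c. \<forall>x. g i x = (\<Sum>chi\<in>dirichlet_chars n. c chi * chi x)" for i
      using g_per g_zero g_eig by (intro insert.IH) auto
    then obtain c where c: "\<And>i x. g i x = (\<Sum>chi\<in>dirichlet_chars n. c i chi * chi x)"
      by metis
    have "f x = (\<Sum>chi\<in>dirichlet_chars n. (\<Sum>i<e. c i chi) * chi x)" for x
    proof -
      have "(\<Sum>chi\<in>dirichlet_chars n. (\<Sum>i<e. c i chi) * chi x) = (\<Sum>i<e. g i x)"
        unfolding c sum_distrib_right by (rule sum.swap)
      also have "\<dots> = (\<Sum>k<e. \<Sum>i<e. e_q e (real (i * k)) * f (a ^ k * x)) / of_nat e"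
        unfolding g_def sum_divide_distrib [symmetric] by (subst sum.swap) simp
      also have "(\<Sum>k<e. \<Sum>i<e. e_q e (real (i * k)) * f (a ^ k * x))
          = (\<Sum>k<e. if k = 0 then of_nat e * f x else 0)"
        unfolding sum_distrib_right [symmetric] sum_e_q[OF e]
        by (intro sum.cong) (auto dest: dvd_imp_le)
      also have "\<dots> / of_nat e = f x"
        using e by simp
      finally show ?thesis ..
    qed
    then show ?thesis
      by (intro exI[of _ "\<lambda>chi. \<Sum>i<e. c i chi"]) simp
  qed
qed

text \<open>Spanning supplies some coefficients and orthogonality identifies them.\<close>

lemma dirichlet_char_expansion:
  assumes n: "n \<ge> 1" and per: "\<And>x. f (x + n) = f x"
    and zero: "\<And>x. \<not> coprime x n \<Longrightarrow> f x = (0 :: complex)"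
  shows "f x = (\<Sum>chi\<in>dirichlet_chars n.
    (\<Sum>m | 1 \<le> m \<and> m \<le> n \<and> coprime m n. f m * cnj (chi m)) / of_nat (totient n) * chi x)"
proof -
  obtain c where c: "\<And>x. f x = (\<Sum>chi\<in>dirichlet_chars n. c chi * chi x)"
    \<comment> \<open>With A = {..<n} no translation is assumed diagonal, so the eigenfunction
      hypothesis is vacuous.\<close>
    using dirichlet_chars_span_aux[of n "{..<n}" f] assms by auto
  have "(\<Sum>m | 1 \<le> m \<and> m \<le> n \<and> coprime m n. f m * cnj (psi m)) = c psi * of_nat (totient n)"
    if psi: "psi \<in> dirichlet_chars n" for psi
  proof -
    have "(\<Sum>m | 1 \<le> m \<and> m \<le> n \<and> coprime m n. f m * cnj (psi m))
        = (\<Sum>chi\<in>dirichlet_chars n. c chi * (\<Sum>m | 1 \<le> m \<and> m \<le> n \<and> coprime m n. chi m * cnj (psi m)))"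
      unfolding c sum_distrib_right sum_distrib_left by (subst sum.swap) (simp add: mult.assoc)
    also have "\<dots> = (\<Sum>chi\<in>dirichlet_chars n. if chi = psi then c chi * of_nat (totient n) else 0)"
      using dirichlet_char_orthogonality[OF _ psi n] by (intro sum.cong) auto
    also have "\<dots> = c psi * of_nat (totient n)"
      using psi finite_dirichlet_chars[OF n] by simp
    finally show ?thesis .
  qed
  then show ?thesis
    using n by (simp add: c)
qed

text \<open>In the coefficient of chi the substitution of j * m for m turns the exponential into
  that of a Gauss sum; the conjugate character then releases the factor chi j.\<close>

lemma e_q_dirichlet_char_expansion:
  assumes n: "n \<ge> 1" and j: "coprime j n"
  shows "(if coprime t n then e_q n (real (j * t)) else 0) =
    1 / of_nat (totient n) * (\<Sum>chi\<in>dirichlet_chars n. gauss_sum n (\<lambda>m. cnj (chi m)) * chi j * chi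
        t)"
proof -
  define f where "f t = (if coprime t n then e_q n (real (j * t)) else 0)" for t
  have per: "f (x + n) = f x" for x
    unfolding f_def coprime_add_right_self
    using e_q_cong[of n "j * (x + n)" "j * x"] n by (simp add: cong_def distrib_left)
  have coeff: "(\<Sum>m | 1 \<le> m \<and> m \<le> n \<and> coprime m n. f m * cnj (chi m))
      = gauss_sum n (\<lambda>m. cnj (chi m)) * chi j" if chi: "chi \<in> dirichlet_chars n" for chi
  proof -
    have "f m * cnj (chi m) = chi j * (cnj (chi (j * m)) * e_q n (real (j * m)))" if "coprime m n"
        for m
      using dirichlet_char_cnj_mult[OF chi n j] that
      by (simp add: f_def dirichlet_charsD(1)[OF chi] mult_ac)
    then have "(\<Sum>m | 1 \<le> m \<and> m \<le> n \<and> coprime m n. f m * cnj (chi m))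
        = chi j * (\<Sum>m | 1 \<le> m \<and> m \<le> n \<and> coprime m n. cnj (chi (j * m)) * e_q n (real (j * m)))"
      unfolding sum_distrib_left by (intro sum.cong) auto
    also have "(\<Sum>m | 1 \<le> m \<and> m \<le> n \<and> coprime m n. cnj (chi (j * m)) * e_q n (real (j * m)))
        = (\<Sum>m | 1 \<le> m \<and> m \<le> n \<and> coprime m n. cnj (chi m) * e_q n (real m))"
      using j n dirichlet_charsD(2)[OF chi] e_q_cong[of n "x + n" x for x]
      by (intro sum_units_mult[where G = "\<lambda>m. cnj (chi m) * e_q n (real m)"]) (auto simp: cong_def)
    finally show ?thesis
      by (simp add: gauss_sum_def mult.commute)
  qed
  have "f t = (\<Sum>chi\<in>dirichlet_chars n.
      (\<Sum>m | 1 \<le> m \<and> m \<le> n \<and> coprime m n. f m * cnj (chi m)) / of_nat (totient n) * chi t)"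
    by (rule dirichlet_char_expansion[of n f, OF n per]) (simp add: f_def)
  also have "\<dots> = 1 / of_nat (totient n) * (\<Sum>chi\<in>dirichlet_chars n. gauss_sum n (\<lambda>m. cnj (chi m)) *
      chi j * chi t)"
    unfolding sum_distrib_left by (rule sum.cong) (simp_all add: coeff del: One_nat_def)
  finally show ?thesis
    by (simp add: f_def)
qed

subsection \<open>Expansion into characters\<close>


lemma has_sum_finite_sum:
  fixes f :: "'i \<Rightarrow> 'a \<Rightarrow> complex"
  assumes "\<And>i. i \<in> I \<Longrightarrow> (f i has_sum S i) A"
  shows "((\<lambda>x. \<Sum>i\<in>I. f i x) has_sum (\<Sum>i\<in>I. S i)) A"
  using assms by (induction I rule: infinite_finite_induct) (auto intro: has_sum_add)

text \<open>For \<open>n\<close> coprime to the modulus, chi (n div d) = chi n * cnj (chi d) for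
  each divisor d. This is how the conjugates enter the product over the primes of
  \<open>l''\<close>.\<close>

lemma sum_moebius_dirichlet_char:
  assumes chi: "chi \<in> dirichlet_chars q" and q: "q \<ge> 1" and n: "n > 0" "coprime n q"
  shows "(\<Sum>d | d dvd n. of_int (moebius_mu (n div d)) * chi d) =
    chi n * (\<Prod>p\<in>prime_factors n. 1 - cnj (chi p))"
proof -
  have "(\<Sum>d | d dvd n. of_int (moebius_mu (n div d)) * chi d)
      = (\<Sum>d | d dvd n. (\<lambda>e. of_int (moebius_mu e) * chi (n div e)) (n div d))"
    using n by (intro sum.cong) (auto elim!: dvdE)
  also have "\<dots> = (\<Sum>d | d dvd n. of_int (moebius_mu d) * chi (n div d))"
    by (rule sum_divisors_flip[OF n(1)])
  also have "\<dots> = (\<Sum>d | d dvd n. chi n * (of_int (moebius_mu d) * cnj (chi d)))"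
  proof (rule sum.cong)
    fix d assume "d \<in> {d. d dvd n}"
    then obtain k where k: "n = d * k"
      by auto
    then have "coprime d q" "d > 0"
      using n by auto
    then show "of_int (moebius_mu d) * chi (n div d)
        = chi n * (of_int (moebius_mu d) * cnj (chi d))"
      using dirichlet_char_cnj_mult[OF chi q \<open>coprime d q\<close>]
      by (simp add: k dirichlet_charsD(1)[OF chi] mult_ac)
  qed simp
  also have "\<dots> = chi n * (\<Prod>p\<in>prime_factors n. 1 - cnj (chi p))"
    using sum_divisors_moebius[of "\<lambda>d. cnj (chi d)" n] n dirichlet_char_1[OF chi]
    by (simp add: sum_distrib_left [symmetric] dirichlet_charsD(1)[OF chi])
  finally show ?thesis .
qed

lemma has_sum_dirichlet_char_smooth:
  assumes chi: "chi \<in> dirichlet_chars q" and q: "q \<ge> 1"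
  shows "((\<lambda>t. chi t / of_nat t) has_sum (\<Prod>p | prime p \<and> p
      \<le> P. inverse (1 - chi p / of_nat p))) (smooth P)"
proof (rule euler_product_smooth(1))
  show "norm (chi p / of_nat p) < 1" if "prime p" for p
    using norm_dirichlet_char_le[OF assms, of p] prime_gt_1_nat[OF that]
    by (simp add: norm_divide divide_simps)
qed (use dirichlet_char_1[OF chi] in \<open>auto simp: dirichlet_charsD(1)[OF chi]\<close>)

text \<open>Insert the divisor formula for the Ramanujan sum. For t = d * u the factor d cancels
  against 1/t, so each d contributes \<mu>(n / d) * chi d times the same Euler product.\<close>

lemma has_sum_char_ramanujan_smooth_coprime:
  assumes chi: "chi \<in> dirichlet_chars q" and q: "q \<ge> 1" and n: "n \<in> smooth P" "coprime n q"
  shows "((\<lambda>t. chi t * ramanujan_sum n t / of_nat t) has_sum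
    chi n * (\<Prod>p\<in>prime_factors n. 1 - cnj (chi p)) * (\<Prod>p | prime p \<and> p
        \<le> P. inverse (1 - chi p / of_nat p))) (smooth P)"
proof -
  have pos: "n > 0"
    using n by (simp add: smooth_pos)
  define L where "L = (\<Prod>p | prime p \<and> p \<le> P. inverse (1 - chi p / of_nat p))"
  have L: "((\<lambda>t. chi t / of_nat t) has_sum L) (smooth P)"
    unfolding L_def by (rule has_sum_dirichlet_char_smooth[OF chi q])
  have "((\<lambda>t. \<Sum>d | d dvd n. of_int (moebius_mu (n div d)) * chi d *
        (if d dvd t then chi (t div d) / of_nat (t div d) else 0))
      has_sum (\<Sum>d | d dvd n. of_int (moebius_mu (n div d)) * chi d * L)) (smooth P)"
    using n by (intro has_sum_finite_sum has_sum_cmult_right has_sum_smooth_dilate[OF _ L])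
      (auto intro: smooth_dvd)
  also have "(\<Sum>d | d dvd n. of_int (moebius_mu (n div d)) * chi d * L)
      = chi n * (\<Prod>p\<in>prime_factors n. 1 - cnj (chi p)) * L"
    using sum_moebius_dirichlet_char[OF chi q pos n(2)] by (simp add: sum_distrib_right [symmetric])
  also have "((\<lambda>t. \<Sum>d | d dvd n. of_int (moebius_mu (n div d)) * chi d *
        (if d dvd t then chi (t div d) / of_nat (t div d) else 0))
      has_sum chi n * (\<Prod>p\<in>prime_factors n. 1 - cnj (chi p)) * L) (smooth P) \<longleftrightarrow>
      ((\<lambda>t. chi t * ramanujan_sum n t / of_nat t) has_sum
      chi n * (\<Prod>p\<in>prime_factors n. 1 - cnj (chi p)) * L) (smooth P)"
  proof (rule has_sum_cong)
    fix t assume "t \<in> smooth P"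
    then have t: "t > 0"
      by (rule smooth_pos)
    show "(\<Sum>d | d dvd n. of_int (moebius_mu (n div d)) * chi d *
        (if d dvd t then chi (t div d) / of_nat (t div d) else 0))
            = chi t * ramanujan_sum n t / of_nat t"
      unfolding ramanujan_sum_divisors[OF pos] sum_distrib_left sum_divide_distrib
    proof (rule sum.cong)
      fix d assume "d \<in> {d. d dvd n}"
      show "of_int (moebius_mu (n div d)) * chi d * (if d dvd t then chi (t div d) / of_nat (t div
          d) else 0) =
          chi t * (if d dvd t then of_nat d * of_int (moebius_mu (n div d)) else 0) / of_nat t"
      proof (cases "d dvd t")
        case True
        then obtain k where "t = d * k"
          by auto
        then show ?thesis
          using t by (simp add: dirichlet_charsD(1)[OF chi])
      qed simp
    qed simp
  qed
  finally show ?thesis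
    by (simp add: L_def)
qed

text \<open>The character restricts t to integers coprime to q, where gcd l t = gcd l2 t. If l2 is
  coprime to q, then \<mu> and \<phi> of q2 split off in Hoelder's formula and the coprime case
  applies to l2. Otherwise a prime divides l2 and q, hence also q2 and every l2 div gcd l2 t; so
  \<mu> vanishes on the left and chi l2 on the right.\<close>

lemma has_sum_char_ramanujan_smooth:
  fixes l q :: nat
  assumes chi: "chi \<in> dirichlet_chars q" and q: "q \<ge> 1" and l: "l \<in> smooth P"
  defines "q2 \<equiv> gcd l q"
  defines "l2 \<equiv> l div q2"
  shows "((\<lambda>t. chi t * (ramanujan_sum l t / of_nat (totient l)) / of_nat t) has_sum
    of_int (moebius_mu q2) * chi l2 / of_nat (totient l) * (\<Prod>p\<in>prime_factors l2. 1 - cnj (chi p)) *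
      (\<Prod>p | prime p \<and> p \<le> P. inverse (1 - chi p / of_nat p))) (smooth P)"
proof -
  have l_pos: "l > 0"
    using l by (rule smooth_pos)
  have lq: "l = q2 * l2"
    unfolding l2_def q2_def by simp
  have pos: "q2 > 0" "l2 > 0"
    using lq l_pos by auto
  have l2: "l2 \<in> smooth P"
    using l lq by (metis smooth_mult_iff)
  have "q2 dvd q"
    by (simp add: q2_def)
  have hoelder: "ramanujan_sum l t / of_nat (totient l) =
      of_int (moebius_mu (q2 * (l2 div gcd l2 t))) / of_nat (totient (q2 * (l2 div gcd l2 t)))"
    if t: "coprime t q" for t
  proof -
    have "coprime t q2"
      using t \<open>q2 dvd q\<close> by (meson coprime_divisors dvd_refl)
    then have "gcd (q2 * l2) t = gcd l2 t"
      by (rule gcd_mult_left_left_cancel)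
    then have "gcd l t = gcd l2 t"
      using lq by argo
    then have "l div gcd l t = q2 * (l2 div gcd l2 t)"
      using lq by (metis div_mult_swap gcd_dvd1)
    then show ?thesis
      by (simp add: ramanujan_sum_hoelder[OF l_pos])
  qed
  show ?thesis
  proof (cases "coprime l2 q")
    case True
    have cop: "coprime q2 l2"
      using True \<open>q2 dvd q\<close> by (meson coprime_commute coprime_divisors dvd_refl)
    have "((\<lambda>t. of_int (moebius_mu q2) / of_nat (totient l) * (chi t * ramanujan_sum l2 t / of_nat
        t)) has_sum
        of_int (moebius_mu q2) / of_nat (totient l) * (chi l2 * (\<Prod>p\<in>prime_factors l2. 1 - cnj (chi
            p)) *
        (\<Prod>p | prime p \<and> p \<le> P. inverse (1 - chi p / of_nat p)))) (smooth P)"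
      by (intro has_sum_cmult_right has_sum_char_ramanujan_smooth_coprime[OF chi q l2 True])
    also have "?this \<longleftrightarrow> ((\<lambda>t. chi t * (ramanujan_sum l t / of_nat (totient l)) / of_nat t) has_sum
        of_int (moebius_mu q2) / of_nat (totient l) * (chi l2 * (\<Prod>p\<in>prime_factors l2. 1 - cnj (chi
            p)) *
        (\<Prod>p | prime p \<and> p \<le> P. inverse (1 - chi p / of_nat p)))) (smooth P)"
    proof (rule has_sum_cong)
      fix t
      have "chi t * (ramanujan_sum l t / of_nat (totient l)) =
          of_int (moebius_mu q2) / of_nat (totient l) * (chi t * ramanujan_sum l2 t)"
      proof (cases "coprime t q")
        case True
        define k where "k = l2 div gcd l2 t"
        have "coprime q2 k"
          using cop by (metis k_def coprime_divisors div_dvd_iff_mult dvd_refl dvd_triv_left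
              gcd_dvd1 gcd_eq_0_iff pos(2) less_numeral_extra(3))
        have "ramanujan_sum l2 t / of_nat (totient l2) = of_int (moebius_mu k) / of_nat (totient k)"
          unfolding k_def by (rule ramanujan_sum_hoelder[OF pos(2)])
        then have "ramanujan_sum l2 t = of_int (moebius_mu k) / of_nat (totient k) * of_nat
            (totient l2)"
          using pos by (simp add: field_simps)
        moreover have "ramanujan_sum l t / of_nat (totient l) =
            of_int (moebius_mu q2) * of_int (moebius_mu k) / (of_nat (totient q2) * of_nat
                (totient k))"
          using hoelder[OF True] \<open>coprime q2 k\<close>
          by (simp add: k_def [symmetric] moebius_mu_mult_coprime totient_mult_coprime)
        moreover have "of_nat (totient l) = (of_nat (totient q2) * of_nat (totient l2) :: complex)"
          using cop by (simp add: lq totient_mult_coprime)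
        ultimately show ?thesis
          using pos by (simp add: field_simps)
      next
        case False
        then show ?thesis
          using dirichlet_charsD(3)[OF chi, of t] by simp
      qed
      then show "of_int (moebius_mu q2) / of_nat (totient l) * (chi t * ramanujan_sum l2 t /
          of_nat t) =
          chi t * (ramanujan_sum l t / of_nat (totient l)) / of_nat t"
        by (metis times_divide_eq_right)
    qed
    finally show ?thesis
      by (simp add: mult_ac)
  next
    case False
    obtain p where p: "prime p" "p dvd l2" "p dvd q"
      using False by (metis coprime_iff_gcd_eq_1 gcd_nat.bounded_iff prime_factor_nat)
    have "p dvd l"
      using p(2) lq by (metis dvd_mult)
    then have "p dvd q2"
      using p by (simp add: q2_def)
    have zero: "chi t * (ramanujan_sum l t / of_nat (totient l)) = 0" for t
    proof (cases "coprime t q")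
      case True
      have "\<not> p dvd gcd l2 t"
        using True p by (meson coprime_common_divisor gcd_dvd2 dvd_trans not_prime_unit)
      moreover have "p dvd gcd l2 t * (l2 div gcd l2 t)"
        using p by simp
      ultimately have "p dvd l2 div gcd l2 t"
        using p(1) by (metis prime_dvd_mult_iff)
      then have "\<not> coprime q2 (l2 div gcd l2 t)"
        using \<open>p dvd q2\<close> p(1) by (meson coprime_common_divisor not_prime_unit)
      then show ?thesis
        using hoelder[OF True] by (simp add: moebius_mu_not_coprime)
    next
      case False
      then show ?thesis
        using dirichlet_charsD(3)[OF chi, of t] by simp
    qed
    have zero': "chi l2 = 0"
      using False dirichlet_charsD(3)[OF chi, of l2] by simp
    show ?thesis
      unfolding zero zero' by simp
  qed
qed

text \<open>Both sides have the same Hoelder quotient, since l div gcd l (b * t) = l1 div gcd l1 t.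
  This is the origin of \<open>l'\<close>.\<close>

lemma ramanujan_sum_reduce:
  fixes l b t :: nat
  assumes l: "l > 0"
  defines "l1 \<equiv> l div gcd l b"
  shows "ramanujan_sum l (b * t) / of_nat (totient l) = ramanujan_sum l1 t / of_nat (totient l1)"
proof -
  define g where "g = gcd l b"
  have g: "g > 0"
    using l by (simp add: g_def)
  define b1 where "b1 = b div g"
  have eqs: "l = g * l1" "b = g * b1"
    by (simp_all add: g_def l1_def b1_def)
  have cop: "coprime l1 b1"
    unfolding l1_def b1_def g_def using l by (intro div_gcd_coprime) auto
  have pos: "l1 > 0"
    using eqs l by (cases l1) auto
  have "gcd l (b * t) = g * gcd l1 (b1 * t)"
    unfolding eqs by (simp add: gcd_mult_distrib_nat mult.assoc)
  also have "gcd l1 (b1 * t) = gcd l1 t"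
    using cop by (metis gcd.commute gcd_mult_left_left_cancel)
  finally have "l div gcd l (b * t) = l1 div gcd l1 t"
    using g eqs by (metis div_mult_mult1 less_numeral_extra(3))
  then show ?thesis
    by (simp add: ramanujan_sum_hoelder l pos)
qed

lemma coprime_div_div_iff_gcd:
  fixes b s q :: nat
  assumes "b dvd s" "b dvd q" "q > 0"
  shows "coprime (s div b) (q div b) \<longleftrightarrow> b = gcd s q"
proof -
  obtain x y where xy: "s = b * x" "q = b * y"
    using assms(1,2) by (elim dvdE)
  then have "b > 0"
    using assms by auto
  have "gcd s q = b * gcd x y"
    unfolding xy by (rule gcd_mult_distrib_nat [symmetric])
  then have "b = gcd s q \<longleftrightarrow> gcd x y = 1"
    using \<open>b > 0\<close> by auto
  moreover have "s div b = x" "q div b = y"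
    using xy \<open>b > 0\<close> by simp_all
  ultimately show ?thesis
    by (simp only: coprime_iff_gcd_eq_1)
qed

text \<open>Only b = gcd s q contributes: for it s / b is coprime to q / b and the exponential
  descends to modulus q / b. Summing formally over all b lets the sum over s be taken for each b
  separately.\<close>

lemma F_exp_ramanujan_expansion:
  assumes q: "q \<ge> 1" and j: "coprime j q" and l: "l > 0" and s: "s > 0"
  shows "F_exp j q s * (ramanujan_sum l s / of_nat (totient l)) =
    (\<Sum>b | b dvd q. if b dvd s then
       1 / of_nat (totient (q div b)) * (\<Sum>chi\<in>dirichlet_chars (q div b).
         gauss_sum (q div b) (\<lambda>m. cnj (chi m)) * chi j *
         (chi (s div b) * (ramanujan_sum (l div gcd l b) (s div b) / of_nat (totient (l div gcd l
             b)))))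
     else 0)"
proof -
  have "(if b dvd s then
       1 / of_nat (totient (q div b)) * (\<Sum>chi\<in>dirichlet_chars (q div b).
         gauss_sum (q div b) (\<lambda>m. cnj (chi m)) * chi j *
         (chi (s div b) * (ramanujan_sum (l div gcd l b) (s div b) / of_nat (totient (l div gcd l
             b)))))
     else 0) = (if b = gcd s q then F_exp j q s * (ramanujan_sum l s / of_nat (totient l)) else 0)"
    if b: "b dvd q" for b
  proof (cases "b dvd s")
    case True
    define q1 where "q1 = q div b"
    have q_eq: "q = b * q1"
      using b by (simp add: q1_def)
    then have pos: "b > 0" "q1 \<ge> 1"
      using q by (auto simp: Suc_le_eq)
    have j': "coprime j q1"
      using j q_eq by simp
    define t where "t = s div b"
    have s_eq: "s = b * t"
      using True by (simp add: t_def)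
    have "1 / of_nat (totient q1) * (\<Sum>chi\<in>dirichlet_chars q1.
         gauss_sum q1 (\<lambda>m. cnj (chi m)) * chi j *
         (chi t * (ramanujan_sum (l div gcd l b) t / of_nat (totient (l div gcd l b))))) =
        (if coprime t q1 then e_q q1 (real (j * t))
            else 0) * (ramanujan_sum l s / of_nat (totient l))"
      unfolding e_q_dirichlet_char_expansion[OF pos(2) j'] s_eq ramanujan_sum_reduce[OF l]
      by (simp only: sum_distrib_right [symmetric] mult.assoc [symmetric])
    also have "coprime t q1 \<longleftrightarrow> b = gcd s q"
      unfolding t_def q1_def using True b q by (intro coprime_div_div_iff_gcd) auto
    also have "e_q q1 (real (j * t)) = F_exp j q s"
      using e_q_cancel[OF pos(1), of q1 "real (j * t)"] by (simp add: F_exp_def q_eq s_eq mult_ac)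
    finally show ?thesis
      using True by (simp add: q1_def t_def)
  next
    case False
    then have "b \<noteq> gcd s q"
      by auto
    then show ?thesis
      using False by simp
  qed
  then have "(\<Sum>b | b dvd q. if b dvd s then
       1 / of_nat (totient (q div b)) * (\<Sum>chi\<in>dirichlet_chars (q div b).
         gauss_sum (q div b) (\<lambda>m. cnj (chi m)) * chi j *
         (chi (s div b) * (ramanujan_sum (l div gcd l b) (s div b) / of_nat (totient (l div gcd l
             b)))))
     else 0) = (\<Sum>b | b dvd q. if b
         = gcd s q then F_exp j q s * (ramanujan_sum l s / of_nat (totient l)) else 0)"
    by (intro sum.cong) auto
  also have "\<dots> = F_exp j q s * (ramanujan_sum l s / of_nat (totient l))"
    using q by (subst sum.delta) auto
  finally show ?thesis ..
qed

text \<open>The summand of one character for one b; here \<open>l\<close> and \<open>q\<close> play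
  the roles of l / gcd l b and q / b.\<close>

definition char_term :: "nat \<Rightarrow> nat \<Rightarrow> nat \<Rightarrow> nat \<Rightarrow> (nat \<Rightarrow> complex) \<Rightarrow> complex" where
  "char_term P j l q chi =
     gauss_sum q (\<lambda>m. cnj (chi m)) * chi j *
     (of_int (moebius_mu (gcd l q)) * chi (l div gcd l q) / of_nat (totient l)) *
     (\<Prod>p\<in>prime_factors (l div gcd l q). 1 - cnj (chi p)) *
     ((\<Prod>p | prime p \<and> p \<le> P. inverse (1 - chi p / of_nat p)) /
      (\<Prod>p | prime p \<and> p \<le> P. inverse (1 - 1 / of_nat p)))"

lemma Car_smooth_F_exp_all_chars:
  assumes q: "q \<ge> 1" "q \<le> P" and j: "coprime j q" and l: "l \<in> smooth P"
  shows "Car_smooth_exists P l (F_exp j q)"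
    and "Car_smooth P l (F_exp j q) = (\<Sum>b | b dvd q. 1 / (of_nat b * of_nat (totient (q div b))) *
      (\<Sum>chi\<in>dirichlet_chars (q div b). char_term P j (l div gcd l b) (q div b) chi))"
proof -
  have l_pos: "l > 0"
    using l by (rule smooth_pos)
  \<comment> \<open>The density of integers free of primes up to P; its reciprocal is the
    denominator in \<open>char_term\<close>.\<close>
  define W :: complex where "W = (\<Prod>p | prime p \<and> p \<le> P. 1 - 1 / of_nat p)"
  define T where "T b chi = gauss_sum (q div b) (\<lambda>m. cnj (chi m)) * chi j *
     (of_int (moebius_mu (gcd (l div gcd l b) (q div b))) *
       chi ((l div gcd l b) div gcd (l div gcd l b) (q div b)) / of_nat (totient (l div gcd l b)) *
     (\<Prod>p\<in>prime_factors ((l div gcd l b) div gcd (l div gcd l b) (q div b)). 1 - cnj (chi p)) *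
     (\<Prod>p | prime p \<and> p \<le> P. inverse (1 - chi p / of_nat p)))" for b chi
  define S where "S = (\<Sum>b | b dvd q. 1 / of_nat b *
      (1 / of_nat (totient (q div b)) * (\<Sum>chi\<in>dirichlet_chars (q div b). T b chi)))"
  define h where "h b t = 1 / of_nat (totient (q div b)) * (\<Sum>chi\<in>dirichlet_chars (q div b).
         gauss_sum (q div b) (\<lambda>m. cnj (chi m)) * chi j *
         (chi t * (ramanujan_sum (l div gcd l b) t / of_nat (totient (l div gcd l b))) / of_nat
             t))" for b t
  have h: "(h b has_sum (1 / of_nat (totient (q div b)) * (\<Sum>chi\<in>dirichlet_chars (q div b). T b
      chi))) (smooth P)"
    if b: "b dvd q" for b
    unfolding h_def T_def
  proof (intro has_sum_cmult_right has_sum_finite_sum has_sum_char_ramanujan_smooth)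
    show "q div b \<ge> 1"
      using b q by (auto simp: Suc_le_eq elim!: dvdE)
    have "l div gcd l b dvd l"
      by (metis dvd_mult_div_cancel dvd_triv_right gcd_dvd1)
    then show "l div gcd l b \<in> smooth P"
      using l by (rule smooth_dvd[rotated])
  qed
  have "((\<lambda>s. \<Sum>b | b dvd q. 1 / of_nat b * (if b dvd s then h b (s div b) else 0))
      has_sum S) (smooth P)"
    unfolding S_def
  proof (intro has_sum_finite_sum has_sum_cmult_right has_sum_smooth_dilate h)
    \<comment> \<open>Here q \<le> P is essential: only for smooth b do smooth multiples s = b * t
      correspond to all smooth t.\<close>
    fix b assume b: "b \<in> {b. b dvd q}"
    have "b \<le> q" "b \<ge> 1"
      using b q by (auto intro: dvd_imp_le dvd_pos_nat simp: Suc_le_eq)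
    then show "b \<in> smooth P"
      using q by (intro le_in_smooth) auto
  qed simp
  also have "?this \<longleftrightarrow> ((\<lambda>s. F_exp j q s * (ramanujan_sum l s / of_nat (totient l)) / of_nat s)
      has_sum S) (smooth P)"
  proof (rule has_sum_cong)
    fix s assume "s \<in> smooth P"
    then have s: "s > 0"
      by (rule smooth_pos)
    show "(\<Sum>b | b dvd q. 1 / of_nat b * (if b dvd s then h b (s div b) else 0)) =
        F_exp j q s * (ramanujan_sum l s / of_nat (totient l)) / of_nat s"
      unfolding F_exp_ramanujan_expansion[OF q(1) j l_pos s] sum_divide_distrib
    proof (rule sum.cong)
      fix b assume "b \<in> {b. b dvd q}"
      then have "b > 0"
        using q by (auto intro: dvd_pos_nat)
      have "1 / of_nat b * h b (s div b)
          = 1 / of_nat (totient (q div b)) * (\<Sum>chi\<in>dirichlet_chars (q div b).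
         gauss_sum (q div b) (\<lambda>m. cnj (chi m)) * chi j *
         (chi (s div b) * (ramanujan_sum (l div gcd l b) (s div b) / of_nat (totient (l div gcd l
             b))))) / of_nat s"
        if "b dvd s"
      proof -
        obtain t where t: "s = b * t"
          using \<open>b dvd s\<close> by auto
        show ?thesis
          using \<open>b > 0\<close> by (simp add: t h_def sum_distrib_left sum_divide_distrib mult_ac)
      qed
      then show "1 / of_nat b * (if b dvd s then h b (s div b) else 0) =
        (if b dvd s then
       1 / of_nat (totient (q div b)) * (\<Sum>chi\<in>dirichlet_chars (q div b).
         gauss_sum (q div b) (\<lambda>m. cnj (chi m)) * chi j *
         (chi (s div b) * (ramanujan_sum (l div gcd l b) (s div b) / of_nat (totient (l div gcd l
             b)))))
     else 0) / of_nat s"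
        by simp
    qed simp
  qed
  finally have "((\<lambda>s. of_nat (totient l) * W * (F_exp j q s * (ramanujan_sum l s / of_nat (totient
      l)) / of_nat s))
      has_sum (of_nat (totient l) * W * S)) (smooth P)"
    by (rule has_sum_cmult_right)
  then have "((\<lambda>s. F_exp j q s * (ramanujan_sum l s * W) / of_nat s)
      has_sum (of_nat (totient l) * W * S)) (smooth P)"
    using l_pos by (simp add: mult_ac)
  then have mean: "has_mean (\<lambda>a. smooth_part P (F_exp j q) a * ramanujan_sum l a) (of_nat (totient
      l) * W * S)"
    unfolding W_def
    by (rule has_mean_smooth_part[OF _ has_mean_ramanujan_coprime_smooth[OF l], rotated]) (simp
        add: F_exp_def)
  show "Car_smooth_exists P l (F_exp j q)"
    unfolding Car_smooth_exists_def by (rule Car_eq[OF mean])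
  have "Car_smooth P l (F_exp j q) = W * S"
    unfolding Car_smooth_def Car_eq(2)[OF mean] using l_pos by simp
  also have "\<dots> = (\<Sum>b | b dvd q. 1 / (of_nat b * of_nat (totient (q div b))) *
      (\<Sum>chi\<in>dirichlet_chars (q div b). W * T b chi))"
    unfolding S_def sum_distrib_left by (simp add: mult_ac)
  also have "W = inverse (\<Prod>p | prime p \<and> p \<le> P. inverse (1 - 1 / of_nat p))"
    by (simp add: W_def prod_inversef [symmetric] o_def)
  finally show "Car_smooth P l (F_exp j q)
      = (\<Sum>b | b dvd q. 1 / (of_nat b * of_nat (totient (q div b))) *
      (\<Sum>chi\<in>dirichlet_chars (q div b). char_term P j (l div gcd l b) (q div b) chi))"
    by (simp add: char_term_def T_def divide_inverse mult_ac)
qed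

subsection \<open>The principal characters\<close>


text \<open>A divisor sum determines its summand by strong induction, because the term at n itself
  is what the smaller divisors leave over.\<close>

lemma divisor_sum_eq_imp_eq:
  fixes f g :: "nat \<Rightarrow> complex"
  assumes "\<And>n. n > 0 \<Longrightarrow> (\<Sum>d | d dvd n. f d) = (\<Sum>d | d dvd n. g d)" and "n > 0"
  shows "f n = g n"
  using assms(2)
proof (induction n rule: less_induct)
  case (less n)
  have fin: "finite {d. d dvd n}" "n \<in> {d. d dvd n}"
    using less.prems by auto
  have "(\<Sum>d\<in>{d. d dvd n} - {n}. f d) = (\<Sum>d\<in>{d. d dvd n} - {n}. g d)"
  proof (rule sum.cong)
    fix d assume "d \<in> {d. d dvd n} - {n}"
    then have "d \<le> n" "d \<noteq> n" "d > 0"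
      using less.prems by (auto intro: dvd_imp_le dvd_pos_nat)
    then have "d < n" "d > 0"
      by simp_all
    then show "f d = g d"
      by (rule less.IH)
  qed simp
  moreover have "(\<Sum>d | d dvd n. f d) = f n + (\<Sum>d\<in>{d. d dvd n} - {n}. f d)"
    "(\<Sum>d | d dvd n. g d) = g n + (\<Sum>d\<in>{d. d dvd n} - {n}. g d)"
    using fin by (simp_all add: sum.remove)
  ultimately show ?case
    using assms(1)[OF less.prems] by simp
qed

text \<open>The divisor formula says that the Ramanujan sum is the divisor sum of \<open>f\<close>,
  so its Eratosthenes transform is \<open>f\<close>. Since l divides q, \<open>f q\<close> is
  nonzero only for l = q.\<close>

lemma sum_ramanujan_moebius:
  assumes l: "l > 0" and q: "q > 0" and "l dvd q"
  shows "(\<Sum>b | b dvd q. ramanujan_sum l b * of_int (moebius_mu (q div b))) = (if l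
      = q then of_nat q else 0)"
proof -
  define f :: "nat \<Rightarrow> complex" where "f d
      = (if d dvd l then of_nat d * of_int (moebius_mu (l div d)) else 0)" for d
  have "(\<Sum>d | d dvd n. eratosthenes (ramanujan_sum l) d) = (\<Sum>d | d dvd n. f d)" if n: "n > 0" for n
  proof -
    have "(\<Sum>d | d dvd n. eratosthenes (ramanujan_sum l) d) =
        (\<Sum>d | d dvd l. if d dvd n then of_nat d * of_int (moebius_mu (l div d)) else 0)"
      unfolding sum_eratosthenes[OF n] by (rule ramanujan_sum_divisors[OF l])
    also have "\<dots> = (\<Sum>d | d dvd l \<and> d dvd n. of_nat d * of_int (moebius_mu (l div d)))"
      using l by (intro sum.mono_neutral_cong_right) auto
    also have "\<dots> = (\<Sum>d | d dvd n. f d)"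
      using n by (intro sum.mono_neutral_cong_left) (auto simp: f_def)
    finally show ?thesis .
  qed
  then have "eratosthenes (ramanujan_sum l) q = f q"
    using q by (rule divisor_sum_eq_imp_eq)
  moreover have "f q = (if l = q then of_nat q else 0)"
    using assms by (auto simp: f_def dest: dvd_antisym)
  ultimately show ?thesis
    by (simp add: eratosthenes_def)
qed

lemma gauss_sum_principal:
  assumes q: "q \<ge> 1"
  shows "gauss_sum q (\<lambda>m. cnj (principal_char q m)) = of_int (moebius_mu q)"
proof -
  have "gauss_sum q (\<lambda>m. cnj (principal_char q m)) = ramanujan_sum q 1"
    unfolding gauss_sum_def ramanujan_sum_def by (intro sum.cong) (auto simp: principal_char_def)
  then show ?thesis
    using ramanujan_sum_hoelder[of q 1] q by simp
qed

text \<open>Factors at primes not dividing q cancel. As q \<le> P, all primes of q occur in the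
  quotient, and they give \<phi>(q) / q.\<close>

lemma euler_product_ratio_principal:
  assumes q: "q \<ge> 1" "q \<le> P"
  shows "(\<Prod>p | prime p \<and> p \<le> P. inverse (1 - principal_char q p / of_nat p)) /
      (\<Prod>p | prime p \<and> p \<le> P. inverse (1 - 1 / of_nat p))
          = of_nat (totient q) / (of_nat q :: complex)"
proof -
  have "(\<Prod>p | prime p \<and> p \<le> P. inverse (1 - principal_char q p / of_nat p)) /
      (\<Prod>p | prime p \<and> p \<le> P. inverse (1 - 1 / of_nat p)) =
      (\<Prod>p | prime p \<and> p \<le> P. inverse (1 - principal_char q p / of_nat p) / inverse (1 - 1 / of_nat
          p))"
    by (rule prod_dividef [symmetric])
  also have "\<dots> = (\<Prod>p\<in>prime_factors q. 1 - 1 / of_nat p)"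
  proof (rule prod.mono_neutral_cong_right)
    show "prime_factors q \<subseteq> {p. prime p \<and> p \<le> P}"
      using q by (auto simp: in_prime_factors_iff intro: order.trans[OF dvd_imp_le])
    show "\<forall>p\<in>{p. prime p \<and> p \<le> P} - prime_factors q.
        inverse (1 - principal_char q p / of_nat p) / inverse (1 - 1 / of_nat p) = 1"
    proof
      fix p assume p: "p \<in> {p. prime p \<and> p \<le> P} - prime_factors q"
      then have "coprime p q"
        using q by (auto simp: in_prime_factors_iff intro: prime_imp_coprime_nat)
      moreover have "1 - 1 / of_nat p \<noteq> (0 :: complex)"
        using p prime_gt_1_nat[of p] by (auto simp: field_simps)
      ultimately show "inverse (1 - principal_char q p / of_nat p) / inverse (1 - 1 / of_nat p) = 1"
        by (simp add: principal_char_def)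
    qed
    show "inverse (1 - principal_char q p / of_nat p) / inverse (1 - 1 / of_nat p)
        = 1 - 1 / of_nat p"
      if "p \<in> prime_factors q" for p
    proof -
      have "prime p" "p dvd q"
        using that by auto
      then have "\<not> coprime p q"
        by (meson coprime_common_divisor dvd_refl not_prime_unit)
      then show ?thesis
        by (simp add: principal_char_def divide_inverse)
    qed
  qed simp
  also have "\<dots> = of_nat (totient q) / of_nat q"
    using q by (simp add: of_nat_totient)
  finally show ?thesis .
qed

text \<open>For n > 1 coprime to q, any prime of n contributes the factor 1 - 1; for n not coprime
  to q the character vanishes at n.\<close>

lemma principal_char_prod_factor:
  assumes "n > 0"
  shows "principal_char q n * (\<Prod>p\<in>prime_factors n. 1 - cnj (principal_char q p)) = (if n
      = 1 then 1 else 0)"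
proof (cases "n = 1")
  case False
  show ?thesis
  proof (cases "coprime n q")
    case True
    obtain p where p: "prime p" "p dvd n"
      using prime_factor_nat[OF False] by auto
    then have "coprime p q"
      using True by (meson coprime_divisors dvd_refl)
    then have "1 - cnj (principal_char q p) = 0"
      by (simp add: principal_char_def)
    moreover have "p \<in> prime_factors n"
      using p assms by (simp add: in_prime_factors_iff)
    ultimately have "(\<Prod>p\<in>prime_factors n. 1 - cnj (principal_char q p)) = 0"
      by (intro prod_zero) auto
    then show ?thesis
      using False by simp
  next
    case False
    then show ?thesis
      using \<open>n \<noteq> 1\<close> by (simp add: principal_char_def)
  qed
qed (simp add: principal_char_def)

lemma char_term_principal:
  assumes q: "q \<ge> 1" "q \<le> P" and j: "coprime j q" and l: "l > 0"
  shows "char_term P j l q (principal_char q) =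
    (if l dvd q then of_int (moebius_mu q) * (of_int (moebius_mu l) / of_nat (totient l)) *
       (of_nat (totient q) / of_nat q) else 0)"
proof -
  define l2 where "l2 = l div gcd l q"
  have eq: "l = gcd l q * l2"
    by (simp add: l2_def)
  then have "l2 > 0"
    using l by (metis gr0I mult_0_right)
  have iff: "l2 = 1 \<longleftrightarrow> l dvd q"
  proof
    assume "l2 = 1"
    then show "l dvd q"
      using eq by (metis gcd_dvd2 mult.right_neutral)
  next
    assume "l dvd q"
    then have "gcd l q = l"
      by (simp add: gcd_proj1_iff)
    then show "l2 = 1"
      using l by (simp add: l2_def)
  qed
  have "char_term P j l q (principal_char q) =
      of_int (moebius_mu q) * (of_int (moebius_mu (gcd l q)) / of_nat (totient l)) *
      (principal_char q l2 * (\<Prod>p\<in>prime_factors l2. 1 - cnj (principal_char q p))) *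
      (of_nat (totient q) / of_nat q)"
    unfolding char_term_def gauss_sum_principal[OF q(1)] euler_product_ratio_principal[OF q]
        l2_def [symmetric]
    using j by (simp add: principal_char_def)
  also have "\<dots> = (if l dvd q then of_int (moebius_mu q) * (of_int (moebius_mu l) / of_nat (totient
      l)) *
       (of_nat (totient q) / of_nat q) else 0)"
    unfolding principal_char_prod_factor[OF \<open>l2 > 0\<close>] iff by (simp add: gcd_proj1_iff)
  finally show ?thesis .
qed

text \<open>Read backwards, Hoelder's formula turns \<mu> / \<phi> at l div gcd l b into a Ramanujan
  sum at b, and all weights combine to 1 / (q \<phi>(l)). The sum over b is then the convolution of
  that Ramanujan sum with \<mu>, evaluated at q.\<close>

lemma sum_char_term_principal:
  assumes q: "q \<ge> 1" "q \<le> P" and j: "coprime j q" and l: "l > 0"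
  shows "(\<Sum>b | b dvd q. 1 / (of_nat b * of_nat (totient (q div b))) *
      char_term P j (l div gcd l b) (q div b) (principal_char (q div b))) =
    (if l = q then 1 else 0) * (1 / of_nat (totient q))"
proof -
  have "1 / (of_nat b * of_nat (totient (q div b))) *
      char_term P j (l div gcd l b) (q div b) (principal_char (q div b)) =
      (if l dvd q then 1 / (of_nat q * of_nat (totient l)) * (ramanujan_sum l b * of_int
          (moebius_mu (q div b))) else 0)"
    if b: "b dvd q" for b
  proof -
    define q1 where "q1 = q div b"
    have q_eq: "q = b * q1"
      using b by (simp add: q1_def)
    then have pos: "b > 0" "q1 \<ge> 1"
      using q by (auto simp: Suc_le_eq)
    then have "q1 \<le> P"
      using q q_eq by (metis dvd_imp_le dvd_triv_right less_le_trans order.trans zero_less_one)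
    define l1 where "l1 = l div gcd l b"
    have l_eq: "l = gcd l b * l1"
      by (simp add: l1_def)
    then have "l1 > 0"
      using l by (metis gr0I mult_0_right)
    \<comment> \<open>The divisibility condition does not depend on b, so it can be taken out of the
      sum.\<close>
    have iff: "l1 dvd q1 \<longleftrightarrow> l dvd q"
    proof
      assume "l1 dvd q1"
      then have "gcd l b * l1 dvd b * q1"
        by (intro mult_dvd_mono) simp_all
      then show "l dvd q"
        using l_eq q_eq by simp
    next
      assume "l dvd q"
      then have "l dvd l * q1" "l dvd b * q1"
        using q_eq by simp_all
      then have "l dvd gcd l b * q1"
        by (metis gcd_greatest gcd_mult_distrib_nat mult.commute)
      then have "gcd l b * l1 dvd gcd l b * q1"
        using l_eq by simp
      then show "l1 dvd q1"
        using l by simp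
    qed
    have "coprime j q1"
      using j q_eq by simp
    then have "char_term P j l1 q1 (principal_char q1) =
        (if l dvd q then of_int (moebius_mu q1) * (ramanujan_sum l b / of_nat (totient l)) *
         (of_nat (totient q1) / of_nat q1) else 0)"
      using char_term_principal[OF pos(2) \<open>q1
          \<le> P\<close> _ \<open>l1 > 0\<close>, of j] ramanujan_sum_hoelder[OF l, of b]
      by (simp add: iff l1_def [symmetric])
    then show ?thesis
      unfolding q1_def [symmetric] l1_def [symmetric] using pos by (simp add: q_eq mult_ac)
  qed
  then have "(\<Sum>b | b dvd q. 1 / (of_nat b * of_nat (totient (q div b))) *
      char_term P j (l div gcd l b) (q div b) (principal_char (q div b))) =
      (\<Sum>b | b dvd q. if l dvd q then 1 / (of_nat q * of_nat (totient l)) * (ramanujan_sum l b *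
          of_int (moebius_mu (q div b))) else 0)"
    by (intro sum.cong) auto
  also have "\<dots> = (if l = q then 1 else 0) * (1 / of_nat (totient q))"
  proof (cases "l dvd q")
    case True
    show ?thesis
      unfolding if_P[OF True] sum_distrib_left [symmetric]
      by (subst sum_ramanujan_moebius[OF l _ True]) (use q in auto)
  next
    case False
    then have "l \<noteq> q"
      by auto
    then show ?thesis
      using False by simp
  qed
  finally show ?thesis .
qed

lemma Car_smooth_F_exp:
  assumes q: "q \<ge> 1" "q \<le> P" and j: "coprime j q" and l: "l \<in> smooth P"
  shows "Car_smooth P l (F_exp j q) = Car l (F_exp j q) +
    (\<Sum>b | b dvd q. 1 / (of_nat b * of_nat (totient (q div b))) *
      (\<Sum>chi\<in>dirichlet_chars (q div b) - {principal_char (q div b)}.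
        char_term P j (l div gcd l b) (q div b) chi))"
proof -
  have l_pos: "l > 0"
    using l by (rule smooth_pos)
  have "(\<Sum>chi\<in>dirichlet_chars (q div b). char_term P j (l div gcd l b) (q div b) chi) =
      char_term P j (l div gcd l b) (q div b) (principal_char (q div b)) +
      (\<Sum>chi\<in>dirichlet_chars (q div b) - {principal_char (q div b)}. char_term P j (l div gcd l b)
          (q div b) chi)"
    if "b dvd q" for b
  proof -
    have "q div b \<ge> 1"
      using that q by (auto simp: Suc_le_eq elim!: dvdE)
    then show ?thesis
      by (intro sum.remove finite_dirichlet_chars principal_char_in_dirichlet_chars)
  qed
  then have "Car_smooth P l (F_exp j q) =
      (\<Sum>b | b dvd q. 1 / (of_nat b * of_nat (totient (q div b))) *
        (char_term P j (l div gcd l b) (q div b) (principal_char (q div b)) +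
         (\<Sum>chi\<in>dirichlet_chars (q div b) - {principal_char (q div b)}.
            char_term P j (l div gcd l b) (q div b) chi)))"
    unfolding Car_smooth_F_exp_all_chars(2)[OF q j l] by (intro sum.cong) auto
  also have "\<dots> = Car l (F_exp j q) + (\<Sum>b | b dvd q. 1 / (of_nat b * of_nat (totient (q div b))) *
      (\<Sum>chi\<in>dirichlet_chars (q div b) - {principal_char (q div b)}.
        char_term P j (l div gcd l b) (q div b) chi))"
    using sum_char_term_principal[OF q j l_pos] Car_F_exp(2)[OF q(1) j, of l] l_pos
    by (simp only: distrib_left sum.distrib)
  finally show ?thesis .
qed

text \<open>Extends the estimate from smooth \<open>l\<close> to all \<open>l\<close>, as uniformity
  requires.\<close>

lemma Car_smooth_nonsmooth:
  assumes F: "\<And>s. norm (F s) \<le> 1" and l: "l > 0" "l \<notin> smooth P"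
  shows "Car_smooth_exists P l F" "Car_smooth P l F = 0"
proof -
  have "has_mean (\<lambda>a. smooth_part P F a * ramanujan_sum l a) 0"
    by (rule has_mean_smooth_part[OF F has_mean_ramanujan_coprime_nonsmooth[OF l]]) simp_all
  from Car_eq[OF this] show "Car_smooth_exists P l F" "Car_smooth P l F = 0"
    by (simp_all add: Car_smooth_exists_def Car_smooth_def)
qed

subsection \<open>Bounding Euler products of characters\<close>


text \<open>A Chebyshev-type count: the sum over p \<le> n of ln p times the number of multiples of
  p up to n equals the sum over m \<le> n of ln p for the primes p dividing m, hence is at most n ln
  n. The factor 2 comes from n / p \<le> 2 * (n div p) for p \<le> n.\<close>

lemma sum_ln_primes_div_le:
  assumes n: "n \<ge> 1"
  shows "(\<Sum>p | prime p \<and> p \<le> n. ln (real p) / real p) \<le> 2 * ln (real n)"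
proof -
  have ln_m: "(\<Sum>p\<in>prime_factors m. ln (real p)) \<le> ln (real m)" if "m > 0" for m :: nat
  proof -
    have "(\<Prod>p\<in>prime_factors m. p) dvd (\<Prod>p\<in>prime_factors m. p ^ multiplicity p m)"
      by (intro prod_dvd_prod) (auto simp: prime_factors_multiplicity intro: dvd_power)
    also have "\<dots> = m"
      using that prime_factorization_nat[of m] by simp
    finally have le: "(\<Prod>p\<in>prime_factors m. p) \<le> m"
      using that by (rule dvd_imp_le)
    have pos: "(\<Prod>p\<in>prime_factors m. p) > 0"
      by (intro prod_pos) (auto dest: in_prime_factors_imp_prime prime_gt_0_nat)
    have "(\<Sum>p\<in>prime_factors m. ln (real p)) = ln (\<Prod>p\<in>prime_factors m. real p)"
      by (rule ln_prod [symmetric]) (auto dest: in_prime_factors_imp_prime prime_gt_0_nat)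
    also have "(\<Prod>p\<in>prime_factors m. real p) = real (\<Prod>p\<in>prime_factors m. p)"
      by simp
    also have "ln \<dots> \<le> ln (real m)"
      using le pos that by (intro ln_le_cancel_iff[THEN iffD2]) (simp_all del: of_nat_prod)
    finally show ?thesis .
  qed
  have half: "real n / real p \<le> 2 * real (n div p)" if p: "prime p" "p \<le> n" for p
  proof -
    have "p > 0"
      using p(1) by (rule prime_gt_0_nat)
    have "n = p * (n div p) + n mod p" "n mod p < p"
      using \<open>p > 0\<close> by simp_all
    moreover have "p * 1 \<le> p * (n div p)"
      using p \<open>p > 0\<close> by (intro mult_left_mono) (simp_all add: Suc_le_eq div_greater_zero_iff)
    ultimately have "n \<le> 2 * (p * (n div p))"
      by linarith
    then have "n \<le> 2 * (n div p) * p"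
      by (simp add: mult_ac)
    then have "real n \<le> 2 * real (n div p) * real p"
      by (metis of_nat_le_iff of_nat_mult of_nat_numeral)
    then show ?thesis
      using \<open>p > 0\<close> by (simp add: divide_le_eq)
  qed
  have card_mult: "(\<Sum>m\<in>{1..n}. if p dvd m then 1 else 0) = real (n div p)" if "p > 0" for p
    using sum_multiples[OF that, of "\<lambda>_. 1 :: real" n] by simp
  have "real n * (\<Sum>p | prime p \<and> p \<le> n. ln (real p) / real p)
      = (\<Sum>p | prime p \<and> p \<le> n. (real n / real p) * ln (real p))"
    by (simp add: sum_distrib_left)
  also have "\<dots> \<le> (\<Sum>p | prime p \<and> p \<le> n. 2 * real (n div p) * ln (real p))"
    using half by (intro sum_mono mult_right_mono) (auto dest: prime_ge_1_nat)
  also have "\<dots> = 2 * (\<Sum>p | prime p \<and> p \<le> n. \<Sum>m\<in>{1..n}. if p dvd m then ln (real p) else 0)"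
    unfolding sum_distrib_left
  proof (rule sum.cong)
    fix p assume "p \<in> {p. prime p \<and> p \<le> n}"
    then have "p > 0"
      by (auto dest: prime_gt_0_nat)
    have "(\<Sum>m\<in>{1..n}. 2 * (if p dvd m then ln (real p) else 0)) =
        (\<Sum>m\<in>{1..n}. (if p dvd m then 1 else 0) * (2 * ln (real p)))"
      by (rule sum.cong) auto
    also have "\<dots> = real (n div p) * (2 * ln (real p))"
      using card_mult[OF \<open>p > 0\<close>] by (simp only: sum_distrib_right [symmetric])
    finally show "2 * real (n div p) * ln (real p) = (\<Sum>m\<in>{1..n}. 2 * (if p dvd m then ln (real p)
        else 0))"
      by (simp only: mult_ac)
  qed simp
  also have "\<dots> = 2 * (\<Sum>m\<in>{1..n}. \<Sum>p | prime p \<and> p \<le> n. if p dvd m then ln (real p) else 0)"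
    by (subst sum.swap) simp
  also have "\<dots> = 2 * (\<Sum>m\<in>{1..n}. \<Sum>p\<in>prime_factors m. ln (real p))"
  proof -
    have "(\<Sum>p | prime p \<and> p \<le> n. if p dvd m then ln (real p) else 0)
        = (\<Sum>p\<in>prime_factors m. ln (real p))"
      if m: "m \<in> {1..n}" for m
      using m by (intro sum.mono_neutral_cong_right)
        (auto simp: in_prime_factors_iff intro: order.trans[OF dvd_imp_le])
    then show ?thesis
      by simp
  qed
  also have "\<dots> \<le> 2 * (\<Sum>m\<in>{1..n}. ln (real n))"
  proof (intro mult_left_mono sum_mono)
    fix m assume m: "m \<in> {1..n}"
    then have "(\<Sum>p\<in>prime_factors m. ln (real p)) \<le> ln (real m)"
      by (intro ln_m) auto
    also have "\<dots> \<le> ln (real n)"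
      using m by simp
    finally show "(\<Sum>p\<in>prime_factors m. ln (real p)) \<le> ln (real n)" .
  qed simp
  also have "\<dots> = real n * (2 * ln (real n))"
    by simp
  finally show ?thesis
    using n by (simp add: mult_le_cancel_left)
qed

text \<open>By 1 - exp (-x) \<le> x with x = d ln p, each difference is at most d ln p / p, and the
  choice of d cancels the ln P in the bound for the sum.\<close>

lemma sum_primes_diff_powr_le:
  fixes P :: nat
  assumes P: "P \<ge> 2"
  defines "d \<equiv> 1 / ln (real P)"
  shows "(\<Sum>p | prime p \<and> p \<le> P. 1 / real p - real p powr (-1 - d)) \<le> 2"
proof -
  have "ln (real P) > 0"
    using P by simp
  have "(\<Sum>p | prime p \<and> p \<le> P. 1 / real p - real p powr (-1 - d)) \<le> (\<Sum>p | prime p \<and> p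
      \<le> P. d * (ln (real p) / real p))"
  proof (rule sum_mono)
    fix p assume "p \<in> {p. prime p \<and> p \<le> P}"
    then have p: "p > 0"
      by (auto dest: prime_gt_0_nat)
    have "real p powr (-1 - d) = 1 / real p * exp (- (d * ln (real p)))"
      using p by (simp add: powr_def algebra_simps exp_diff exp_minus field_simps)
    moreover have "1 + - (d * ln (real p)) \<le> exp (- (d * ln (real p)))"
      by (rule exp_ge_add_one_self)
    ultimately have "1 / real p * (1 + - (d * ln (real p))) \<le> real p powr (-1 - d)"
      using p by (simp add: divide_right_mono)
    then show "1 / real p - real p powr (-1 - d) \<le> d * (ln (real p) / real p)"
      by (simp add: algebra_simps)
  qed
  also have "\<dots> = d * (\<Sum>p | prime p \<and> p \<le> P. ln (real p) / real p)"
    by (simp add: sum_distrib_left)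
  also have "\<dots> \<le> d * (2 * ln (real P))"
    using P \<open>ln (real P) > 0\<close> by (intro mult_left_mono sum_ln_primes_div_le) (auto simp: d_def)
  also have "\<dots> = 2"
    using \<open>ln (real P) > 0\<close> by (simp add: d_def)
  finally show ?thesis .
qed

lemma sum_div_two_power_le: "(\<Sum>k=1..K. real k * (1 / 2) ^ k) \<le> 2"
proof -
  have "(\<Sum>k=1..K. real k * (1 / 2) ^ k) = 2 - (real K + 2) * (1 / 2) ^ K"
    by (induction K) (auto simp: field_simps)
  then show ?thesis
    by simp
qed

text \<open>Group the primes into blocks P^(k-1) < p \<le> P^k. There p^(-1-d) = exp (-u) / p with u
  = ln p / ln P > k - 1, so a block contributes at most 4 k / 2^k, and these bounds sum to at most
  8.\<close>

lemma sum_primes_tail_powr_le: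
  fixes P :: nat
  assumes P: "P \<ge> 2"
  defines "d \<equiv> 1 / ln (real P)"
  shows "(\<Sum>p | prime p \<and> P < p \<and> p \<le> N. real p powr (-1 - d)) \<le> 8"
proof -
  define A where "A = {p. prime p \<and> P < p \<and> p \<le> N}"
  define k where "k p = nat \<lceil>ln (real p) / ln (real P)\<rceil>" for p :: nat
  have lnP: "ln (real P) > 0"
    using P by simp
  have fin: "finite A"
    by (rule finite_subset[of _ "{..N}"]) (auto simp: A_def)
  \<comment> \<open>Inserting 1 keeps the maximum defined even if there are no primes in the
    range.\<close>
  define K where "K = Max (insert 1 (k ` A))"
  have kK: "k ` A \<subseteq> {1..K}"
  proof
    fix i assume "i \<in> k ` A"
    then obtain p where p: "p \<in> A" "i = k p"
      by auto
    then have "real P < real p"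
      by (simp add: A_def)
    then have "ln (real p) / ln (real P) > 0"
      using P lnP by simp
    then have "k p \<ge> 1"
      by (simp add: k_def Suc_le_eq)
    moreover have "k p \<le> K"
      unfolding K_def using fin p by (intro Max_ge) auto
    ultimately show "i \<in> {1..K}"
      using p by simp
  qed
  have "(\<Sum>p\<in>A. real p powr (-1 - d))
      \<le> (\<Sum>p\<in>A. 2 * (1 / 2) ^ k p / ln (real P) * (ln (real p) / real p))"
  proof (rule sum_mono)
    fix p assume p: "p \<in> A"
    then have gt: "real P < real p" "p > 0"
      using P by (auto simp: A_def)
    define u where "u = ln (real p) / ln (real P)"
    have u1: "u \<ge> 1"
      using gt P lnP by (simp add: u_def)
    have ku: "real (k p) - 1 \<le> u"
      unfolding k_def u_def [symmetric] using u1 by linarith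
    have k1: "k p \<ge> 1"
      using kK p by auto
    have "exp (-1) \<le> (1 / 2 :: real)"
      using exp_ge_add_one_self[of "1 :: real"] by (simp add: exp_minus field_simps)
    then have "exp (-1) ^ (k p - 1) \<le> (1 / 2 :: real) ^ (k p - 1)"
      by (rule power_mono) simp
    moreover have "exp (- u) \<le> exp (-1) ^ (k p - 1)"
      using ku k1 by (simp add: exp_of_nat_mult [symmetric] of_nat_diff)
    moreover have "(1 / 2 :: real) ^ (k p - 1) = 2 * (1 / 2) ^ k p"
      using k1 by (cases "k p") auto
    ultimately have eu: "exp (- u) \<le> 2 * (1 / 2) ^ k p"
      by linarith
    have "real p powr (-1 - d) = exp (- u) * (1 / real p)"
      using gt by (simp add: powr_def u_def d_def algebra_simps exp_diff exp_minus field_simps)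
    \<comment> \<open>The extra factor u \<ge> 1 supplies the ln p needed to apply the bound for the
      sum of ln p / p.\<close>
    also have "\<dots> \<le> (2 * (1 / 2) ^ k p) * (u * (1 / real p))"
      using u1 gt eu mult_right_mono[of 1 u "1 / real p"] by (intro mult_mono) auto
    also have "\<dots> = 2 * (1 / 2) ^ k p / ln (real P) * (ln (real p) / real p)"
      by (simp add: u_def)
    finally show "real p powr (-1 - d) \<le> 2 * (1 / 2) ^ k p / ln (real P) * (ln (real p) / real p)" .
  qed
  also have "\<dots> = (\<Sum>i=1..K. \<Sum>p | p \<in> A \<and> k p
      = i. 2 * (1 / 2) ^ k p / ln (real P) * (ln (real p) / real p))"
    using kK fin by (intro sum.group [symmetric]) auto
  also have "\<dots> \<le> (\<Sum>i=1..K. 4 * (real i * (1 / 2) ^ i))"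
  proof (rule sum_mono)
    fix i assume i: "i \<in> {1..K}"
    have sub: "{p. p \<in> A \<and> k p = i} \<subseteq> {p. prime p \<and> p \<le> P ^ i}"
    proof
      fix p assume "p \<in> {p. p \<in> A \<and> k p = i}"
      then have p: "p \<in> A" "k p = i"
        by auto
      have "p > 0"
        using p by (auto simp: A_def)
      have "ln (real p) / ln (real P) \<le> real i"
        unfolding p(2) [symmetric] k_def by linarith
      then have "ln (real p) \<le> real i * ln (real P)"
        using lnP by (simp add: divide_le_eq)
      also have "\<dots> = ln (real (P ^ i))"
        using P by (simp add: ln_realpow)
      finally have "real p \<le> real (P ^ i)"
        using \<open>p > 0\<close> P by (subst (asm) ln_le_cancel_iff) auto
      then show "p \<in> {p. prime p \<and> p \<le> P ^ i}"
        using p by (auto simp: A_def simp del: of_nat_power)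
    qed
    have "(\<Sum>p | p \<in> A \<and> k p = i. 2 * (1 / 2) ^ k p / ln (real P) * (ln (real p) / real p))
        = 2 * (1 / 2) ^ i / ln (real P) * (\<Sum>p | p \<in> A \<and> k p = i. ln (real p) / real p)"
      unfolding sum_distrib_left by (rule sum.cong) auto
    also have "\<dots> \<le> 2 * (1 / 2) ^ i / ln (real P) * (2 * ln (real (P ^ i)))"
    proof (intro mult_left_mono)
      have "(\<Sum>p | p \<in> A \<and> k p = i. ln (real p) / real p) \<le> (\<Sum>p | prime p \<and> p
          \<le> P ^ i. ln (real p) / real p)"
        using sub by (intro sum_mono2) (auto dest: prime_ge_1_nat)
      also have "\<dots> \<le> 2 * ln (real (P ^ i))"
        using P by (intro sum_ln_primes_div_le) simp
      finally show "(\<Sum>p | p \<in> A \<and> k p = i. ln (real p) / real p) \<le> 2 * ln (real (P ^ i))" .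
    qed (use lnP in simp)
    also have "\<dots> = 4 * (real i * (1 / 2) ^ i)"
      using lnP P by (simp add: ln_realpow)
    finally show "(\<Sum>p | p \<in> A \<and> k p = i. 2 * (1 / 2) ^ k p / ln (real P) * (ln (real p) / real p))
        \<le> 4 * (real i * (1 / 2) ^ i)" .
  qed
  also have "\<dots> = 4 * (\<Sum>i=1..K. real i * (1 / 2) ^ i)"
    by (simp add: sum_distrib_left)
  also have "\<dots> \<le> 4 * 2"
    by (intro mult_left_mono sum_div_two_power_le) simp
  finally show ?thesis
    by (simp add: A_def)
qed

text \<open>Summation by parts: the differences of the decreasing weights are nonnegative and
  telescope.\<close>

lemma norm_sum_mult_antimono_le:
  fixes c :: "nat \<Rightarrow> complex" and a :: "nat \<Rightarrow> real"
  assumes B: "\<And>N. norm (\<Sum>m<N. c m) \<le> B" and a: "\<And>m. a (Suc m) \<le> a m" "\<And>m. a m \<ge> 0"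
  shows "norm (\<Sum>m<N. c m * of_real (a m)) \<le> B * a 0"
proof -
  have "B \<ge> 0"
    using B[of 0] by simp
  define S where "S N = (\<Sum>m<N. c m)" for N
  have "(\<Sum>m<N. c m * of_real (a m)) = S N * of_real (a N)
      + (\<Sum>m<N. S (Suc m) * of_real (a m - a (Suc m)))"
    by (induction N) (auto simp: S_def algebra_simps)
  also have "norm \<dots> \<le> B * a N + (\<Sum>m<N. B * (a m - a (Suc m)))"
  proof (intro norm_triangle_mono sum_norm_le)
    show "norm (S N * of_real (a N)) \<le> B * a N"
      using B[of N] a by (simp add: S_def norm_mult mult_right_mono)
    show "norm (S (Suc m) * of_real (a m - a (Suc m))) \<le> B * (a m - a (Suc m))" for m
      using B[of "Suc m"] a(1)[of m] \<open>B \<ge> 0\<close> unfolding norm_mult norm_of_real S_def [symmetric]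
      by (intro mult_mono) auto
  qed
  also have "\<dots> = B * a 0"
    unfolding sum_distrib_left [symmetric] sum_lessThan_telescope' by (simp add: algebra_simps)
  finally show ?thesis .
qed

text \<open>The Euler product is the sum over N-smooth t. Terms t \<le> N are bounded by summation
  by parts; the rest is dominated by a tail of a convergent series and is eventually below 1. The
  bound must not depend on s, which later approaches -1 as P grows. In n + 2, n bounds the character
  sums, 1 the term chi 0, and 1 the tail.\<close>

lemma eventually_norm_euler_product_le:
  assumes chi: "chi \<in> dirichlet_chars n" and n: "n \<ge> 1" and np: "chi \<noteq> principal_char n" and s: "s
      < -1"
  shows "\<forall>\<^sub>F N in sequentially.
    norm (\<Prod>p | prime p \<and> p \<le> N. inverse (1 - chi p * of_real (real p powr s))) \<le> real n + 2"
proof -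
  define g where "g t = real t powr s" for t :: nat
  define f where "f t = chi t * of_real (g t)" for t
  have f_mult: "f (a * b) = f a * f b" for a b
    by (simp add: f_def g_def dirichlet_charsD(1)[OF chi] powr_mult)
  have f_1: "f 1 = 1"
    using dirichlet_char_1[OF chi] by (simp add: f_def g_def)
  have f_norm: "norm (f t) \<le> g t" for t
    using norm_dirichlet_char_le[OF chi n, of t]
    by (simp add: f_def g_def norm_mult mult_left_le_one_le)
  have g_prime: "g p < 1" if "prime p" for p
    using prime_gt_1_nat[OF that] s by (simp add: g_def powr_less_one)
  have "summable g"
    using s by (simp add: g_def [abs_def] summable_real_powr_iff)
  have g_sum: "(g has_sum suminf g) UNIV"
    using \<open>summable g\<close> by (intro sums_nonneg_imp_has_sum summable_sums) (auto simp: g_def)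
  have partial: "norm (\<Sum>t=1..N. f t) \<le> real n + 1" for N
  proof -
    have "norm (\<Sum>m<N. chi (Suc m)) \<le> real n + 1" for N
    proof -
      have "(\<Sum>m<N. chi (Suc m)) = (\<Sum>m<Suc N. chi m) - chi 0"
        by (simp only: sum.lessThan_Suc_shift) simp
      also have "norm \<dots> \<le> norm (\<Sum>m<Suc N. chi m) + norm (chi 0)"
        by (rule norm_triangle_ineq4)
      also have "\<dots> \<le> real n + 1"
        by (intro add_mono norm_sum_dirichlet_char_le[OF chi n np] norm_dirichlet_char_le[OF chi n])
      finally show ?thesis .
    qed
    then have "norm (\<Sum>m<N. chi (Suc m) * of_real (g (Suc m))) \<le> (real n + 1) * g (Suc 0)"
      using s by (intro norm_sum_mult_antimono_le) (auto simp: g_def intro!: powr_mono2')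
    also have "(\<Sum>m<N. chi (Suc m) * of_real (g (Suc m))) = (\<Sum>t=1..N. f t)"
      by (rule sum.reindex_bij_witness[of _ "\<lambda>t. t - 1" Suc]) (auto simp: f_def)
    finally show ?thesis
      by (simp add: g_def)
  qed
  have le: "norm (\<Prod>p | prime p \<and> p \<le> N. inverse (1 - f p)) \<le> real n + 1
      + (suminf g - (\<Sum>t<Suc N. g t))" for N
  proof -
    define S where "S = (\<Prod>p | prime p \<and> p \<le> N. inverse (1 - f p))"
    have S: "(f has_sum S) (smooth N)"
      unfolding S_def
    proof (rule euler_product_smooth(1)[OF f_mult f_1])
      show "norm (f p) < 1" if "prime p" for p
        using f_norm[of p] g_prime[OF that] by simp
    qed
    have f_has: "(f has_sum (S - (\<Sum>t=1..N. f t))) (smooth N - {1..N})"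
      using S by (intro has_sum_Diff has_sum_finite) (auto intro: le_in_smooth)
    have g_has: "(g has_sum (suminf g - (\<Sum>t<Suc N. g t))) (UNIV - {..<Suc N})"
      using g_sum by (intro has_sum_Diff has_sum_finite) auto
    have sub: "smooth N - {1..N} \<subseteq> UNIV - {..<Suc N}"
      by (auto simp: not_le Suc_le_eq dest: smooth_pos)
    have "norm (S - (\<Sum>t=1..N. f t)) \<le> suminf g - (\<Sum>t<Suc N. g t)"
    proof -
      have g_on: "g summable_on (smooth N - {1..N})"
        using summable_on_subset[OF has_sum_imp_summable[OF g_has] sub] .
      have "norm (S - (\<Sum>t=1..N. f t)) \<le> infsum g (smooth N - {1..N})"
        using norm_infsum_le[OF f_has has_sum_infsum[OF g_on]] f_norm by blast
      also have "\<dots> \<le> suminf g - (\<Sum>t<Suc N. g t)"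
        using has_sum_mono2[OF has_sum_infsum[OF g_on] g_has sub] by (auto simp: g_def)
      finally show ?thesis .
    qed
    then show ?thesis
      using partial[of N] norm_triangle_sub[of S "\<Sum>t=1..N. f t"] by (simp add: S_def)
  qed
  have "(\<lambda>N. suminf g - (\<Sum>t<Suc N. g t)) \<longlonglongrightarrow> suminf g - suminf g"
    by (intro tendsto_diff tendsto_const LIMSEQ_Suc summable_LIMSEQ \<open>summable g\<close>)
  then have "\<forall>\<^sub>F N in sequentially. suminf g - (\<Sum>t<Suc N. g t) < 1"
    by (rule order_tendstoD) simp
  then show ?thesis
  proof eventually_elim
    case (elim N)
    then show ?case
      using le[of N] by (simp add: f_def g_def)
  qed
qed

text \<open>
  Shifting the exponent to \<open>1 + 1 / ln P\<close> changes the Euler product over \<open>p \<le> P\<close> by a bounded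
  factor and makes the factors with \<open>p > P\<close> harmless, so only the boundedness of \<open>L(s, chi)\<close> for
  real \<open>s > 1\<close> is needed, not \<open>L(1, chi) \<noteq> 0\<close>.
\<close>

lemma norm_euler_product_le:
  assumes chi: "chi \<in> dirichlet_chars n" and n: "n \<ge> 1" and np: "chi \<noteq> principal_char n" and P: "P
      \<ge> 2"
  shows "norm (\<Prod>p | prime p \<and> p \<le> P. inverse (1 - chi p / of_nat p)) \<le> exp 12 * (real n + 2)"
proof -
  define d where "d = 1 / ln (real P)"
  define a where "a p = real p powr (-1 - d)" for p :: nat
  have "d > 0"
    using P by (simp add: d_def)
  have "\<forall>\<^sub>F N in sequentially. norm (\<Prod>p | prime p \<and> p \<le> N. inverse (1 - chi p * of_real (a p)))
      \<le> real n + 2 \<and> N \<ge> P"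
    unfolding a_def using \<open>d > 0\<close>
    by (intro eventually_conj eventually_norm_euler_product_le[OF chi n np] eventually_ge_at_top)
        simp
  \<comment> \<open>How large N must be depends on P through the exponent, but the bound does
    not.\<close>
  then obtain N where N: "norm (\<Prod>p | prime p \<and> p \<le> N. inverse (1 - chi p * of_real (a p)))
      \<le> real n + 2" "N \<ge> P"
    using eventually_happens'[OF sequentially_bot] by blast
  have chi_le: "norm (chi p) \<le> 1" for p
    by (rule norm_dirichlet_char_le[OF chi n])
  have a_bounds: "0 < a p" "a p \<le> 1 / real p" "1 / real p \<le> 1 / 2" if "prime p" for p
  proof -
    have p: "real p \<ge> 2"
      using prime_ge_2_nat[OF that] by simp
    then show "0 < a p" "1 / real p \<le> 1 / 2"
      by (auto simp: a_def field_simps)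
    have "a p \<le> real p powr (-1)"
      unfolding a_def using p \<open>d > 0\<close> by (intro powr_mono) auto
    then show "a p \<le> 1 / real p"
      using p by (simp add: powr_minus_divide)
  qed
  have small: "norm (1 - chi p * of_real (a p))
      \<le> norm (1 - chi p / of_nat p) * exp (2 * (1 / real p - a p))"
    if "prime p" for p
  proof -
    have "1 - chi p * of_real (a p) = (1 - chi p / of_nat p) + chi p * of_real (1 / real p - a p)"
      by (simp add: algebra_simps)
    also have "norm \<dots> \<le> norm (1 - chi p / of_nat p) + norm (chi p * of_real (1 / real p - a p))"
      by (rule norm_triangle_ineq)
    also have "norm (chi p * of_real (1 / real p - a p)) \<le> 1 * (1 / real p - a p)"
      unfolding norm_mult norm_of_real using chi_le[of p] a_bounds[OF that]
          by (intro mult_mono) auto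
    \<comment> \<open>Since chi p / p has norm at most 1/2, the factor 1 - chi p / p has norm at
      least 1/2. This turns the additive error into a relative one.\<close>
    also have "1 * (1 / real p - a p) \<le> (2 * norm (1 - chi p / of_nat p)) * (1 / real p - a p)"
    proof (rule mult_right_mono)
      have "norm (chi p / of_nat p) \<le> 1 / real p"
        using chi_le[of p] by (simp add: norm_divide divide_right_mono)
      also have "\<dots> \<le> 1 / 2"
        by (rule a_bounds[OF that])
      finally show "1 \<le> 2 * norm (1 - chi p / of_nat p)"
        using norm_triangle_ineq2[of 1 "chi p / of_nat p"] by simp
    qed (use a_bounds[OF that] in simp)
    finally have "norm (1 - chi p * of_real (a p)) \<le> norm (1 - chi p / of_nat p) * (1
        + 2 * (1 / real p - a p))"
      by (simp add: algebra_simps)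
    also have "\<dots> \<le> norm (1 - chi p / of_nat p) * exp (2 * (1 / real p - a p))"
      by (intro mult_left_mono exp_ge_add_one_self) simp
    finally show ?thesis .
  qed
  have large: "norm (1 - chi p * of_real (a p)) \<le> exp (a p)" if "prime p" for p
  proof -
    have "norm (1 - chi p * of_real (a p)) \<le> 1 + norm (chi p * of_real (a p))"
      using norm_triangle_ineq4[of 1 "chi p * of_real (a p)"] by simp
    also have "norm (chi p * of_real (a p)) \<le> 1 * a p"
      unfolding norm_mult norm_of_real using chi_le[of p] a_bounds[OF that]
          by (intro mult_mono) auto
    also have "1 + 1 * a p \<le> exp (a p)"
      using exp_ge_add_one_self[of "a p"] by simp
    finally show ?thesis
      by simp
  qed
  have nz: "1 - chi p * of_real (a p) \<noteq> 0" "1 - chi p / of_nat p \<noteq> 0" if "prime p" for p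
  proof -
    have "norm (chi p * of_real (a p)) < 1" "norm (chi p / of_nat p) < 1"
      using mult_mono[OF chi_le[of p] a_bounds(2)[OF that]] divide_right_mono[OF chi_le[of p], of
          "real p"]
        a_bounds[OF that] by (auto simp: norm_mult norm_divide)
    then show "1 - chi p * of_real (a p) \<noteq> 0" "1 - chi p / of_nat p \<noteq> 0"
      by auto
  qed
  define X where "X = (\<Prod>p | prime p \<and> p \<le> P. norm (1 - chi p / of_nat p))"
  define Y where "Y = (\<Prod>p | prime p \<and> p \<le> N. norm (1 - chi p * of_real (a p)))"
  have "X > 0" "Y > 0"
    unfolding X_def Y_def using nz by (auto intro!: prod_pos)
  have split: "{p. prime p \<and> p \<le> N} = {p. prime p \<and> p \<le> P} \<union> {p. prime p \<and> P < p \<and> p \<le> N}"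
    using N(2) by auto
  have fin: "finite {p. prime p \<and> P < p \<and> p \<le> N}"
    by (rule finite_subset[of _ "{..N}"]) auto
  have "Y = (\<Prod>p | prime p \<and> p \<le> P. norm (1 - chi p * of_real (a p))) *
      (\<Prod>p | prime p \<and> P < p \<and> p \<le> N. norm (1 - chi p * of_real (a p)))"
    unfolding Y_def split using fin by (intro prod.union_disjoint) auto
  also have "\<dots> \<le> (\<Prod>p | prime p \<and> p
      \<le> P. norm (1 - chi p / of_nat p) * exp (2 * (1 / real p - a p))) *
      (\<Prod>p | prime p \<and> P < p \<and> p \<le> N. exp (a p))"
    using small large by (intro mult_mono prod_mono prod_nonneg) auto
  also have "\<dots> = X * exp (2 * (\<Sum>p | prime p \<and> p \<le> P. 1 / real p - a p) + (\<Sum>p | prime p \<and> P < p \<and> p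
      \<le> N. a p))"
    using fin by (simp add: X_def prod.distrib exp_add exp_sum sum_distrib_left)
  \<comment> \<open>12 = 2 * 2 + 8, from the bound 2 for the primes up to P and 8 for the
    tail.\<close>
  also have "\<dots> \<le> X * exp 12"
    using sum_primes_diff_powr_le[OF P] sum_primes_tail_powr_le[OF P, of N] \<open>X > 0\<close>
    by (intro mult_left_mono) (auto simp: a_def d_def)
  finally have "Y \<le> X * exp 12" .
  have "inverse X \<le> exp 12 * inverse Y"
    using \<open>Y \<le> X * exp 12\<close> \<open>X > 0\<close> \<open>Y > 0\<close> by (simp add: field_simps)
  also have "inverse Y \<le> real n + 2"
    using N(1) by (simp add: Y_def prod_norm [symmetric] norm_inverse prod_inversef [unfolded
        o_def])
  finally show ?thesis
    by (simp add: X_def prod_norm [symmetric] norm_inverse prod_inversef [unfolded o_def])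
qed

subsection \<open>Uniform estimates\<close>


text \<open>Each factor has norm at most 2, and 2 \<le> p - 1 except at p = 2, which costs one extra
  factor 2. The product of all p - 1 is at most \<phi>(n).\<close>

lemma norm_prod_dirichlet_char_le:
  assumes chi: "chi \<in> dirichlet_chars q" and q: "q \<ge> 1" and n: "n > 0"
  shows "norm (\<Prod>p\<in>prime_factors n. 1 - cnj (chi p)) \<le> 2 * real (totient n)"
proof -
  have "norm (\<Prod>p\<in>prime_factors n. 1 - cnj (chi p)) \<le> (\<Prod>p\<in>prime_factors n. 2)"
    unfolding prod_norm [symmetric]
  proof (rule prod_mono)
    show "0 \<le> norm (1 - cnj (chi p)) \<and> norm (1 - cnj (chi p)) \<le> 2" for p
      using norm_triangle_ineq4[of 1 "cnj (chi p)"] norm_dirichlet_char_le[OF chi q, of p] by simp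
  qed
  also have "\<dots> \<le> (\<Prod>p\<in>prime_factors n. if p = 2 then 2 else 1) * (\<Prod>p\<in>prime_factors n. real p - 1)"
    unfolding prod.distrib [symmetric]
  proof (rule prod_mono)
    fix p assume "p \<in> prime_factors n"
    then have "p \<ge> 2"
      by (auto intro: prime_ge_2_nat)
    then show "0 \<le> (2 :: real) \<and> 2 \<le> (if p = 2 then 2 else 1) * (real p - 1)"
      by auto
  qed
  also have "\<dots> \<le> 2 * real (totient n)"
  proof (rule mult_mono)
    have "(\<Prod>p\<in>prime_factors n. if p = 2 then 2 else 1 :: real) = (if 2 \<in> prime_factors n then 2
        else 1)"
      by (simp add: prod.delta)
    then show "(\<Prod>p\<in>prime_factors n. if p = 2 then 2 else 1 :: real) \<le> 2"
      by simp
    have "(\<Prod>p\<in>prime_factors n. real p - 1)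
        \<le> (\<Prod>p\<in>prime_factors n. real (p ^ (multiplicity p n - 1) * (p - 1)))"
    proof (rule prod_mono)
      fix p assume "p \<in> prime_factors n"
      then have p: "p \<ge> 2"
        by (auto intro: prime_ge_2_nat)
      then have "1 * (p - 1) \<le> p ^ (multiplicity p n - 1) * (p - 1)"
        by (intro mult_right_mono) auto
      then have "real (p - 1) \<le> real (p ^ (multiplicity p n - 1) * (p - 1))"
        by (metis of_nat_le_iff mult_1)
      then show "0 \<le> real p - 1 \<and> real p - 1 \<le> real (p ^ (multiplicity p n - 1) * (p - 1))"
        using p by (simp add: of_nat_diff)
    qed
    then show "(\<Prod>p\<in>prime_factors n. real p - 1) \<le> real (totient n)"
      using totient_formula1[OF n] by simp
  qed (auto intro!: prod_nonneg dest!: in_prime_factors_imp_prime prime_ge_1_nat)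
  finally show ?thesis .
qed

text \<open>The denominator \<phi>(l) cancels the bound for the product over the primes of l / gcd l
  q, which is what removes \<open>l\<close> from the estimate.\<close>

lemma norm_char_term_le:
  assumes chi: "chi \<in> dirichlet_chars q" and q: "q \<ge> 1" and np: "chi \<noteq> principal_char q"
    and P: "P \<ge> 2" and l: "l > 0"
  shows "norm (char_term P j l q chi) \<le>
    2 * norm (gauss_sum q (\<lambda>m. cnj (chi m))) * (exp 12 * (real q + 2)) / ln (real P)"
proof -
  define l2 where "l2 = l div gcd l q"
  have l_eq: "l = gcd l q * l2"
    by (simp add: l2_def)
  then have "l2 > 0"
    using l by (metis gr0I mult_0_right)
  have "l2 dvd l"
    using l_eq by (metis dvd_triv_right)
  have lnP: "ln (real P) > 0"
    using P by simp
  define L where "L = (\<Prod>p | prime p \<and> p \<le> P. inverse (1 - chi p / of_nat p))"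
  define Z where "Z = (\<Prod>p | prime p \<and> p \<le> P. inverse (1 - 1 / real p))"
  have Z: "(\<Prod>p | prime p \<and> p \<le> P. inverse (1 - 1 / of_nat p)) = complex_of_real Z"
    by (simp add: Z_def)
  have "ln (real P) \<le> Z"
    unfolding Z_def using P by (intro ln_le_prod_primes) simp
  have LZ: "norm (L / complex_of_real Z) \<le> exp 12 * (real q + 2) / ln (real P)"
  proof -
    have "norm (L / complex_of_real Z) = norm L / Z"
      using lnP \<open>ln (real P) \<le> Z\<close> by (simp add: norm_divide)
    also have "\<dots> \<le> exp 12 * (real q + 2) / ln (real P)"
      unfolding L_def using norm_euler_product_le[OF chi q np P] lnP \<open>ln (real P) \<le> Z\<close>
      by (intro frac_le) auto
    finally show ?thesis .
  qed
  have mid: "norm (of_int (moebius_mu (gcd l q)) * chi l2 / of_nat (totient l))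
      \<le> 1 / real (totient l)"
    unfolding norm_mult norm_divide
        using norm_moebius_mu_le[of "gcd l q"] norm_dirichlet_char_le[OF chi q, of l2]
      mult_mono[of "norm (of_int (moebius_mu (gcd l q)) :: complex)" 1 "norm (chi l2)" 1]
    by (simp add: divide_right_mono)
  have pr: "norm (\<Prod>p\<in>prime_factors l2. 1 - cnj (chi p)) \<le> 2 * real (totient l)"
  proof -
    have "totient l2 \<le> totient l"
      using \<open>l2 dvd l\<close> l by (rule totient_dvd_mono)
    then show ?thesis
      using norm_prod_dirichlet_char_le[OF chi q \<open>l2 > 0\<close>] by linarith
  qed
  have "norm (char_term P j l q chi) =
      norm (gauss_sum q (\<lambda>m. cnj (chi m))) * norm (chi j) *
      norm (of_int (moebius_mu (gcd l q)) * chi l2 / of_nat (totient l)) *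
      norm (\<Prod>p\<in>prime_factors l2. 1 - cnj (chi p)) * norm (L / complex_of_real Z)"
    unfolding char_term_def l2_def [symmetric] L_def [symmetric] Z by (simp only: norm_mult)
  also have "\<dots> \<le> norm (gauss_sum q (\<lambda>m. cnj (chi m))) * 1 * (1 / real (totient l)) *
      (2 * real (totient l)) * (exp 12 * (real q + 2) / ln (real P))"
    using norm_dirichlet_char_le[OF chi q, of j] LZ mid pr by (intro mult_mono) auto
  also have "\<dots> = 2 * norm (gauss_sum q (\<lambda>m. cnj (chi m))) * (exp 12 * (real q + 2)) / ln (real P)"
    using l by simp
  finally show ?thesis .
qed

text \<open>Existence of the limits is asserted along with each formula, because \<open>Lim\<close>
  is unspecified otherwise. Choosing C before j, P and l expresses uniformity with dependence on q
  alone.\<close>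

theorem theorem5:
  fixes q :: nat
  assumes "q \<ge> 1"
  shows
    "(\<forall>j P l. 1 \<le> j \<and> j \<le> q \<and> coprime j q \<and> prime P \<and> q \<le> P \<and> l \<in> smooth P \<longrightarrow>
        Car_exists l (F_exp j q) \<and> Car_smooth_exists P l (F_exp j q) \<and>
        Car_smooth P l (F_exp j q) = Car l (F_exp j q) +
          (\<Sum>b | b dvd q.
             let q' = q div b; l' = l div gcd l b; q'' = gcd l' q'; l'' = l' div q'' in
             1 / (of_nat b * of_nat (totient q')) *
             (\<Sum>chi\<in>dirichlet_chars q' - {principal_char q'}.
                gauss_sum q' (\<lambda>m. cnj (chi m)) * chi j *
                (of_int (moebius_mu q'') * chi l'' / of_nat (totient l')) *
                (\<Prod>p\<in>prime_factors l''. 1 - cnj (chi p)) *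
                ((\<Prod>p | prime p \<and> p \<le> P. inverse (1 - chi p / of_nat p)) /
                 (\<Prod>p | prime p \<and> p \<le> P. inverse (1 - 1 / of_nat p))))))
     \<and>
     (\<exists>C::real. \<forall>j P l. 1 \<le> j \<and> j \<le> q \<and> coprime j q \<and> prime P \<and> q \<le> P \<and> 1 \<le> l \<longrightarrow>
        Car_exists l (F_exp j q) \<and> Car_smooth_exists P l (F_exp j q) \<and>
        norm (Car_smooth P l (F_exp j q) - Car l (F_exp j q)) \<le> C / ln (real P) \<and>
        norm (Car_smooth P l (F_exp j q) - (if l = q then 1 else 0) * (1 / of_nat (totient q)))
          \<le> C / ln (real P))"
proof (intro conjI allI impI)
  fix j P l
  assume asm: "1 \<le> j \<and> j \<le> q \<and> coprime j q \<and> prime P \<and> q \<le> P \<and> l \<in> smooth P"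
  then have l: "l \<ge> 1"
    using smooth_pos[of l P] by simp
  show "Car_exists l (F_exp j q)"
    using asm l assms by (intro Car_F_exp) auto
  show "Car_smooth_exists P l (F_exp j q)"
    using asm assms by (intro Car_smooth_F_exp_all_chars) auto
  show "Car_smooth P l (F_exp j q) = Car l (F_exp j q) +
          (\<Sum>b | b dvd q.
             let q' = q div b; l' = l div gcd l b; q'' = gcd l' q'; l'' = l' div q'' in
             1 / (of_nat b * of_nat (totient q')) *
             (\<Sum>chi\<in>dirichlet_chars q' - {principal_char q'}.
                gauss_sum q' (\<lambda>m. cnj (chi m)) * chi j *
                (of_int (moebius_mu q'') * chi l'' / of_nat (totient l')) *
                (\<Prod>p\<in>prime_factors l''. 1 - cnj (chi p)) *
                ((\<Prod>p | prime p \<and> p \<le> P. inverse (1 - chi p / of_nat p)) /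
                 (\<Prod>p | prime p \<and> p \<le> P. inverse (1 - 1 / of_nat p)))))"
    unfolding Let_def char_term_def [symmetric] using asm assms by (intro Car_smooth_F_exp) auto
next
  \<comment> \<open>The bound of \<open>norm_char_term_le\<close> without 1 / ln P. It involves
    neither j, P nor l, and summed over all b and all characters it gives C.\<close>
  define B where "B b chi = 2 * norm (gauss_sum (q div b) (\<lambda>m. cnj (chi m))) * (exp 12 * (real (q
      div b) + 2))"
    for b and chi :: "nat \<Rightarrow> complex"
  define C where "C = (\<Sum>b | b dvd q. \<Sum>chi\<in>dirichlet_chars (q div b) - {principal_char (q div b)}.
      B b chi)"
  have B_nonneg: "B b chi \<ge> 0" for b chi
    by (simp add: B_def)
  have C_nonneg: "C \<ge> 0"
    unfolding C_def by (intro sum_nonneg B_nonneg)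
  have main: "Car_exists l (F_exp j q) \<and> Car_smooth_exists P l (F_exp j q) \<and>
      norm (Car_smooth P l (F_exp j q) - Car l (F_exp j q)) \<le> C / ln (real P)"
    if j: "coprime j q" and P: "prime P" "q \<le> P" and l: "l \<ge> 1" for j P l
  proof (intro conjI)
    have P2: "P \<ge> 2"
      using P(1) by (rule prime_ge_2_nat)
    then have lnP: "ln (real P) > 0"
      by simp
    show "Car_exists l (F_exp j q)"
      by (rule Car_F_exp[OF assms j l])
    show "Car_smooth_exists P l (F_exp j q)"
    proof (cases "l \<in> smooth P")
      case True
      then show ?thesis
        by (rule Car_smooth_F_exp_all_chars[OF assms P(2) j])
    next
      case False
      then show ?thesis
        using l by (intro Car_smooth_nonsmooth) (simp_all add: F_exp_def)
    qed
    show "norm (Car_smooth P l (F_exp j q) - Car l (F_exp j q)) \<le> C / ln (real P)"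
    proof (cases "l \<in> smooth P")
      case False
      \<comment> \<open>As q is smooth and \<open>l\<close> is not, l \<noteq> q, so the ordinary
        coefficient vanishes together with the smooth one.\<close>
      have "q \<in> smooth P"
        using assms P by (intro le_in_smooth)
      then have "l \<noteq> q"
        using False by auto
      then have "Car l (F_exp j q) = 0"
        using Car_F_exp(2)[OF assms j l] by simp
      moreover have "Car_smooth P l (F_exp j q) = 0"
        using False l by (intro Car_smooth_nonsmooth) (simp_all add: F_exp_def)
      ultimately show ?thesis
        using C_nonneg lnP by simp
    next
      case True
      have "norm (Car_smooth P l (F_exp j q) - Car l (F_exp j q)) =
          norm (\<Sum>b | b dvd q. 1 / (of_nat b * of_nat (totient (q div b))) *
            (\<Sum>chi\<in>dirichlet_chars (q div b) - {principal_char (q div b)}.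
              char_term P j (l div gcd l b) (q div b) chi))"
        unfolding Car_smooth_F_exp[OF assms P(2) j True] by simp
      also have "\<dots> \<le> (\<Sum>b | b dvd q. \<Sum>chi\<in>dirichlet_chars (q div b) - {principal_char (q div b)}.
          B b chi / ln (real P))"
      proof (rule sum_norm_le)
        fix b assume "b \<in> {b. b dvd q}"
        then have b: "b dvd q"
          by simp
        then have pos: "b \<ge> 1" "q div b \<ge> 1"
          using assms by (auto simp: Suc_le_eq elim!: dvdE)
        have "l div gcd l b > 0"
          using l by (metis dvd_div_eq_0_iff gcd_dvd1 gr0I not_one_le_zero)
        define S where "S = (\<Sum>chi\<in>dirichlet_chars (q div b) - {principal_char (q div b)}.
            char_term P j (l div gcd l b) (q div b) chi)"
        have "totient (q div b) \<ge> 1"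
          using pos by (simp add: Suc_le_eq)
        then have "1 * 1 \<le> b * totient (q div b)"
          using pos by (intro mult_le_mono) auto
        then have "1 \<le> real (b * totient (q div b))"
          by (metis mult_1 of_nat_1 of_nat_mono)
        then have "norm (1 / (of_nat b * of_nat (totient (q div b))) :: complex) \<le> 1"
          by (simp add: norm_divide norm_mult divide_le_eq)
        then have "norm (1 / (of_nat b * of_nat (totient (q div b))) * S) \<le> 1 * norm S"
          unfolding norm_mult[of _ S] by (rule mult_right_mono) simp
        also have "1 * norm S \<le> (\<Sum>chi\<in>dirichlet_chars (q div b) - {principal_char (q div b)}. B b
            chi / ln (real P))"
          unfolding S_def mult_1 B_def using pos P2 \<open>l div gcd l b > 0\<close>
          by (intro sum_norm_le norm_char_term_le) auto
        finally show "norm (1 / (of_nat b * of_nat (totient (q div b))) *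
            (\<Sum>chi\<in>dirichlet_chars (q div b) - {principal_char (q div b)}.
              char_term P j (l div gcd l b) (q div b) chi)) \<le>
            (\<Sum>chi\<in>dirichlet_chars (q div b) - {principal_char (q div b)}. B b chi / ln (real P))"
          unfolding S_def .
      qed
      also have "\<dots> = C / ln (real P)"
        by (simp add: C_def sum_divide_distrib)
      finally show ?thesis .
    qed
  qed
  show "\<exists>C::real. \<forall>j P l. 1 \<le> j \<and> j \<le> q \<and> coprime j q \<and> prime P \<and> q \<le> P \<and> 1 \<le> l \<longrightarrow>
        Car_exists l (F_exp j q) \<and> Car_smooth_exists P l (F_exp j q) \<and>
        norm (Car_smooth P l (F_exp j q) - Car l (F_exp j q)) \<le> C / ln (real P) \<and>
        norm (Car_smooth P l (F_exp j q) - (if l = q then 1 else 0) * (1 / of_nat (totient q)))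
          \<le> C / ln (real P)"
  proof (rule exI[of _ C], intro allI impI)
    fix j P l :: nat
    assume asm: "1 \<le> j \<and> j \<le> q \<and> coprime j q \<and> prime P \<and> q \<le> P \<and> 1 \<le> l"
    then have "Car l (F_exp j q) = (if l = q then 1 else 0) * (1 / of_nat (totient q))"
      using assms by (intro Car_F_exp) auto
    then show "Car_exists l (F_exp j q) \<and> Car_smooth_exists P l (F_exp j q) \<and>
        norm (Car_smooth P l (F_exp j q) - Car l (F_exp j q)) \<le> C / ln (real P) \<and>
        norm (Car_smooth P l (F_exp j q) - (if l = q then 1 else 0) * (1 / of_nat (totient q)))
          \<le> C / ln (real P)"
      using main[of j P l] asm by auto
  qed
qed

end
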